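(* Let $(\Omega,\mathfrak F,\mathbb P,(\theta_t)_{t\in\mathbb R})$ be a metric dynamical system, let $K>0$, and let $(\mu_\omega)_{\omega\in\Omega}$ be a family in $\mathfrak m$ such that for every $T>0$ and every $\omega\in\Omega$ the path $(\mu_{\theta_t\omega})_{t\in[0,T]}$ belongs to $\mathfrak m_T$, and for every $T>0$ the map $\Omega\ni\omega\mapsto(\mu_{\theta_t\omega})_{t\in[0,T]}\in\mathfrak m_T$ is $(\mathfrak F,\Sigma_T)$-measurable. Then for every $t\ge0$ and every $u_0\in AC([-1,0])$ the mapping $$\Omega\ni\omega\mapsto U_\omega(t)u_0\in AC([-1,0])$$ is $(\mathfrak F,\mathfrak B(AC([-1,0])))$-measurable.
   Context: A metric dynamical system consists of a probability space $(\Omega,\mathfrak F,\mathbb P)$ with $\mathbb P$ complete and a $(\mathfrak B(\mathbb R)\otimes\mathfrak F,\mathfrak F)$-measurable map $\theta:\mathbb R\times\Omega\to\Omega$, $\theta_t\omega=\theta(t,\omega)$, with $\theta_0=\mathrm{id}$, $\theta_{t+s}=\theta_t\circ\theta_s$, and each $\theta_t$ preserving $\mathbb P$. $\mathfrak m$ is the set of finite signed Borel measures on $[-1,0]$ with total variation norm at most $K$. $\mathfrak m_T$ is the set of all maps $\mu:[0,T]\to\mathfrak m$, $t\mapsto\mu_t$, such that for every $f\in C([-1,0])$ the function $t\mapsto\int_{[-1,0]}f\,d\mu_t$ is Lebesgue measurable on $[0,T]$. $\Sigma_T$ is the smallest $\sigma$-algebra on $\mathfrak m_T$ making all maps $\mu\mapsto\int_0^t\int_{[-1,0]}y(\tau+s)\,d\mu_\tau(s)\,d\tau$,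 $y\in AC([-1,T])$, $t\in[0,T]$, Borel measurable. $AC([a,b])$ is the Banach space of real absolutely continuous functions with norm $|u(a)|+\int_a^b|u'|$. For $u_0\in AC([-1,0])$, let $z$ be the unique continuous function on $[-1,\infty)$ with $z=u_0$ on $[-1,0]$ and $z(t)=u_0(0)+\int_0^t\int_{[-1,0]}z(\tau+r)\,d\mu_{\theta_\tau\omega}(r)\,d\tau$ for $t\ge0$; then $(U_\omega(t)u_0)(s)=z(t+s)$, $s\in[-1,0]$. *)

theory Defs
  imports "HOL-Probability.Probability"
begin

locale metric_dynamical_system =
  prob_space M + complete_measure M for M :: "'w measure" +
  fixes \<theta> :: "real \<Rightarrow> 'w \<Rightarrow> 'w"
  assumes flow_measurable: "(\<lambda>(t, \<omega>). \<theta> t \<omega>) \<in> borel \<Otimes>\<^sub>M M \<rightarrow>\<^sub>M M"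
    and flow_zero: "\<omega> \<in> space M \<Longrightarrow> \<theta> 0 \<omega> = \<omega>"
    and flow_add: "\<omega> \<in> space M \<Longrightarrow> \<theta> (t + s) \<omega> = \<theta> t (\<theta> s \<omega>)"
    and flow_preserves: "distr M M (\<theta> t) = M"

text \<open>A finite signed measure is a real set function on the \<open>\<sigma>\<close>-algebra, extended by 0
  to non-measurable sets so that it is determined by its values on measurable ones.\<close>

definition signed_measure :: "'a measure \<Rightarrow> ('a set \<Rightarrow> real) \<Rightarrow> bool" where
  "signed_measure M \<nu> \<longleftrightarrow>
     \<nu> {} = 0 \<and>
     (\<forall>A :: nat \<Rightarrow> 'a set. range A \<subseteq> sets M \<longrightarrow> disjoint_family A \<longrightarrow>
        (\<lambda>i. \<nu> (A i)) sums \<nu> (\<Union>i. A i)) \<and>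
     (\<forall>A. A \<notin> sets M \<longrightarrow> \<nu> A = 0)"

definition tv_norm :: "'a measure \<Rightarrow> ('a set \<Rightarrow> real) \<Rightarrow> ennreal" where
  "tv_norm M \<nu> =
     (SUP P \<in> {P. finite P \<and> P \<subseteq> sets M \<and> partition_on (space M) P}.
        \<Sum>A\<in>P. ennreal \<bar>\<nu> A\<bar>)"

text \<open>The positive part \<open>\<nu>\<^sup>+(A) = sup {\<nu>(B) | B \<subseteq> A}\<close> of the Jordan decomposition; the
  negative part is the positive part of \<open>- \<nu>\<close>. Negative values are cut off by
  \<^term>\<open>ennreal\<close>, which does not change the supremum, as \<open>B = {}\<close> is admitted.\<close>

definition jordan_pos :: "'a measure \<Rightarrow> ('a set \<Rightarrow> real) \<Rightarrow> 'a measure" where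
  "jordan_pos M \<nu> =
     measure_of (space M) (sets M) (\<lambda>A. SUP B \<in> {B \<in> sets M. B \<subseteq> A}. ennreal (\<nu> B))"

definition signed_integral :: "'a measure \<Rightarrow> ('a set \<Rightarrow> real) \<Rightarrow> ('a \<Rightarrow> real) \<Rightarrow> real" where
  "signed_integral M \<nu> f =
     (\<integral>x. f x \<partial>jordan_pos M \<nu>) - (\<integral>x. f x \<partial>jordan_pos M (\<lambda>A. - \<nu> A))"

abbreviation borel_I :: "real measure" where
  "borel_I \<equiv> restrict_space borel {-1..0}"

definition delay_measures :: "real \<Rightarrow> (real set \<Rightarrow> real) set" where
  "delay_measures K = {\<nu>. signed_measure borel_I \<nu> \<and> tv_norm borel_I \<nu> \<le> ennreal K}"

definition abs_continuous_on_Icc :: "real \<Rightarrow> real \<Rightarrow> (real \<Rightarrow> real) \<Rightarrow> bool" where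
  "abs_continuous_on_Icc a b u \<longleftrightarrow>
     (\<forall>\<epsilon>>0. \<exists>\<delta>>0. \<forall>(n :: nat) (l :: nat \<Rightarrow> real) (r :: nat \<Rightarrow> real).
        (\<forall>i<n. a \<le> l i \<and> l i \<le> r i \<and> r i \<le> b) \<and>
        disjoint_family_on (\<lambda>i. {l i<..<r i}) {..<n} \<and>
        (\<Sum>i<n. r i - l i) < \<delta>
        \<longrightarrow> (\<Sum>i<n. \<bar>u (r i) - u (l i)\<bar>) < \<epsilon>)"

text \<open>Functions on \<open>[a, b]\<close> are represented by their extensional versions on the whole line.
  The norm only depends on the values in \<open>[a, b]\<close>. An absolutely continuous function is
  differentiable almost everywhere, so the value of \<^const>\<open>deriv\<close> at the other points is
  irrelevant for the Lebesgue integral.\<close>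

definition AC :: "real \<Rightarrow> real \<Rightarrow> (real \<Rightarrow> real) set" where
  "AC a b = {u \<in> extensional {a..b}. abs_continuous_on_Icc a b u}"

definition AC_norm :: "real \<Rightarrow> real \<Rightarrow> (real \<Rightarrow> real) \<Rightarrow> real" where
  "AC_norm a b u = \<bar>u a\<bar> + (LINT x:{a..b}|lebesgue. \<bar>deriv u x\<bar>)"

definition AC_dist :: "real \<Rightarrow> real \<Rightarrow> (real \<Rightarrow> real) \<Rightarrow> (real \<Rightarrow> real) \<Rightarrow> real" where
  "AC_dist a b u v = AC_norm a b (\<lambda>x. u x - v x)"

definition AC_borel :: "real \<Rightarrow> real \<Rightarrow> (real \<Rightarrow> real) measure" where
  "AC_borel a b = sigma (AC a b) {U. openin (Metric_space.mtopology (AC a b) (AC_dist a b)) U}"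

definition measure_paths :: "real \<Rightarrow> real \<Rightarrow> (real \<Rightarrow> real set \<Rightarrow> real) set" where
  "measure_paths K T =
     {\<mu> \<in> {0..T} \<rightarrow>\<^sub>E delay_measures K.
        \<forall>f. continuous_on {-1..0} f \<longrightarrow>
          (\<lambda>t. signed_integral borel_I (\<mu> t) f) \<in> borel_measurable (lebesgue_on {0..T})}"

definition path_functional ::
    "(real \<Rightarrow> real) \<Rightarrow> real \<Rightarrow> (real \<Rightarrow> real set \<Rightarrow> real) \<Rightarrow> real" where
  "path_functional y t \<mu> =
     (LINT \<tau>:{0..t}|lebesgue. signed_integral borel_I (\<mu> \<tau>) (\<lambda>s. y (\<tau> + s)))"

definition path_space :: "real \<Rightarrow> real \<Rightarrow> (real \<Rightarrow> real set \<Rightarrow> real) measure" where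
  "path_space K T =
     sigma (measure_paths K T)
       {{\<mu> \<in> measure_paths K T. path_functional y t \<mu> \<in> B} | y t B.
          y \<in> AC (-1) T \<and> t \<in> {0..T} \<and> B \<in> sets borel}"

definition is_delay_solution ::
    "(real \<Rightarrow> real set \<Rightarrow> real) \<Rightarrow> (real \<Rightarrow> real) \<Rightarrow> (real \<Rightarrow> real) \<Rightarrow> bool" where
  "is_delay_solution \<mu> u0 z \<longleftrightarrow>
     z \<in> extensional {-1..} \<and> continuous_on {-1..} z \<and>
     (\<forall>s\<in>{-1..0}. z s = u0 s) \<and>
     (\<forall>t\<ge>0. z t = u0 0 +
        (LINT \<tau>:{0..t}|lebesgue. signed_integral borel_I (\<mu> \<tau>) (\<lambda>r. z (\<tau> + r))))"

definition delay_solution ::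
    "(real \<Rightarrow> real set \<Rightarrow> real) \<Rightarrow> (real \<Rightarrow> real) \<Rightarrow> real \<Rightarrow> real" where
  "delay_solution \<mu> u0 = (THE z. is_delay_solution \<mu> u0 z)"

definition delay_cocycle ::
    "(real \<Rightarrow> 'w \<Rightarrow> 'w) \<Rightarrow> ('w \<Rightarrow> real set \<Rightarrow> real) \<Rightarrow> 'w \<Rightarrow> real \<Rightarrow> (real \<Rightarrow> real) \<Rightarrow> real \<Rightarrow> real" where
  "delay_cocycle \<theta> \<mu> \<omega> t u0 =
     (\<lambda>s\<in>{-1..0}. delay_solution (\<lambda>\<tau>. \<mu> (\<theta> \<tau> \<omega>)) u0 (t + s))"

end

theory Submission
  imports Defs
begin

text \<open>
  The proof has two independent halves. They meet in the statement that
  a map into \<open>AC([a,b])\<close> is Borel measurable as soon as all its point evaluations are measurable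
  (theorem \<open>AC_borel_measurableI\<close>).

  For the first half, an absolutely continuous \<open>u\<close> is the integral of an integrable density \<open>g\<close>
  (lemma \<open>abs_continuous_imp_ac_density\<close>): \<open>u\<close> is a difference of two nondecreasing absolutely
  continuous functions, and the Stieltjes measure of such a function has a Radon-Nikodym density.
  By Lebesgue differentiation \<open>u' = g\<close> almost everywhere, so the norm of \<open>AC\<close> is the \<open>L\<^sup>1\<close> norm of
  the density plus \<open>|u(a)|\<close>. Two things follow. The space is separable, because polynomials with
  rational coefficients are dense in \<open>L\<^sup>1\<close>. The norm is a limit of the sums of \<open>|u(x\<^sub>i\<^sub>+\<^sub>1) - u(x\<^sub>i)|\<close> over
  equidistant grids (lemma \<open>grid_variation_tendsto\<close>), hence determined by countably many point values.
  Open sets are thus countable unions of balls whose preimages are measurable.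

  For the second half, the solution of the delay equation is obtained by Picard iteration. With an
  exponential weight the integral operator halves distances
  (lemma \<open>integral_operator_contraction\<close>), which gives
  existence, uniqueness and convergence of the iterates at every point. Measurability in \<open>\<omega>\<close> passes
  from one iterate to the next (lemma \<open>accumulated_random_measurable\<close>): the \<open>\<sigma>\<close>-algebra on paths is
  made for integrals of a fixed function \<open>y\<close>, but a random continuous function is the uniform limit
  of its Bernstein polynomials, which are fixed polynomials with random coefficients. The solution is
  absolutely continuous because it equals \<open>u\<^sub>0\<close> on \<open>[-1,0]\<close> and is Lipschitz on \<open>[0,T]\<close>.
\<close>

section \<open>Absolute continuity and families of intervals\<close>

text \<open>The index set is arbitrary, because refining every interval of a family leads to pairs of indices,
and covering arguments lead to families indexed by the intervals themselves.\<close>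
definition interval_family :: "real \<Rightarrow> real \<Rightarrow> 'i set \<Rightarrow> ('i \<Rightarrow> real) \<Rightarrow> ('i \<Rightarrow> real) \<Rightarrow> bool" where
  "interval_family a b I l r \<longleftrightarrow> finite I \<and> (\<forall>i\<in>I. a \<le> l i \<and> l i \<le> r i \<and> r i \<le> b) \<and>
     disjoint_family_on (\<lambda>i. {l i<..<r i}) I"

lemma interval_familyD:
  assumes "interval_family a b I l r" "i \<in> I"
  shows "a \<le> l i" "l i \<le> r i" "r i \<le> b"
  using assms by (auto simp: interval_family_def)

lemma abs_continuous_interval_family:
  assumes "abs_continuous_on_Icc a b u" "\<epsilon> > 0"
  obtains \<delta> where "\<delta> > 0"
    "\<And>(I :: 'i set) l r. interval_family a b I l r \<Longrightarrow> (\<Sum>i\<in>I. r i - l i) < \<delta> \<Longrightarrow>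
        (\<Sum>i\<in>I. \<bar>u (r i) - u (l i)\<bar>) < \<epsilon>"
proof -
  obtain \<delta> where "\<delta> > 0" and \<delta>: "\<forall>(n :: nat) (l :: nat \<Rightarrow> real) (r :: nat \<Rightarrow> real).
        (\<forall>i<n. a \<le> l i \<and> l i \<le> r i \<and> r i \<le> b) \<and>
        disjoint_family_on (\<lambda>i. {l i<..<r i}) {..<n} \<and> (\<Sum>i<n. r i - l i) < \<delta> \<longrightarrow>
        (\<Sum>i<n. \<bar>u (r i) - u (l i)\<bar>) < \<epsilon>"
    using assms(1)[unfolded abs_continuous_on_Icc_def, rule_format, OF assms(2)] by (elim exE conjE)
  show thesis
  proof (rule that[OF \<open>\<delta> > 0\<close>])
    fix I :: "'i set" and l r
    assume fam: "interval_family a b I l r" and small: "(\<Sum>i\<in>I. r i - l i) < \<delta>"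
    obtain h where h: "bij_betw h {..<card I} I"
      using fam unfolding interval_family_def by (metis bij_betw_from_nat_into_finite)
    have "(\<Sum>i<card I. \<bar>u (r (h i)) - u (l (h i))\<bar>) < \<epsilon>"
    proof (rule \<delta>[rule_format], intro conjI)
      show "\<forall>i<card I. a \<le> l (h i) \<and> l (h i) \<le> r (h i) \<and> r (h i) \<le> b"
        using fam h unfolding interval_family_def by (metis bij_betw_apply lessThan_iff)
      show "disjoint_family_on (\<lambda>i. {l (h i)<..<r (h i)}) {..<card I}"
        using fam h unfolding interval_family_def disjoint_family_on_def bij_betw_def inj_on_def
        by (metis imageI)
      show "(\<Sum>i<card I. r (h i) - l (h i)) < \<delta>"
        using small sum.reindex_bij_betw[OF h, of "\<lambda>i. r i - l i"] by simp
    qed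
    then show "(\<Sum>i\<in>I. \<bar>u (r i) - u (l i)\<bar>) < \<epsilon>"
      using sum.reindex_bij_betw[OF h, of "\<lambda>i. \<bar>u (r i) - u (l i)\<bar>"] by simp
  qed
qed

lemma abs_continuousI:
  assumes "\<And>\<epsilon>. \<epsilon> > 0 \<Longrightarrow> \<exists>\<delta>>0. \<forall>(n :: nat) l r. interval_family a b {..<n} l r \<longrightarrow>
      (\<Sum>i<n. r i - l i) < \<delta> \<longrightarrow> (\<Sum>i<n. \<bar>u (r i) - u (l i)\<bar>) < \<epsilon>"
  shows "abs_continuous_on_Icc a b u"
  unfolding abs_continuous_on_Icc_def
proof (intro allI impI)
  fix \<epsilon> :: real assume "\<epsilon> > 0"
  from assms[OF this] obtain \<delta> where "\<delta> > 0" and \<delta>: "\<forall>(n :: nat) l r. interval_family a b {..<n} l r \<longrightarrow>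
      (\<Sum>i<n. r i - l i) < \<delta> \<longrightarrow> (\<Sum>i<n. \<bar>u (r i) - u (l i)\<bar>) < \<epsilon>" by (elim exE conjE)
  show "\<exists>\<delta>>0. \<forall>(n :: nat) l r. (\<forall>i<n. a \<le> l i \<and> l i \<le> r i \<and> r i \<le> b) \<and>
      disjoint_family_on (\<lambda>i. {l i<..<r i}) {..<n} \<and> (\<Sum>i<n. r i - l i) < \<delta> \<longrightarrow>
      (\<Sum>i<n. \<bar>u (r i) - u (l i)\<bar>) < \<epsilon>"
  proof (intro exI[of _ \<delta>] conjI allI impI)
    fix n :: nat and l r
    assume *: "(\<forall>i<n. a \<le> l i \<and> l i \<le> r i \<and> r i \<le> b) \<and>
      disjoint_family_on (\<lambda>i. {l i<..<r i}) {..<n} \<and> (\<Sum>i<n. r i - l i) < \<delta>"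
    then have "interval_family a b {..<n} l r" unfolding interval_family_def by blast
    with * show "(\<Sum>i<n. \<bar>u (r i) - u (l i)\<bar>) < \<epsilon>" using \<delta> by blast
  qed (fact \<open>\<delta> > 0\<close>)
qed

lemma lipschitz_imp_abs_continuous:
  assumes "\<And>x y. a \<le> x \<Longrightarrow> x \<le> y \<Longrightarrow> y \<le> b \<Longrightarrow> \<bar>u y - u x\<bar> \<le> L * (y - x)"
  shows "abs_continuous_on_Icc a b u"
proof (rule abs_continuousI)
  fix \<epsilon> :: real assume "\<epsilon> > 0"
  define C where "C = \<bar>L\<bar> + 1"
  have "C > 0" by (simp add: C_def)
  have key: "(\<Sum>i<n. \<bar>u (r i) - u (l i)\<bar>) < \<epsilon>"
    if fam: "interval_family a b {..<n} l r" and small: "(\<Sum>i<n. r i - l i) < \<epsilon> / C"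
    for n :: nat and l r
  proof -
    have "(\<Sum>i<n. \<bar>u (r i) - u (l i)\<bar>) \<le> (\<Sum>i<n. C * (r i - l i))"
    proof (rule sum_mono)
      fix i assume "i \<in> {..<n}"
      then have i: "a \<le> l i" "l i \<le> r i" "r i \<le> b" using fam by (auto simp: interval_family_def)
      have "L * (r i - l i) \<le> C * (r i - l i)"
        using i by (intro mult_right_mono) (auto simp: C_def)
      then show "\<bar>u (r i) - u (l i)\<bar> \<le> C * (r i - l i)"
        using assms[OF i] by linarith
    qed
    also have "\<dots> = C * (\<Sum>i<n. r i - l i)" by (simp add: sum_distrib_left)
    also have "\<dots> < \<epsilon>" using small \<open>C > 0\<close> by (simp add: field_simps)
    finally show ?thesis .
  qed
  show "\<exists>\<delta>>0. \<forall>(n :: nat) l r. interval_family a b {..<n} l r \<longrightarrow>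
      (\<Sum>i<n. r i - l i) < \<delta> \<longrightarrow> (\<Sum>i<n. \<bar>u (r i) - u (l i)\<bar>) < \<epsilon>"
    by (intro exI[of _ "\<epsilon> / C"] conjI allI impI key divide_pos_pos \<open>\<epsilon> > 0\<close> \<open>C > 0\<close>)
qed

lemma abs_continuous_diff:
  assumes "abs_continuous_on_Icc a b u" "abs_continuous_on_Icc a b v"
  shows "abs_continuous_on_Icc a b (\<lambda>x. u x - v x)"
proof (rule abs_continuousI)
  fix \<epsilon> :: real assume "\<epsilon> > 0"
  then have "\<epsilon> / 2 > 0" by simp
  obtain d where d: "d > 0" "\<And>(I :: nat set) l r. interval_family a b I l r \<Longrightarrow> (\<Sum>i\<in>I. r i - l i) < d \<Longrightarrow>
        (\<Sum>i\<in>I. \<bar>u (r i) - u (l i)\<bar>) < \<epsilon> / 2"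
    by (rule abs_continuous_interval_family[OF assms(1) \<open>\<epsilon> / 2 > 0\<close>]) (rule that; assumption)
  obtain e where e: "e > 0" "\<And>(I :: nat set) l r. interval_family a b I l r \<Longrightarrow> (\<Sum>i\<in>I. r i - l i) < e \<Longrightarrow>
        (\<Sum>i\<in>I. \<bar>v (r i) - v (l i)\<bar>) < \<epsilon> / 2"
    by (rule abs_continuous_interval_family[OF assms(2) \<open>\<epsilon> / 2 > 0\<close>]) (rule that; assumption)
  have "min d e > 0" using d(1) e(1) by simp
  have key: "(\<Sum>i<n. \<bar>(u (r i) - v (r i)) - (u (l i) - v (l i))\<bar>) < \<epsilon>"
    if fam: "interval_family a b {..<n} l r" and small: "(\<Sum>i<n. r i - l i) < min d e"
    for n :: nat and l r
  proof -
    have "(\<Sum>i<n. \<bar>(u (r i) - v (r i)) - (u (l i) - v (l i))\<bar>)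
        \<le> (\<Sum>i<n. \<bar>u (r i) - u (l i)\<bar> + \<bar>v (r i) - v (l i)\<bar>)"
      by (intro sum_mono) linarith
    also have "\<dots> < \<epsilon>"
      using d(2)[OF fam] e(2)[OF fam] small by (simp add: sum.distrib)
    finally show ?thesis .
  qed
  show "\<exists>\<delta>>0. \<forall>(n :: nat) l r. interval_family a b {..<n} l r \<longrightarrow>
      (\<Sum>i<n. r i - l i) < \<delta> \<longrightarrow> (\<Sum>i<n. \<bar>(u (r i) - v (r i)) - (u (l i) - v (l i))\<bar>) < \<epsilon>"
    by (intro exI[of _ "min d e"] conjI allI impI key \<open>min d e > 0\<close>)
qed

lemma abs_continuous_cong:
  assumes "\<And>x. a \<le> x \<Longrightarrow> x \<le> b \<Longrightarrow> u x = v x" "abs_continuous_on_Icc a b u"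
  shows "abs_continuous_on_Icc a b v"
proof (rule abs_continuousI)
  fix \<epsilon> :: real assume "\<epsilon> > 0"
  obtain d where d: "d > 0" "\<And>(I :: nat set) l r. interval_family a b I l r \<Longrightarrow> (\<Sum>i\<in>I. r i - l i) < d \<Longrightarrow>
        (\<Sum>i\<in>I. \<bar>u (r i) - u (l i)\<bar>) < \<epsilon>"
    by (rule abs_continuous_interval_family[OF assms(2) \<open>\<epsilon> > 0\<close>]) (rule that; assumption)
  have eq: "(\<Sum>i<n. \<bar>v (r i) - v (l i)\<bar>) = (\<Sum>i<n. \<bar>u (r i) - u (l i)\<bar>)"
    if "interval_family a b {..<n} l r" for n :: nat and l r
  proof (intro sum.cong refl)
    fix i assume "i \<in> {..<n}"
    note i = interval_familyD[OF that this]
    then show "\<bar>v (r i) - v (l i)\<bar> = \<bar>u (r i) - u (l i)\<bar>"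
      using assms(1)[of "l i"] assms(1)[of "r i"] by simp
  qed
  have key: "(\<Sum>i<n. \<bar>v (r i) - v (l i)\<bar>) < \<epsilon>"
    if "interval_family a b {..<n} l r" "(\<Sum>i<n. r i - l i) < d" for n :: nat and l r
    using d(2)[OF that] eq[OF that(1)] by simp
  show "\<exists>\<delta>>0. \<forall>(n :: nat) l r. interval_family a b {..<n} l r \<longrightarrow>
      (\<Sum>i<n. r i - l i) < \<delta> \<longrightarrow> (\<Sum>i<n. \<bar>v (r i) - v (l i)\<bar>) < \<epsilon>"
    by (intro exI[of _ d] conjI allI impI key d(1))
qed

lemma abs_continuous_translate:
  assumes "abs_continuous_on_Icc a b u" "a \<le> c + t" "d + t \<le> b"
  shows "abs_continuous_on_Icc c d (\<lambda>s. u (t + s))"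
proof (rule abs_continuousI)
  fix \<epsilon> :: real assume "\<epsilon> > 0"
  obtain \<delta> where \<delta>: "\<delta> > 0" "\<And>(I :: nat set) l r. interval_family a b I l r \<Longrightarrow> (\<Sum>i\<in>I. r i - l i) < \<delta> \<Longrightarrow>
        (\<Sum>i\<in>I. \<bar>u (r i) - u (l i)\<bar>) < \<epsilon>"
    by (rule abs_continuous_interval_family[OF assms(1) \<open>\<epsilon> > 0\<close>]) (rule that; assumption)
  have fam: "interval_family a b I (\<lambda>i. t + l i) (\<lambda>i. t + r i)"
    if "interval_family c d I l r" for I :: "nat set" and l r
  proof -
    have "{t + l i<..<t + r i} \<inter> {t + l j<..<t + r j} = {}"
      if "{l i<..<r i} \<inter> {l j<..<r j} = {}" for i j
    proof (rule ccontr)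
      assume "{t + l i<..<t + r i} \<inter> {t + l j<..<t + r j} \<noteq> {}"
      then obtain x where "x \<in> {t + l i<..<t + r i} \<inter> {t + l j<..<t + r j}" by blast
      then have "x - t \<in> {l i<..<r i} \<inter> {l j<..<r j}" by auto
      with that show False by blast
    qed
    then have "disjoint_family_on (\<lambda>i. {t + l i<..<t + r i}) I"
      using that unfolding interval_family_def disjoint_family_on_def by blast
    moreover have "a \<le> t + l i \<and> t + l i \<le> t + r i \<and> t + r i \<le> b" if "i \<in> I" for i
      using interval_familyD[OF \<open>interval_family c d I l r\<close> that] assms(2,3) by simp
    ultimately show ?thesis
      using that unfolding interval_family_def by blast
  qed
  show "\<exists>\<delta>>0. \<forall>(n :: nat) l r. interval_family c d {..<n} l r \<longrightarrow>
      (\<Sum>i<n. r i - l i) < \<delta> \<longrightarrow> (\<Sum>i<n. \<bar>u (t + r i) - u (t + l i)\<bar>) < \<epsilon>"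
  proof (intro exI[of _ \<delta>] conjI allI impI)
    fix n :: nat and l r
    assume *: "interval_family c d {..<n} l r" "(\<Sum>i<n. r i - l i) < \<delta>"
    then show "(\<Sum>i<n. \<bar>u (t + r i) - u (t + l i)\<bar>) < \<epsilon>"
      using \<delta>(2)[OF fam[OF *(1)]] by simp
  qed (fact \<delta>(1))
qed

text \<open>Clipping all end points at \<open>b\<close> treats the intervals on the left of \<open>b\<close>, on its right and across it
uniformly: an interval on the wrong side degenerates to a point and contributes nothing to any sum.\<close>
lemma interval_family_clip:
  assumes "interval_family a c I l r" "a \<le> b" "b \<le> c"
  shows "interval_family a b I (\<lambda>i. min (l i) b) (\<lambda>i. min (r i) b)"
    "interval_family b c I (\<lambda>i. max (l i) b) (\<lambda>i. max (r i) b)"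
proof -
  have *: "\<And>i j. i \<in> I \<Longrightarrow> j \<in> I \<Longrightarrow> i \<noteq> j \<Longrightarrow> {l i<..<r i} \<inter> {l j<..<r j} = {}"
    using assms(1) by (auto simp: interval_family_def disjoint_family_on_def)
  have **: "{min (l i) b<..<min (r i) b} \<subseteq> {l i<..<r i}" "{max (l i) b<..<max (r i) b} \<subseteq> {l i<..<r i}" for i
    by auto
  have "disjoint_family_on (\<lambda>i. {min (l i) b<..<min (r i) b}) I"
    "disjoint_family_on (\<lambda>i. {max (l i) b<..<max (r i) b}) I"
    unfolding disjoint_family_on_def using * **  by blast+
  then show "interval_family a b I (\<lambda>i. min (l i) b) (\<lambda>i. min (r i) b)"
    "interval_family b c I (\<lambda>i. max (l i) b) (\<lambda>i. max (r i) b)"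
    using assms unfolding interval_family_def by (auto simp: min_def max_def)
qed

lemma sum_increments_clip:
  fixes u :: "real \<Rightarrow> real"
  assumes "\<And>i. i \<in> I \<Longrightarrow> l i \<le> r i"
  shows "(\<Sum>i\<in>I. \<bar>u (r i) - u (l i)\<bar>) \<le> (\<Sum>i\<in>I. \<bar>u (min (r i) b) - u (min (l i) b)\<bar>)
      + (\<Sum>i\<in>I. \<bar>u (max (r i) b) - u (max (l i) b)\<bar>)"
  unfolding sum.distrib[symmetric] using assms
  by (intro sum_mono) (auto simp: min_def max_def)

lemma abs_continuous_concat:
  assumes "abs_continuous_on_Icc a b u" "abs_continuous_on_Icc b c u" "a \<le> b" "b \<le> c"
  shows "abs_continuous_on_Icc a c u"
proof (rule abs_continuousI)
  fix \<epsilon> :: real assume "\<epsilon> > 0"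
  then have "\<epsilon> / 2 > 0" by simp
  obtain d where d: "d > 0" "\<And>(I :: nat set) l r. interval_family a b I l r \<Longrightarrow> (\<Sum>i\<in>I. r i - l i) < d \<Longrightarrow>
        (\<Sum>i\<in>I. \<bar>u (r i) - u (l i)\<bar>) < \<epsilon> / 2"
    by (rule abs_continuous_interval_family[OF assms(1) \<open>\<epsilon> / 2 > 0\<close>]) (rule that; assumption)
  obtain e where e: "e > 0" "\<And>(I :: nat set) l r. interval_family b c I l r \<Longrightarrow> (\<Sum>i\<in>I. r i - l i) < e \<Longrightarrow>
        (\<Sum>i\<in>I. \<bar>u (r i) - u (l i)\<bar>) < \<epsilon> / 2"
    by (rule abs_continuous_interval_family[OF assms(2) \<open>\<epsilon> / 2 > 0\<close>]) (rule that; assumption)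
  have "min d e > 0" using d(1) e(1) by simp
  have key: "(\<Sum>i<n. \<bar>u (r i) - u (l i)\<bar>) < \<epsilon>"
    if fam: "interval_family a c {..<n} l r" and small: "(\<Sum>i<n. r i - l i) < min d e"
    for n :: nat and l r
  proof -
    have le: "l i \<le> r i" if "i \<in> {..<n}" for i using fam that by (auto simp: interval_family_def)
    have "(\<Sum>i<n. min (r i) b - min (l i) b) \<le> (\<Sum>i<n. r i - l i)"
      "(\<Sum>i<n. max (r i) b - max (l i) b) \<le> (\<Sum>i<n. r i - l i)"
      using le by (intro sum_mono; force simp: min_def max_def)+
    then show ?thesis
      using d(2)[OF interval_family_clip(1)[OF fam assms(3,4)]]
        e(2)[OF interval_family_clip(2)[OF fam assms(3,4)]] small
        sum_increments_clip[of "{..<n}" l r u b, OF le] by simp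
  qed
  show "\<exists>\<delta>>0. \<forall>(n :: nat) l r. interval_family a c {..<n} l r \<longrightarrow>
      (\<Sum>i<n. r i - l i) < \<delta> \<longrightarrow> (\<Sum>i<n. \<bar>u (r i) - u (l i)\<bar>) < \<epsilon>"
    by (intro exI[of _ "min d e"] conjI allI impI key \<open>min d e > 0\<close>)
qed

lemma abs_continuous_imp_continuous:
  assumes "abs_continuous_on_Icc a b u"
  shows "continuous_on {a..b} u"
  unfolding continuous_on_iff
proof (intro ballI allI impI)
  fix x \<epsilon> :: real assume x: "x \<in> {a..b}" "\<epsilon> > 0"
  obtain d where d: "d > 0" "\<And>(I :: unit set) l r. interval_family a b I l r \<Longrightarrow> (\<Sum>i\<in>I. r i - l i) < d \<Longrightarrow>
        (\<Sum>i\<in>I. \<bar>u (r i) - u (l i)\<bar>) < \<epsilon>"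
    by (rule abs_continuous_interval_family[OF assms \<open>\<epsilon> > 0\<close>]) (rule that; assumption)
  have "dist (u y) (u x) < \<epsilon>" if y: "y \<in> {a..b}" "dist y x < d" for y
  proof -
    have "interval_family a b {()} (\<lambda>_. min x y) (\<lambda>_. max x y)"
      using x y by (simp add: interval_family_def disjoint_family_on_def)
    moreover have "max x y - min x y < d" using y(2) by (simp add: dist_real_def)
    ultimately have "\<bar>u (max x y) - u (min x y)\<bar> < \<epsilon>" using d(2) by fastforce
    then show ?thesis by (cases "x \<le> y") (simp_all add: dist_real_def abs_minus_commute max_def min_def)
  qed
  then show "\<exists>d>0. \<forall>x'\<in>{a..b}. dist x' x < d \<longrightarrow> dist (u x') (u x) < \<epsilon>"
    using d(1) by blast
qed

section \<open>Variation and monotone decomposition\<close>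

text \<open>The values may be infinite, so that the supremum can be handled before it is known to be finite.\<close>
definition variation :: "(real \<Rightarrow> real) \<Rightarrow> real \<Rightarrow> real \<Rightarrow> ennreal" where
  "variation u a b = (SUP (n, l, r) \<in> {(n, l, r). interval_family a b {..<n :: nat} l r}.
     ennreal (\<Sum>i<n. \<bar>u (r i) - u (l i)\<bar>))"

lemma variation_upper:
  "interval_family a b {..<n :: nat} l r \<Longrightarrow> ennreal (\<Sum>i<n. \<bar>u (r i) - u (l i)\<bar>) \<le> variation u a b"
  unfolding variation_def by (rule SUP_upper2[where i = "(n, l, r)"]) auto

lemma variation_least:
  assumes "\<And>(n :: nat) l r. interval_family a b {..<n} l r \<Longrightarrow> ennreal (\<Sum>i<n. \<bar>u (r i) - u (l i)\<bar>) \<le> B"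
  shows "variation u a b \<le> B"
  unfolding variation_def by (rule SUP_least) (use assms in auto)

lemma variation_subadd:
  assumes "a \<le> b" "b \<le> c"
  shows "variation u a c \<le> variation u a b + variation u b c"
proof (rule variation_least)
  fix n :: nat and l r assume fam: "interval_family a c {..<n} l r"
  have "ennreal (\<Sum>i<n. \<bar>u (r i) - u (l i)\<bar>) \<le> ennreal ((\<Sum>i<n. \<bar>u (min (r i) b) - u (min (l i) b)\<bar>)
      + (\<Sum>i<n. \<bar>u (max (r i) b) - u (max (l i) b)\<bar>))"
    by (intro ennreal_leI sum_increments_clip) (use fam in \<open>auto simp: interval_family_def\<close>)
  also have "\<dots> = ennreal (\<Sum>i<n. \<bar>u (min (r i) b) - u (min (l i) b)\<bar>)
      + ennreal (\<Sum>i<n. \<bar>u (max (r i) b) - u (max (l i) b)\<bar>)"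
    by (intro ennreal_plus sum_nonneg) auto
  also have "\<dots> \<le> variation u a b + variation u b c"
    using interval_family_clip[OF fam assms] by (intro add_mono variation_upper)
  finally show "ennreal (\<Sum>i<n. \<bar>u (r i) - u (l i)\<bar>) \<le> variation u a b + variation u b c" .
qed

text \<open>Any family in \<open>[a,b]\<close> can be extended by the interval \<open>[b,c]\<close>. Hence the variation on \<open>[a,x]\<close>
grows with \<open>x\<close> at least as fast as \<open>u\<close> moves.\<close>
lemma variation_add_increment:
  assumes "a \<le> b" "b \<le> c"
  shows "variation u a b + ennreal \<bar>u c - u b\<bar> \<le> variation u a c"
proof -
  have "ennreal (\<Sum>i<n. \<bar>u (r i) - u (l i)\<bar>) + ennreal \<bar>u c - u b\<bar> \<le> variation u a c"
    if fam: "interval_family a b {..<n} l r" for n :: nat and l r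
  proof -
    define l' where "l' = l(n := b)"
    define r' where "r' = r(n := c)"
    have last: "{l i<..<r i} \<inter> {b<..<c} = {}" if "i < n" for i
      using interval_familyD[OF fam, of i] that by auto
    have old: "{l i<..<r i} \<inter> {l j<..<r j} = {}" if "i < n" "j < n" "i \<noteq> j" for i j
      using fam that unfolding interval_family_def disjoint_family_on_def by blast
    have "disjoint_family_on (\<lambda>i. {l' i<..<r' i}) {..<Suc n}"
      unfolding disjoint_family_on_def
    proof (intro ballI impI)
      fix i j assume ij: "i \<in> {..<Suc n}" "j \<in> {..<Suc n}" "i \<noteq> j"
      then consider "i < n" "j < n" | "i = n" "j < n" | "i < n" "j = n" by fastforce
      then show "{l' i<..<r' i} \<inter> {l' j<..<r' j} = {}"
        using old[OF _ _ ij(3)] last by cases (simp_all add: l'_def r'_def Int_commute)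
    qed
    moreover have "a \<le> l' i \<and> l' i \<le> r' i \<and> r' i \<le> c" if "i < Suc n" for i
      using interval_familyD[OF fam, of i] that assms by (cases "i = n") (auto simp: l'_def r'_def)
    ultimately have "interval_family a c {..<Suc n} l' r'"
      unfolding interval_family_def by blast
    then have "ennreal (\<Sum>i<Suc n. \<bar>u (r' i) - u (l' i)\<bar>) \<le> variation u a c"
      by (rule variation_upper)
    also have "(\<Sum>i<Suc n. \<bar>u (r' i) - u (l' i)\<bar>) = (\<Sum>i<n. \<bar>u (r i) - u (l i)\<bar>) + \<bar>u c - u b\<bar>"
      by (simp add: l'_def r'_def)
    finally show ?thesis by (simp add: sum_nonneg)
  qed
  moreover have "interval_family a b {..<0} l r" for l r :: "nat \<Rightarrow> real"
    by (simp add: interval_family_def disjoint_family_on_def)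
  then have "{(n, l, r). interval_family a b {..<n :: nat} l r} \<noteq> {}" by blast
  ultimately show ?thesis
    unfolding variation_def by (subst ennreal_SUP_add_left[symmetric]) (auto intro!: SUP_least)
qed

text \<open>The intervals are disjoint subsets of \<open>[a,b]\<close>, so Lebesgue measure compares the lengths.\<close>
lemma interval_family_length:
  assumes fam: "interval_family a b I l r" and "a \<le> b"
  shows "(\<Sum>i\<in>I. r i - l i) \<le> b - a"
proof -
  have lr: "l i \<le> r i" if "i \<in> I" for i using interval_familyD[OF fam that] by simp
  have "ennreal (\<Sum>i\<in>I. r i - l i) = (\<Sum>i\<in>I. ennreal (r i - l i))"
    using lr by (intro sum_ennreal[symmetric]) simp
  also have "\<dots> = (\<Sum>i\<in>I. emeasure lborel {l i<..<r i})"
    using lr by simp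
  also have "\<dots> = emeasure lborel (\<Union>i\<in>I. {l i<..<r i})"
    using fam by (intro sum_emeasure) (auto simp: interval_family_def)
  also have "\<dots> \<le> emeasure lborel {a..b}"
    using interval_familyD[OF fam] by (intro emeasure_mono) force+
  also have "\<dots> = ennreal (b - a)" using \<open>a \<le> b\<close> by simp
  finally show ?thesis
    using \<open>a \<le> b\<close> by (subst (asm) ennreal_le_iff) auto
qed

lemma interval_family_mono:
  "interval_family c d I l r \<Longrightarrow> a \<le> c \<Longrightarrow> d \<le> b \<Longrightarrow> interval_family a b I l r"
  unfolding interval_family_def by fastforce

lemma variation_mono: "a \<le> c \<Longrightarrow> d \<le> b \<Longrightarrow> variation u c d \<le> variation u a b"
  by (intro variation_least variation_upper) (rule interval_family_mono)

text \<open>On an interval shorter than the \<open>\<delta>\<close> that belongs to \<open>\<epsilon> = 1\<close> the variation is at most 1, and finitely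
many such intervals make up \<open>[a,b]\<close>.\<close>
lemma variation_finite:
  assumes "abs_continuous_on_Icc a b u" "a \<le> b"
  shows "variation u a b < \<infinity>"
proof -
  obtain \<delta> where \<delta>: "\<delta> > 0" "\<And>(I :: nat set) l r. interval_family a b I l r \<Longrightarrow>
      (\<Sum>i\<in>I. r i - l i) < \<delta> \<Longrightarrow> (\<Sum>i\<in>I. \<bar>u (r i) - u (l i)\<bar>) < 1"
    by (rule abs_continuous_interval_family[OF assms(1) zero_less_one]) (rule that; assumption)
  have short: "variation u c d \<le> 1" if "a \<le> c" "c \<le> d" "d \<le> b" "d - c < \<delta>" for c d
  proof (rule variation_least)
    fix n :: nat and l r assume fam: "interval_family c d {..<n} l r"
    have "(\<Sum>i<n. \<bar>u (r i) - u (l i)\<bar>) < 1"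
      using interval_family_length[OF fam] interval_family_mono[OF fam that(1,3)] that
      by (intro \<delta>(2)) auto
    then show "ennreal (\<Sum>i<n. \<bar>u (r i) - u (l i)\<bar>) \<le> 1"
      by (simp add: ennreal_le_1)
  qed
  obtain N :: nat where N: "(b - a) / \<delta> < N" using reals_Archimedean2 by blast
  have "N > 0" using N \<open>a \<le> b\<close> \<delta>(1) by (metis divide_nonneg_pos diff_ge_0_iff_ge gr0I not_less of_nat_0)
  define h where "h = (b - a) / N"
  have h: "0 \<le> h" "h < \<delta>" "a + N * h = b"
    using N \<open>N > 0\<close> \<delta>(1) \<open>a \<le> b\<close> by (auto simp: h_def field_simps)
  have "variation u a (a + k * h) \<le> of_nat (Suc k)" if "k \<le> N" for k :: nat
    using that
  proof (induction k)
    case 0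
    show ?case using short[of a a] \<open>a \<le> b\<close> \<delta>(1) by simp
  next
    case (Suc k)
    have "real (Suc k) * h \<le> N * h" using Suc.prems h(1) by (intro mult_right_mono) simp_all
    then have "a + Suc k * h \<le> b" using h(3) by linarith
    then have "variation u a (a + Suc k * h) \<le> variation u a (a + k * h) + variation u (a + k * h) (a + Suc k * h)"
      using h(1) by (intro variation_subadd) (auto simp: algebra_simps)
    also have "\<dots> \<le> of_nat (Suc k) + 1"
      using Suc \<open>a + Suc k * h \<le> b\<close> h(1,2)
      by (intro add_mono short) (auto simp: algebra_simps)
    finally show ?case by (simp add: algebra_simps)
  qed
  from this[of N] have "variation u a b \<le> of_nat (Suc N)" using h(3) by simp
  also have "\<dots> < \<infinity>" by (simp add: of_nat_less_top del: of_nat_Suc)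
  finally show ?thesis .
qed

lemma variation_near_attained:
  assumes "variation u a b < \<infinity>" "\<eta> > 0"
  obtains n :: nat and l r where "interval_family a b {..<n} l r"
    "variation u a b \<le> ennreal ((\<Sum>i<n. \<bar>u (r i) - u (l i)\<bar>) + \<eta>)"
proof (cases "variation u a b = 0")
  case True
  have "interval_family a b {..<0 :: nat} (\<lambda>_. 0) (\<lambda>_. 0)"
    by (simp add: interval_family_def disjoint_family_on_def)
  then show thesis by (rule that) (simp add: True)
next
  case False
  obtain V where V: "variation u a b = ennreal V" "V > 0"
    using assms(1) False by (cases "variation u a b") (auto simp: order.order_iff_strict)
  then have "ennreal (V - \<eta>) < variation u a b"
    using assms(2) by (simp add: ennreal_lessI)
  then obtain n :: nat and l r where nlr: "interval_family a b {..<n} l r"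
    "ennreal (V - \<eta>) < ennreal (\<Sum>i<n. \<bar>u (r i) - u (l i)\<bar>)"
    unfolding variation_def less_SUP_iff by auto
  have "V \<le> (\<Sum>i<n. \<bar>u (r i) - u (l i)\<bar>) + \<eta>"
  proof (rule ccontr)
    assume "\<not> ?thesis"
    then have "ennreal (\<Sum>i<n. \<bar>u (r i) - u (l i)\<bar>) \<le> ennreal (V - \<eta>)"
      by (intro ennreal_leI) simp
    with nlr(2) show False by simp
  qed
  then show thesis using that[OF nlr(1)] V by (simp add: ennreal_leI)
qed

text \<open>Choose a nearly optimal subfamily inside every interval of the given family. All subfamilies
together are one family, indexed by pairs, whose total length is no larger than before; the
absolute continuity of \<open>u\<close> applies to it. This is why the variation inherits absolute continuity.\<close>
lemma sum_variation_small:
  assumes ac: "abs_continuous_on_Icc a b u" and "\<epsilon> > 0"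
  obtains \<delta> where "\<delta> > 0"
    "\<And>(n :: nat) l r. interval_family a b {..<n} l r \<Longrightarrow> (\<Sum>i<n. r i - l i) < \<delta> \<Longrightarrow>
       (\<Sum>i<n. variation u (l i) (r i)) \<le> ennreal \<epsilon>"
proof -
  obtain \<delta> where \<delta>: "\<delta> > 0" "\<And>(I :: (nat \<times> nat) set) l r. interval_family a b I l r \<Longrightarrow>
      (\<Sum>i\<in>I. r i - l i) < \<delta> \<Longrightarrow> (\<Sum>i\<in>I. \<bar>u (r i) - u (l i)\<bar>) < \<epsilon>"
    by (rule abs_continuous_interval_family[OF ac \<open>\<epsilon> > 0\<close>]) (rule that; assumption)
  show thesis
  proof (rule that[OF \<delta>(1)])
    fix n :: nat and l r
    assume fam: "interval_family a b {..<n} l r" and small: "(\<Sum>i<n. r i - l i) < \<delta>"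
    have "(\<Sum>i<n. \<Sum>j<N i. \<bar>u (r' i j) - u (l' i j)\<bar>) < \<epsilon>"
      if sub: "\<And>i. i < n \<Longrightarrow> interval_family (l i) (r i) {..<N i} (l' i) (r' i)"
      for N :: "nat \<Rightarrow> nat" and l' r'
    proof -
      define I where "I = Sigma {..<n} (\<lambda>i. {..<N i})"
      have disj: "{l' i j<..<r' i j} \<inter> {l' i' j'<..<r' i' j'} = {}"
        if "i < n" "i' < n" "j < N i" "j' < N i'" "(i, j) \<noteq> (i', j')" for i j i' j'
      proof (cases "i = i'")
        case True
        then show ?thesis using sub[OF that(1)] that
          unfolding interval_family_def disjoint_family_on_def by auto
      next
        case False
        have "{l' i j<..<r' i j} \<subseteq> {l i<..<r i}" "{l' i' j'<..<r' i' j'} \<subseteq> {l i'<..<r i'}"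
          using interval_familyD[OF sub[OF that(1)], of j] interval_familyD[OF sub[OF that(2)], of j'] that
          by auto
        moreover have "{l i<..<r i} \<inter> {l i'<..<r i'} = {}"
          using fam that False unfolding interval_family_def disjoint_family_on_def by blast
        ultimately show ?thesis by blast
      qed
      have bounds: "a \<le> l' i j \<and> l' i j \<le> r' i j \<and> r' i j \<le> b" if "i < n" "j < N i" for i j
        using interval_familyD[OF fam, of i] interval_familyD[OF sub[OF that(1)], of j] that by auto
      have "interval_family a b I (\<lambda>(i, j). l' i j) (\<lambda>(i, j). r' i j)"
        unfolding interval_family_def I_def disjoint_family_on_def
        using bounds disj by (auto simp del: greaterThanLessThan_iff)
      moreover have "(\<Sum>j<N i. r' i j - l' i j) \<le> r i - l i" if "i < n" for i
        using interval_family_length[OF sub[OF that]] interval_familyD[OF fam, of i] that by simp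
      then have "(\<Sum>i\<in>I. (\<lambda>(i, j). r' i j) i - (\<lambda>(i, j). l' i j) i) \<le> (\<Sum>i<n. r i - l i)"
        unfolding I_def using sum.Sigma[of "{..<n}" "\<lambda>i. {..<N i}" "\<lambda>i j. r' i j - l' i j"]
          sum_mono[of "{..<n}" "\<lambda>i. \<Sum>j<N i. r' i j - l' i j" "\<lambda>i. r i - l i"]
        by (simp add: case_prod_unfold)
      ultimately have "(\<Sum>i\<in>I. \<bar>u ((\<lambda>(i, j). r' i j) i) - u ((\<lambda>(i, j). l' i j) i)\<bar>) < \<epsilon>"
        using small by (intro \<delta>(2)) auto
      then show ?thesis
        unfolding I_def by (simp add: sum.Sigma case_prod_unfold)
    qed
    note key = this
    have "(\<Sum>i<n. variation u (l i) (r i)) \<le> ennreal \<epsilon> + ennreal \<eta>" if "\<eta> > 0" for \<eta>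
    proof -
      have pos: "\<eta> / Suc n > 0" using that by simp
      define good where "good i N l' r' \<longleftrightarrow> interval_family (l i) (r i) {..<N :: nat} l' r' \<and>
          variation u (l i) (r i) \<le> ennreal ((\<Sum>j<N. \<bar>u (r' j) - u (l' j)\<bar>) + \<eta> / Suc n)" for i N l' r'
      have "\<exists>N l' r'. good i N l' r'" if "i < n" for i
      proof -
        have "i \<in> {..<n}" using that by simp
        note i = interval_familyD[OF fam this]
        have "variation u (l i) (r i) < \<infinity>"
          using variation_mono[OF i(1,3)] variation_finite[OF ac] i by (meson order.strict_trans1 order_trans)
        then show ?thesis by (rule variation_near_attained[OF _ pos]) (unfold good_def, blast)
      qed
      then obtain N l' r' where "\<And>i. i < n \<Longrightarrow> good i (N i) (l' i) (r' i)" by metis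
      then have *: "\<And>i. i < n \<Longrightarrow> interval_family (l i) (r i) {..<N i :: nat} (l' i) (r' i)"
        "\<And>i. i < n \<Longrightarrow> variation u (l i) (r i) \<le> ennreal ((\<Sum>j<N i. \<bar>u (r' i j) - u (l' i j)\<bar>) + \<eta> / Suc n)"
        unfolding good_def by blast+
      have "(\<Sum>i<n. variation u (l i) (r i)) \<le> (\<Sum>i<n. ennreal ((\<Sum>j<N i. \<bar>u (r' i j) - u (l' i j)\<bar>) + \<eta> / Suc n))"
        using *(2) by (intro sum_mono) simp
      also have "\<dots> = ennreal (\<Sum>i<n. (\<Sum>j<N i. \<bar>u (r' i j) - u (l' i j)\<bar>) + \<eta> / Suc n)"
        using that by (intro sum_ennreal add_nonneg_nonneg sum_nonneg) auto
      also have "\<dots> \<le> ennreal (\<epsilon> + \<eta>)"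
      proof (rule ennreal_leI)
        have "real n * (\<eta> / Suc n) \<le> \<eta>" using that by (simp add: field_simps)
        then show "(\<Sum>i<n. (\<Sum>j<N i. \<bar>u (r' i j) - u (l' i j)\<bar>) + \<eta> / Suc n) \<le> \<epsilon> + \<eta>"
          using key[OF *(1)] by (simp add: sum.distrib)
      qed
      finally show ?thesis using that \<open>\<epsilon> > 0\<close> by simp
    qed
    note eps = this
    show "(\<Sum>i<n. variation u (l i) (r i)) \<le> ennreal \<epsilon>"
      by (rule ennreal_le_epsilon) (rule eps)
  qed
qed

text \<open>With \<open>V x\<close> the variation of \<open>u\<close> on \<open>[a,x]\<close>, the estimate says that both \<open>V\<close> and \<open>V - u\<close> are
nondecreasing; \<open>u\<close> is their difference.\<close>
lemma abs_continuous_decomposition: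
  assumes ac: "abs_continuous_on_Icc a b u" and "a \<le> b"
  obtains V where "abs_continuous_on_Icc a b V"
    "\<And>x y. a \<le> x \<Longrightarrow> x \<le> y \<Longrightarrow> y \<le> b \<Longrightarrow> \<bar>u y - u x\<bar> \<le> V y - V x"
proof -
  \<comment> \<open>Finiteness of the variation makes this conversion harmless on \<open>[a,b]\<close>.\<close>
  define V where "V x = enn2real (variation u a x)" for x
  have V: "variation u a x = ennreal (V x)" if "x \<le> b" for x
  proof -
    have "variation u a x < \<infinity>"
      using variation_finite[OF assms] variation_mono[OF order_refl that] by (rule order.strict_trans1[rotated])
    then show ?thesis by (simp add: V_def less_top)
  qed
  have nonneg: "V x \<ge> 0" for x by (simp add: V_def)
  have incr: "\<bar>u y - u x\<bar> \<le> V y - V x" if "a \<le> x" "x \<le> y" "y \<le> b" for x y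
  proof -
    have "ennreal (V x + \<bar>u y - u x\<bar>) \<le> ennreal (V y)"
      using variation_add_increment[OF that(1,2), of u] V that nonneg by simp
    then show ?thesis using nonneg by (subst (asm) ennreal_le_iff) auto
  qed
  have "abs_continuous_on_Icc a b V"
  proof (rule abs_continuousI)
    fix \<epsilon> :: real assume "\<epsilon> > 0"
    then have "\<epsilon> / 2 > 0" by simp
    obtain \<delta> where \<delta>: "\<delta> > 0" "\<And>(n :: nat) l r. interval_family a b {..<n} l r \<Longrightarrow>
        (\<Sum>i<n. r i - l i) < \<delta> \<Longrightarrow> (\<Sum>i<n. variation u (l i) (r i)) \<le> ennreal (\<epsilon> / 2)"
      by (rule sum_variation_small[OF ac \<open>\<epsilon> / 2 > 0\<close>]) (rule that; assumption)
    have key: "(\<Sum>i<n. \<bar>V (r i) - V (l i)\<bar>) < \<epsilon>"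
      if fam: "interval_family a b {..<n} l r" and small: "(\<Sum>i<n. r i - l i) < \<delta>" for n :: nat and l r
    proof -
      have "ennreal \<bar>V (r i) - V (l i)\<bar> \<le> variation u (l i) (r i)" if "i \<in> {..<n}" for i
      proof -
        note i = interval_familyD[OF fam that]
        have "ennreal (V (r i)) \<le> ennreal (V (l i)) + variation u (l i) (r i)"
          using variation_subadd[OF i(1,2), of u] V i by simp
        then have "ennreal (V (r i)) - ennreal (V (l i)) \<le> variation u (l i) (r i)"
          by (simp add: ennreal_minus_le_iff)
        moreover have "\<bar>V (r i) - V (l i)\<bar> = V (r i) - V (l i)" using incr[OF i] by linarith
        ultimately show ?thesis using nonneg by (simp add: ennreal_minus)
      qed
      then have "(\<Sum>i<n. ennreal \<bar>V (r i) - V (l i)\<bar>) \<le> (\<Sum>i<n. variation u (l i) (r i))"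
        by (rule sum_mono)
      also have "\<dots> \<le> ennreal (\<epsilon> / 2)" by (rule \<delta>(2)[OF fam small])
      finally have "(\<Sum>i<n. \<bar>V (r i) - V (l i)\<bar>) \<le> \<epsilon> / 2"
        using \<open>\<epsilon> > 0\<close> by (simp add: sum_ennreal ennreal_le_iff)
      then show ?thesis using \<open>\<epsilon> > 0\<close> by simp
    qed
    show "\<exists>\<delta>>0. \<forall>(n :: nat) l r. interval_family a b {..<n} l r \<longrightarrow>
        (\<Sum>i<n. r i - l i) < \<delta> \<longrightarrow> (\<Sum>i<n. \<bar>V (r i) - V (l i)\<bar>) < \<epsilon>"
      by (intro exI[of _ \<delta>] conjI allI impI key \<delta>(1))
  qed
  then show thesis using incr by (rule that)
qed

section \<open>Densities of absolutely continuous functions\<close>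

text \<open>This is absolute continuity of the Stieltjes measure of \<open>G\<close>. Enclose the null set in an open set
of length less than \<open>\<delta>\<close> and cover it there by countably many non-overlapping intervals. Absolute
continuity of \<open>G\<close> bounds the measure of finitely many of them by \<open>\<epsilon>\<close>, and continuity from below
extends the bound to the union.\<close>
lemma monotone_ac_null_sets:
  fixes G :: "real \<Rightarrow> real"
  assumes ac: "abs_continuous_on_Icc a b G" and "a < b"
    and mono: "\<And>x y. x \<le> y \<Longrightarrow> G x \<le> G y" and cont: "continuous_on UNIV G"
    and N: "N \<in> null_sets lborel"
  shows "emeasure (interval_measure G) (N \<inter> {a..b}) = 0"
proof -
  let ?\<nu> = "interval_measure G"
  have Icc: "emeasure ?\<nu> {x..y} = ennreal (G y - G x)" if "x \<le> y" for x y
    using emeasure_interval_measure_Icc[OF that mono cont] by simp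
  define S where "S = N \<inter> {a..b}"
  have "emeasure ?\<nu> S \<le> ennreal \<epsilon>" if "\<epsilon> > 0" for \<epsilon>
  proof -
    obtain \<delta> where \<delta>: "\<delta> > 0" "\<And>(I :: real set set) l r. interval_family a b I l r \<Longrightarrow>
        (\<Sum>i\<in>I. r i - l i) < \<delta> \<Longrightarrow> (\<Sum>i\<in>I. \<bar>G (r i) - G (l i)\<bar>) < \<epsilon>"
      by (rule abs_continuous_interval_family[OF ac \<open>\<epsilon> > 0\<close>]) (rule that; assumption)
    have "N \<in> sets borel" using N by auto
    then obtain U where U: "open U" "N \<subseteq> U" "emeasure lborel (U - N) < \<delta>"
      using outer_regular_lborel[OF _ \<delta>(1)] by metis
    have "emeasure lborel U = emeasure lborel (U - N)"
      using U(1,2) N by (intro emeasure_Diff_null_set[symmetric]) auto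
    with U(3) have U\<delta>: "emeasure lborel U < \<delta>" by simp
    \<comment> \<open>Every interval of the covering contains a point of the null set, and so this gauge forces it into \<open>U\<close>.\<close>
    have gau: "gauge (\<lambda>x. if x \<in> U then U else UNIV)"
      using U(1) by (auto simp: gauge_def)
    have "S \<subseteq> cbox a b" "box a b \<noteq> {}" using \<open>a < b\<close> by (auto simp: S_def)
    from covering_lemma[OF this gau] obtain \<D> where D: "countable \<D>" "\<Union>\<D> \<subseteq> cbox a b"
      "\<And>K. K \<in> \<D> \<Longrightarrow> interior K \<noteq> {} \<and> (\<exists>c d. K = cbox c d)"
      "pairwise (\<lambda>A B. interior A \<inter> interior B = {}) \<D>"
      "\<And>K. K \<in> \<D> \<Longrightarrow> \<exists>x \<in> S \<inter> K. K \<subseteq> (if x \<in> U then U else UNIV)"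
      "S \<subseteq> \<Union>\<D>" by metis
    have KU: "K \<subseteq> U" if KD: "K \<in> \<D>" for K
    proof -
      obtain x where "x \<in> S" "K \<subseteq> (if x \<in> U then U else UNIV)" using D(5)[OF KD] by blast
      then show ?thesis using U(2) by (auto simp: S_def split: if_splits)
    qed
    have K: "K = {Inf K..Sup K}" "a \<le> Inf K" "Inf K < Sup K" "Sup K \<le> b" if KD: "K \<in> \<D>" for K
    proof -
      obtain c d where cd: "K = {c..d}" using D(3)[OF KD] by (auto simp: cbox_interval)
      then have "c < d" using D(3)[OF KD] by auto
      moreover have "K \<subseteq> {a..b}" using D(2) KD by (auto simp: cbox_interval)
      ultimately show "K = {Inf K..Sup K}" "a \<le> Inf K" "Inf K < Sup K" "Sup K \<le> b"
        using cd by auto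
    qed
    have fin: "emeasure ?\<nu> (\<Union>\<F>) \<le> ennreal \<epsilon>" if \<F>: "finite \<F>" "\<F> \<subseteq> \<D>" for \<F>
    proof -
      have int: "{Inf K<..<Sup K} = interior K" if "K \<in> \<F>" for K
        using K(1)[of K] that \<F>(2) interior_atLeastAtMost_real by (metis subset_iff)
      have disj: "disjoint_family_on (\<lambda>K. {Inf K<..<Sup K}) \<F>"
        unfolding disjoint_family_on_def
        using D(4) \<F>(2) int by (auto simp: pairwise_def simp del: greaterThanLessThan_iff)
      have "a \<le> Inf K \<and> Inf K \<le> Sup K \<and> Sup K \<le> b" if "K \<in> \<F>" for K
        using K(2-4)[of K] \<F>(2) that by auto
      then have fam: "interval_family a b \<F> Inf Sup"
        using disj \<F>(1) unfolding interval_family_def by blast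
      have le: "Inf K \<le> Sup K" if "K \<in> \<F>" for K using K(3)[of K] \<F>(2) that by auto
      have "ennreal (\<Sum>K\<in>\<F>. Sup K - Inf K) = (\<Sum>K\<in>\<F>. ennreal (Sup K - Inf K))"
        using le by (intro sum_ennreal[symmetric]) simp
      also have "\<dots> = (\<Sum>K\<in>\<F>. emeasure lborel {Inf K<..<Sup K})"
        using le by simp
      also have "\<dots> = emeasure lborel (\<Union>K\<in>\<F>. {Inf K<..<Sup K})"
        using \<F>(1) disj by (intro sum_emeasure) auto
      also have "\<dots> \<le> emeasure lborel U"
      proof (rule emeasure_mono)
        show "(\<Union>K\<in>\<F>. {Inf K<..<Sup K}) \<subseteq> U"
          using int interior_subset KU \<F>(2) by blast
      qed (use U(1) in auto)
      finally have "ennreal (\<Sum>K\<in>\<F>. Sup K - Inf K) < ennreal \<delta>" using U\<delta> by (rule order.strict_trans1)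
      then have "(\<Sum>K\<in>\<F>. Sup K - Inf K) < \<delta>"
        using \<delta>(1) by (simp add: ennreal_less_iff sum_nonneg le)
      from \<delta>(2)[OF fam this] have sm: "(\<Sum>K\<in>\<F>. \<bar>G (Sup K) - G (Inf K)\<bar>) < \<epsilon>" .
      have "emeasure ?\<nu> (\<Union>\<F>) = emeasure ?\<nu> (\<Union>K\<in>\<F>. {Inf K..Sup K})"
        using K(1) \<F>(2) by (intro arg_cong[where f = "emeasure ?\<nu>"]) blast
      also have "\<dots> \<le> (\<Sum>K\<in>\<F>. emeasure ?\<nu> {Inf K..Sup K})"
        using \<F>(1) by (intro emeasure_subadditive_finite) auto
      also have "\<dots> = (\<Sum>K\<in>\<F>. ennreal \<bar>G (Sup K) - G (Inf K)\<bar>)"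
        using le mono by (intro sum.cong refl) (simp add: Icc)
      also have "\<dots> = ennreal (\<Sum>K\<in>\<F>. \<bar>G (Sup K) - G (Inf K)\<bar>)"
        by (intro sum_ennreal) simp
      also have "\<dots> \<le> ennreal \<epsilon>" using sm by (intro ennreal_leI) simp
      finally show ?thesis .
    qed
    show ?thesis
    proof (cases "\<D> = {}")
      case True
      then show ?thesis using D(6) by simp
    next
      case False
      define A where "A n = \<Union>(from_nat_into \<D> ` {..<n})" for n :: nat
      have meas: "A n \<in> sets ?\<nu>" for n
        unfolding A_def
        by (intro sets.finite_Union) (use False K(1) in \<open>auto, metis borel_closed closed_real_atLeastAtMost from_nat_into\<close>)
      have "emeasure ?\<nu> S \<le> emeasure ?\<nu> (\<Union>n. A n)"
      proof (rule emeasure_mono)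
        have "\<Union>\<D> = \<Union>(range (from_nat_into \<D>))"
          using range_from_nat_into[OF False D(1)] by simp
        also have "\<dots> \<subseteq> (\<Union>n. A n)"
        proof -
          have "from_nat_into \<D> n \<subseteq> A (Suc n)" for n
            unfolding A_def by (rule Union_upper) simp
          then show ?thesis by blast
        qed
        finally show "S \<subseteq> (\<Union>n. A n)" by (rule order_trans[OF D(6)])
      qed (intro sets.countable_UN image_subsetI meas)
      also have "\<dots> = (SUP n. emeasure ?\<nu> (A n))"
      proof (intro SUP_emeasure_incseq[symmetric])
        show "incseq A"
          unfolding incseq_def A_def by (intro allI impI Union_mono image_mono) simp
      qed (use meas in blast)
      also have "\<dots> \<le> ennreal \<epsilon>"
        unfolding A_def by (intro SUP_least fin finite_imageI finite_lessThan image_subsetI from_nat_into False)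
      finally show ?thesis .
    qed
  qed
  note eps = this
  have "emeasure ?\<nu> S \<le> 0"
    by (rule ennreal_le_epsilon) (simp add: eps)
  then show ?thesis by (simp add: S_def)
qed

text \<open>The density is integrable on the whole line, so that theorems on indefinite integrals of functions
on the line apply without regard to the end points.\<close>
definition ac_density :: "real \<Rightarrow> real \<Rightarrow> (real \<Rightarrow> real) \<Rightarrow> (real \<Rightarrow> real) \<Rightarrow> bool" where
  "ac_density a b u g \<longleftrightarrow> integrable lborel g \<and>
     (\<forall>x\<in>{a..b}. u x = u a + (LINT t:{a..x}|lborel. g t))"

lemma set_integrable_of_integrable:
  fixes g :: "real \<Rightarrow> real"
  assumes "integrable lborel g" "S \<in> sets borel"
  shows "set_integrable lborel S g"
  unfolding set_integrable_def using assms by (intro integrable_mult_indicator) auto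

lemma set_integral_abs_mono_set:
  fixes g :: "real \<Rightarrow> real"
  assumes "integrable lborel g" "S \<subseteq> T" "S \<in> sets borel" "T \<in> sets borel"
  shows "(LINT t:S|lborel. \<bar>g t\<bar>) \<le> (LINT t:T|lborel. \<bar>g t\<bar>)"
  unfolding set_lebesgue_integral_def
proof (rule integral_mono)
  show "integrable lborel (\<lambda>t. indicator S t *\<^sub>R \<bar>g t\<bar>)" "integrable lborel (\<lambda>t. indicator T t *\<^sub>R \<bar>g t\<bar>)"
    using assms by (intro integrable_mult_indicator integrable_abs; simp)+
qed (use assms(2) in \<open>auto simp: indicator_def\<close>)

text \<open>Continue \<open>F\<close> by constants, to have its Stieltjes measure on the whole line. The density is the
Radon-Nikodym derivative of the part of that measure on \<open>[a,b]\<close>; it is finite almost everywhere,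
since the total mass \<open>F b - F a\<close> is finite.\<close>
lemma monotone_ac_density:
  assumes ac: "abs_continuous_on_Icc a b F" and "a < b"
    and mono: "\<And>x y. a \<le> x \<Longrightarrow> x \<le> y \<Longrightarrow> y \<le> b \<Longrightarrow> F x \<le> F y"
  obtains g where "ac_density a b F g"
proof -
  define G where "G x = F (max a (min b x))" for x
  have G_eq: "G x = F x" if "a \<le> x" "x \<le> b" for x using that by (simp add: G_def)
  have acG: "abs_continuous_on_Icc a b G"
    by (rule abs_continuous_cong[OF _ ac]) (simp add: G_eq)
  have monoG: "G x \<le> G y" if "x \<le> y" for x y
    unfolding G_def using that \<open>a < b\<close> by (intro mono) auto
  have contG: "continuous_on UNIV G"
    unfolding G_def
    by (rule continuous_on_compose2[OF abs_continuous_imp_continuous[OF ac]])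
      (use \<open>a < b\<close> in \<open>auto intro!: continuous_intros\<close>)
  let ?\<nu> = "interval_measure G"
  have Icc: "emeasure ?\<nu> {x..y} = ennreal (G y - G x)" if "x \<le> y" for x y
    using emeasure_interval_measure_Icc[OF that monoG contG] by simp
  define \<nu> where "\<nu> = density ?\<nu> (indicator {a..b})"
  have \<nu>: "emeasure \<nu> A = emeasure ?\<nu> (A \<inter> {a..b})" if "A \<in> sets borel" for A
    unfolding \<nu>_def using that by (subst emeasure_density) (auto simp: indicator_inter_arith[symmetric] Int_commute)
  have sets_\<nu>: "sets \<nu> = sets lborel" by (simp add: \<nu>_def)
  have "absolutely_continuous lborel \<nu>"
    unfolding absolutely_continuous_def
  proof
    fix N :: "real set" assume N: "N \<in> null_sets lborel"
    then have "N \<in> sets borel" by auto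
    with monotone_ac_null_sets[OF acG \<open>a < b\<close> monoG contG N] show "N \<in> null_sets \<nu>"
      by (intro null_setsI) (simp_all add: \<nu> sets_\<nu>)
  qed
  then obtain f where f: "f \<in> borel_measurable lborel" "density lborel f = \<nu>"
    using sigma_finite_measure.Radon_Nikodym[OF sigma_finite_lborel _ sets_\<nu>] by blast
  have int: "(\<integral>\<^sup>+x. f x * indicator A x \<partial>lborel) = emeasure \<nu> A" if "A \<in> sets borel" for A
    using f that by (subst f(2)[symmetric], subst emeasure_density) auto
  have total: "(\<integral>\<^sup>+x. f x \<partial>lborel) < \<infinity>"
    using int[of UNIV] \<open>a < b\<close> by (simp add: \<nu> Icc)
  then have AEf: "AE x in lborel. f x \<noteq> \<infinity>"
    using f(1) by (intro nn_integral_PInf_AE) auto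
  define g where "g = (\<lambda>x. enn2real (f x))"
  have [measurable]: "f \<in> borel_measurable borel" using f(1) by simp
  have [measurable]: "g \<in> borel_measurable borel" unfolding g_def by measurable
  have g_f: "AE x in lborel. ennreal (g x) = f x"
    using AEf by eventually_elim (simp add: g_def less_top)
  have g_int: "integrable lborel g"
  proof (rule integrableI_nonneg)
    have "(\<integral>\<^sup>+x. ennreal (g x) \<partial>lborel) = (\<integral>\<^sup>+x. f x \<partial>lborel)"
      by (rule nn_integral_cong_AE[OF g_f])
    then show "(\<integral>\<^sup>+x. ennreal (g x) \<partial>lborel) < \<infinity>" using total by simp
  qed (simp_all add: g_def)
  have "F x = F a + (LINT t:{a..x}|lborel. g t)" if x: "x \<in> {a..b}" for x
  proof -
    have "(LINT t:{a..x}|lborel. g t) = enn2real (\<integral>\<^sup>+t. ennreal (indicator {a..x} t * g t) \<partial>lborel)"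
      unfolding set_lebesgue_integral_def
      by (subst integral_eq_nn_integral) (auto simp: g_def)
    also have "(\<integral>\<^sup>+t. ennreal (indicator {a..x} t * g t) \<partial>lborel) = (\<integral>\<^sup>+t. f t * indicator {a..x} t \<partial>lborel)"
      by (rule nn_integral_cong_AE) (use g_f in \<open>eventually_elim, auto simp: indicator_def\<close>)
    also have "\<dots> = emeasure ?\<nu> ({a..x} \<inter> {a..b})"
      by (simp add: int \<nu>)
    also have "{a..x} \<inter> {a..b} = {a..x}" using x by auto
    also have "emeasure ?\<nu> {a..x} = ennreal (F x - F a)"
      using x \<open>a < b\<close> by (simp add: Icc G_eq)
    finally show ?thesis using mono[of a x] x by simp
  qed
  with g_int have "ac_density a b F g" unfolding ac_density_def by blast
  then show thesis by (rule that)
qed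

lemma ac_density_diff:
  assumes "ac_density a b u g" "ac_density a b v h"
  shows "ac_density a b (\<lambda>x. u x - v x) (\<lambda>x. g x - h x)"
proof -
  have int: "integrable lborel g" "integrable lborel h"
    using assms unfolding ac_density_def by blast+
  have "u x - v x = u a - v a + (LINT t:{a..x}|lborel. g t - h t)" if "x \<in> {a..b}" for x
  proof -
    have "u x = u a + (LINT t:{a..x}|lborel. g t)" "v x = v a + (LINT t:{a..x}|lborel. h t)"
      using assms that unfolding ac_density_def by blast+
    moreover have "(LINT t:{a..x}|lborel. g t - h t) = (LINT t:{a..x}|lborel. g t) - (LINT t:{a..x}|lborel. h t)"
      using int by (intro set_integral_diff(2) set_integrable_of_integrable) auto
    ultimately show ?thesis by linarith
  qed
  moreover have "integrable lborel (\<lambda>x. g x - h x)" using int by (rule Bochner_Integration.integrable_diff)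
  ultimately show ?thesis unfolding ac_density_def by blast
qed

lemma abs_continuous_imp_ac_density:
  assumes ac: "abs_continuous_on_Icc a b u" and "a < b"
  obtains g where "ac_density a b u g"
proof -
  obtain V where V: "abs_continuous_on_Icc a b V"
    "\<And>x y. a \<le> x \<Longrightarrow> x \<le> y \<Longrightarrow> y \<le> b \<Longrightarrow> \<bar>u y - u x\<bar> \<le> V y - V x"
    by (rule abs_continuous_decomposition[OF ac less_imp_le[OF \<open>a < b\<close>]]) (rule that; assumption)
  have "V x \<le> V y" "V x - u x \<le> V y - u y" if "a \<le> x" "x \<le> y" "y \<le> b" for x y
    using V(2)[OF that] by linarith+
  note mono = this
  obtain g where g: "ac_density a b V g"
    by (rule monotone_ac_density[OF V(1) \<open>a < b\<close> mono(1)])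
  obtain h where h: "ac_density a b (\<lambda>x. V x - u x) h"
    by (rule monotone_ac_density[OF abs_continuous_diff[OF V(1) ac] \<open>a < b\<close> mono(2)])
  show thesis
    using ac_density_diff[OF g h] by (intro that) simp
qed

section \<open>Derivatives and the metric of AC\<close>

text \<open>One half of the Lebesgue differentiation theorem on the line; reflection gives the other half.\<close>
lemma right_averages_converge:
  fixes g :: "real \<Rightarrow> real"
  assumes "integrable lborel g"
  obtains N where "negligible N"
    "\<And>x e. x \<notin> N \<Longrightarrow> 0 < e \<Longrightarrow> \<exists>d>0. \<forall>h. 0 < h \<and> h < d \<longrightarrow> \<bar>integral {x..x + h} g / h - g x\<bar> < e"
proof -
  have "g integrable_on cbox a b" for a b
    using set_borel_integral_eq_integral(1)[OF set_integrable_of_integrable[OF assms, of "cbox a b"]] by simp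
  then obtain N where N: "negligible N" "\<And>x e. x \<notin> N \<Longrightarrow> 0 < e \<Longrightarrow>
      \<exists>d>0. \<forall>h. 0 < h \<and> h < d \<longrightarrow> norm (integral (cbox x (x + h *\<^sub>R One)) g /\<^sub>R h ^ DIM(real) - g x) < e"
    by (rule integrable_ccontinuous_explicit) blast
  show thesis
    by (rule that[OF N(1)]) (use N(2) in \<open>simp add: divide_inverse mult.commute\<close>)
qed

lemma left_averages_converge:
  fixes g :: "real \<Rightarrow> real"
  assumes "integrable lborel g"
  obtains N where "negligible N"
    "\<And>x e. x \<notin> N \<Longrightarrow> 0 < e \<Longrightarrow> \<exists>d>0. \<forall>h. 0 < h \<and> h < d \<longrightarrow> \<bar>integral {x - h..x} g / h - g x\<bar> < e"
proof -
  have "integrable lborel (\<lambda>x. g (- x))"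
    using assms lborel_integrable_real_affine[of g "-1" 0] by simp
  from right_averages_converge[OF this] obtain N where N: "negligible N"
    "\<And>x e. x \<notin> N \<Longrightarrow> 0 < e \<Longrightarrow>
      \<exists>d>0. \<forall>h. 0 < h \<and> h < d \<longrightarrow> \<bar>integral {x..x + h} (\<lambda>x. g (- x)) / h - g (- x)\<bar> < e" by blast
  have "negligible (uminus ` N)"
    by (rule negligible_differentiable_image_negligible[OF _ N(1)])
      (auto intro!: derivative_intros)
  moreover have "\<exists>d>0. \<forall>h. 0 < h \<and> h < d \<longrightarrow> \<bar>integral {x - h..x} g / h - g x\<bar> < e"
    if "x \<notin> uminus ` N" "0 < e" for x e
  proof -
    have "- x \<notin> N" using that(1) by force
    have "integral {- x..- x + h} (\<lambda>x. g (- x)) = integral {x - h..x} g" for h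
      using Henstock_Kurzweil_Integration.integral_reflect_real[of x "x - h" g] by (simp add: add.commute)
    then show ?thesis using N(2)[OF \<open>- x \<notin> N\<close> that(2)] by simp
  qed
  ultimately show thesis by (rule that)
qed

lemma ac_density_increment:
  assumes "ac_density a b u g" "a \<le> x" "x \<le> y" "y \<le> b"
  shows "u y - u x = integral {x..y} g"
proof -
  have g: "integrable lborel g" using assms(1) unfolding ac_density_def by blast
  have eq: "u z = u a + integral {a..z} g" if "z \<in> {a..b}" for z
  proof -
    have "u z = u a + (LINT t:{a..z}|lborel. g t)"
      using assms(1) that unfolding ac_density_def by blast
    also have "(LINT t:{a..z}|lborel. g t) = integral {a..z} g"
      by (intro set_borel_integral_eq_integral(2) set_integrable_of_integrable[OF g]) simp
    finally show ?thesis .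
  qed
  have "integral {a..x} g + integral {x..y} g = integral {a..y} g"
    using assms set_borel_integral_eq_integral(1)[OF set_integrable_of_integrable[OF g, of "{a..y}"]]
    by (intro Henstock_Kurzweil_Integration.integral_combine) simp_all
  moreover have "u x = u a + integral {a..x} g" "u y = u a + integral {a..y} g"
    using assms(2-4) by (intro eq; simp)+
  ultimately show ?thesis by linarith
qed

text \<open>The one-sided difference quotients of \<open>u\<close> at \<open>x\<close> are the averages of \<open>g\<close> over the intervals on
the two sides of \<open>x\<close>.\<close>
lemma ac_density_has_derivative:
  assumes u: "ac_density a b u g"
  shows "AE x in lebesgue. x \<in> {a<..<b} \<longrightarrow> (u has_real_derivative g x) (at x)"
proof -
  have g: "integrable lborel g" using u unfolding ac_density_def by blast
  obtain N where N: "negligible N"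
    "\<And>x e. x \<notin> N \<Longrightarrow> 0 < e \<Longrightarrow> \<exists>d>0. \<forall>h. 0 < h \<and> h < d \<longrightarrow> \<bar>integral {x..x + h} g / h - g x\<bar> < e"
    by (rule right_averages_converge[OF g]) blast
  obtain N' where N': "negligible N'"
    "\<And>x e. x \<notin> N' \<Longrightarrow> 0 < e \<Longrightarrow> \<exists>d>0. \<forall>h. 0 < h \<and> h < d \<longrightarrow> \<bar>integral {x - h..x} g / h - g x\<bar> < e"
    by (rule left_averages_converge[OF g]) blast
  have "(u has_real_derivative g x) (at x)" if x: "x \<in> {a<..<b}" "x \<notin> N \<union> N'" for x
    unfolding DERIV_def LIM_eq
  proof (intro allI impI)
    fix e :: real assume "e > 0"
    obtain d where d: "d > 0" "\<And>h. 0 < h \<Longrightarrow> h < d \<Longrightarrow> \<bar>integral {x..x + h} g / h - g x\<bar> < e"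
      using N(2)[of x e] x(2) \<open>e > 0\<close> by blast
    obtain d' where d': "d' > 0" "\<And>h. 0 < h \<Longrightarrow> h < d' \<Longrightarrow> \<bar>integral {x - h..x} g / h - g x\<bar> < e"
      using N'(2)[of x e] x(2) \<open>e > 0\<close> by blast
    define s where "s = Min {d, d', x - a, b - x}"
    have s: "s > 0" "s \<le> d" "s \<le> d'" "s \<le> x - a" "s \<le> b - x"
      using d d' x(1) by (simp_all add: s_def)
    have "\<bar>(u (x + h) - u x) / h - g x\<bar> < e" if h: "h \<noteq> 0" "\<bar>h\<bar> < s" for h
    proof (cases "h > 0")
      case True
      then have "u (x + h) - u x = integral {x..x + h} g"
        using h s x(1) by (intro ac_density_increment[OF u]) auto
      then show ?thesis using d(2)[of h] True h s by simp
    next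
      case False
      then have "u x - u (x + h) = integral {x + h..x} g"
        using h s x(1) by (intro ac_density_increment[OF u]) auto
      moreover have "(u (x + h) - u x) / h = (u x - u (x + h)) / (- h)"
        by (metis minus_diff_eq minus_divide_divide)
      ultimately have "(u (x + h) - u x) / h = integral {x - (- h)..x} g / (- h)"
        by (simp only: diff_minus_eq_add)
      moreover have "\<bar>integral {x - (- h)..x} g / (- h) - g x\<bar> < e"
        using False h s by (intro d'(2)) auto
      ultimately show ?thesis by (simp only:)
    qed
    then show "\<exists>s>0. \<forall>h. h \<noteq> 0 \<and> norm (h - 0) < s \<longrightarrow> norm ((u (x + h) - u x) / h - g x) < e"
      using s(1) by (intro exI[of _ s]) simp
  qed
  moreover have "N \<union> N' \<in> null_sets lebesgue"
    using N(1) N'(1) by (auto simp: negligible_iff_null_sets)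
  ultimately show ?thesis
    by (intro AE_I'[of "N \<union> N'"]) blast+
qed

text \<open>The values of \<^const>\<open>deriv\<close> at the exceptional points and at the two end points are arbitrary, but
these points form a null set. From here on the norm is computed from densities only.\<close>
lemma AC_norm_eq_density:
  assumes u: "ac_density a b u g"
  shows "AC_norm a b u = \<bar>u a\<bar> + (LINT x:{a..b}|lborel. \<bar>g x\<bar>)"
proof -
  have g [measurable]: "g \<in> borel_measurable lborel"
    using u unfolding ac_density_def by (blast dest: borel_measurable_integrable)
  have ae: "AE x in lebesgue. indicator {a..b} x *\<^sub>R \<bar>g x\<bar> = indicator {a..b} x *\<^sub>R \<bar>deriv u x\<bar>"
    using ac_density_has_derivative[OF u] AE_completion[OF AE_lborel_singleton[of a]]
      AE_completion[OF AE_lborel_singleton[of b]]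
    by eventually_elim (auto simp: indicator_def DERIV_imp_deriv)
  have meas: "(\<lambda>x. indicator {a..b} x *\<^sub>R \<bar>g x\<bar>) \<in> borel_measurable lebesgue"
    by (rule measurable_completion) measurable
  have "(LINT x:{a..b}|lebesgue. \<bar>deriv u x\<bar>) = (LINT x:{a..b}|lebesgue. \<bar>g x\<bar>)"
    unfolding set_lebesgue_integral_def 
    by (rule integral_cong_AE[OF meas borel_measurable_AE[OF meas ae] ae, symmetric])
  also have "\<dots> = (LINT x:{a..b}|lborel. \<bar>g x\<bar>)"
    unfolding set_lebesgue_integral_def by (rule integral_completion) measurable
  finally show ?thesis by (simp add: AC_norm_def)
qed

lemma ac_density_AC:
  assumes "u \<in> AC a b" "a < b"
  obtains g where "ac_density a b u g"
  using assms abs_continuous_imp_ac_density unfolding AC_def by blast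

lemma AC_dist_eq_density:
  assumes "ac_density a b u g" "ac_density a b v h"
  shows "AC_dist a b u v = \<bar>u a - v a\<bar> + (LINT x:{a..b}|lborel. \<bar>g x - h x\<bar>)"
  unfolding AC_dist_def by (rule AC_norm_eq_density[OF ac_density_diff[OF assms]])

text \<open>The axioms of \<^locale>\<open>Metric_space\<close> ask for symmetry on the whole type, also for functions outside \<open>AC\<close>.
Where \<open>f\<close> has no derivative, \<^const>\<open>deriv\<close> picks the same arbitrary number for \<open>f\<close> and \<open>- f\<close>.\<close>
lemma deriv_uminus_abs: "\<bar>deriv (\<lambda>x. - f x) x\<bar> = \<bar>deriv f x\<bar>" for f :: "real \<Rightarrow> real"
proof (cases "f field_differentiable at x")
  case True
  then show ?thesis by simp
next
  case False
  have "\<not> (\<lambda>x. - f x) field_differentiable at x"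
    using False field_differentiable_minus[of "\<lambda>x. - f x" "at x"] by auto
  then show ?thesis
    using False unfolding field_differentiable_def deriv_def by simp
qed

lemma Metric_space_AC:
  assumes "a < b"
  shows "Metric_space (AC a b) (AC_dist a b)"
proof
  show "0 \<le> AC_dist a b u v" for u v
    unfolding AC_dist_def AC_norm_def set_lebesgue_integral_def by (intro add_nonneg_nonneg integral_nonneg_AE) auto
next
  show "AC_dist a b u v = AC_dist a b v u" for u v
    using deriv_uminus_abs[of "\<lambda>x. u x - v x"] by (simp add: AC_dist_def AC_norm_def abs_minus_commute)
next
  fix u v assume uv: "u \<in> AC a b" "v \<in> AC a b"
  obtain g where g: "ac_density a b u g" using ac_density_AC[OF uv(1) assms] .
  obtain h where h: "ac_density a b v h" using ac_density_AC[OF uv(2) assms] .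
  have gh: "ac_density a b (\<lambda>x. u x - v x) (\<lambda>x. g x - h x)" by (rule ac_density_diff[OF g h])
  then have int: "integrable lborel (\<lambda>x. g x - h x)" unfolding ac_density_def by blast
  show "AC_dist a b u v = 0 \<longleftrightarrow> u = v"
  proof
    assume "AC_dist a b u v = 0"
    moreover have "(LINT x:{a..b}|lborel. \<bar>g x - h x\<bar>) \<ge> 0"
      unfolding set_lebesgue_integral_def by (intro integral_nonneg_AE) auto
    ultimately have 0: "u a = v a" "(LINT x:{a..b}|lborel. \<bar>g x - h x\<bar>) = 0"
      unfolding AC_dist_eq_density[OF g h] by linarith+
    have "u x = v x" if "x \<in> {a..b}" for x
    proof -
      have "u x - v x = u a - v a + (LINT t:{a..x}|lborel. g t - h t)"
        using gh that unfolding ac_density_def by blast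
      then have "\<bar>u x - v x\<bar> = \<bar>LINT t:{a..x}|lborel. g t - h t\<bar>" using 0(1) by simp
      also have "\<dots> \<le> (LINT t:{a..x}|lborel. \<bar>g t - h t\<bar>)"
        using set_integral_norm_bound[OF set_integrable_of_integrable[OF int, of "{a..x}"]] by simp
      also have "\<dots> \<le> (LINT t:{a..b}|lborel. \<bar>g t - h t\<bar>)"
        using that int by (intro set_integral_abs_mono_set) auto
      finally show ?thesis using 0(2) by simp
    qed
    then show "u = v" using uv by (intro extensionalityI[of u "{a..b}" v]) (auto simp: AC_def)
  qed (simp add: AC_dist_def AC_norm_def set_lebesgue_integral_def)
next
  fix u v w assume uvw: "u \<in> AC a b" "v \<in> AC a b" "w \<in> AC a b"
  obtain g where g: "ac_density a b u g" using ac_density_AC[OF uvw(1) assms] .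
  obtain h where h: "ac_density a b v h" using ac_density_AC[OF uvw(2) assms] .
  obtain k where k: "ac_density a b w k" using ac_density_AC[OF uvw(3) assms] .
  have int: "integrable lborel g" "integrable lborel h" "integrable lborel k"
    using g h k unfolding ac_density_def by blast+
  have "(LINT x:{a..b}|lborel. \<bar>g x - k x\<bar>) \<le> (LINT x:{a..b}|lborel. \<bar>g x - h x\<bar> + \<bar>h x - k x\<bar>)"
    using int by (intro set_integral_mono set_integrable_of_integrable) auto
  also have "\<dots> = (LINT x:{a..b}|lborel. \<bar>g x - h x\<bar>) + (LINT x:{a..b}|lborel. \<bar>h x - k x\<bar>)"
    using int by (intro set_integral_add set_integrable_of_integrable) auto
  finally show "AC_dist a b u w \<le> AC_dist a b u v + AC_dist a b v w"
    unfolding AC_dist_eq_density[OF g k] AC_dist_eq_density[OF g h] AC_dist_eq_density[OF h k] by simp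
qed

section \<open>Approximation by polynomials\<close>

text \<open>Lebesgue measurable functions are almost everywhere limits of continuous ones. Truncating \<open>g\<close> and
the approximating functions at the same height provides the bound for dominated convergence.\<close>
lemma continuous_dense_L1:
  fixes g :: "real \<Rightarrow> real"
  assumes g: "integrable lborel g" and "e > 0"
  obtains h where "continuous_on UNIV h" "(LINT x:{a..b}|lborel. \<bar>g x - h x\<bar>) < e"
proof -
  define c where "c N y = max (- N) (min N y)" for N y :: real
  have c_cont: "continuous_on UNIV (c N)" for N
    unfolding c_def by (intro continuous_intros)
  have c_meas [measurable]: "c N \<in> borel_measurable borel" for N
    by (rule borel_measurable_continuous_onI[OF c_cont])
  have [measurable]: "g \<in> borel_measurable borel"
    using borel_measurable_integrable[OF g] by simp
  have c_bound: "\<bar>c N y\<bar> \<le> N" if "0 \<le> N" for N y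
    using that by (auto simp: c_def)
  have c_id: "c N y = y" if "\<bar>y\<bar> \<le> N" for N y
    using that by (auto simp: c_def)
  have "(\<lambda>n. LINT x:{a..b}|lborel. \<bar>g x - c (real n) (g x)\<bar>) \<longlonglongrightarrow> integral\<^sup>L (lborel :: real measure) (\<lambda>x. 0 :: real)"
    unfolding set_lebesgue_integral_def
  proof (rule integral_dominated_convergence[where w = "\<lambda>x. \<bar>g x\<bar>"])
    show "AE x in lborel. (\<lambda>n. indicator {a..b} x *\<^sub>R \<bar>g x - c (real n) (g x)\<bar>) \<longlonglongrightarrow> 0"
    proof (rule AE_I2, rule tendsto_eventually)
      fix x
      obtain N :: nat where "\<bar>g x\<bar> \<le> real N" using real_arch_simple by blast
      then have "c (real n) (g x) = g x" if "n \<ge> N" for n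
        using that by (intro c_id) (meson of_nat_mono order_trans)
      then show "\<forall>\<^sub>F n in sequentially. indicator {a..b} x *\<^sub>R \<bar>g x - c (real n) (g x)\<bar> = 0"
        by (intro eventually_sequentiallyI[of N]) simp
    qed
    show "AE x in lborel. norm (indicator {a..b} x *\<^sub>R \<bar>g x - c (real n) (g x)\<bar>) \<le> \<bar>g x\<bar>" for n
      by (rule AE_I2) (auto simp: c_def indicator_def)
    show "integrable lborel (\<lambda>x. \<bar>g x\<bar>)" using g by (rule integrable_abs)
  qed measurable
  then have "\<forall>\<^sub>F n in sequentially. (LINT x:{a..b}|lborel. \<bar>g x - c (real n) (g x)\<bar>) < e / 2"
    by (rule order_tendstoD) (use \<open>e > 0\<close> in simp)
  then obtain n :: nat where n: "(LINT x:{a..b}|lborel. \<bar>g x - c (real n) (g x)\<bar>) < e / 2"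
    using eventually_happens' sequentially_bot by blast
  have "g measurable_on UNIV"
    by (intro lebesgue_measurable_imp_measurable_on measurable_completion) auto
  then have "\<exists>N hs. negligible N \<and> (\<forall>k. continuous_on UNIV (hs k)) \<and>
      (\<forall>x. x \<notin> N \<longrightarrow> (\<lambda>k. hs k x) \<longlonglongrightarrow> g x)"
    by (simp add: measurable_on_def)
  then obtain N hs where hs: "negligible N" "\<forall>k. continuous_on UNIV (hs k)"
    "\<forall>x. x \<notin> N \<longrightarrow> (\<lambda>k. hs k x) \<longlonglongrightarrow> g x"
    by (elim exE conjE)
  have [measurable]: "hs k \<in> borel_measurable borel" for k
    by (rule borel_measurable_continuous_onI[OF hs(2)[rule_format]])
  have "AE x in lebesgue. (\<lambda>k. hs k x) \<longlonglongrightarrow> g x"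
  proof (rule AE_I')
    show "N \<in> null_sets lebesgue" using hs(1) by (simp add: negligible_iff_null_sets)
    show "{x \<in> space lebesgue. \<not> (\<lambda>k. hs k x) \<longlonglongrightarrow> g x} \<subseteq> N" using hs(3) by blast
  qed
  then have ae: "AE x in lborel. (\<lambda>k. hs k x) \<longlonglongrightarrow> g x"
    by (simp add: AE_completion_iff)
  have int_ind: "integrable lborel (indicator {a..b} :: real \<Rightarrow> real)"
    by (cases "a \<le> b") auto
  have "(\<lambda>k. LINT x:{a..b}|lborel. \<bar>c (real n) (g x) - c (real n) (hs k x)\<bar>) \<longlonglongrightarrow> integral\<^sup>L (lborel :: real measure) (\<lambda>x. 0 :: real)"
    unfolding set_lebesgue_integral_def
  proof (rule integral_dominated_convergence[where w = "\<lambda>x. indicator {a..b} x *\<^sub>R (2 * real n)"])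
    show "AE x in lborel. (\<lambda>k. indicator {a..b} x *\<^sub>R \<bar>c (real n) (g x) - c (real n) (hs k x)\<bar>) \<longlonglongrightarrow> 0"
      using ae
    proof eventually_elim
      fix x assume "(\<lambda>k. hs k x) \<longlonglongrightarrow> g x"
      then have "(\<lambda>k. c (real n) (hs k x)) \<longlonglongrightarrow> c (real n) (g x)"
        by (intro continuous_on_tendsto_compose[OF c_cont]) auto
      then have "(\<lambda>k. indicator {a..b} x *\<^sub>R \<bar>c (real n) (g x) - c (real n) (hs k x)\<bar>)
          \<longlonglongrightarrow> indicator {a..b} x *\<^sub>R \<bar>c (real n) (g x) - c (real n) (g x)\<bar>"
        by (intro tendsto_intros)
      then show "(\<lambda>k. indicator {a..b} x *\<^sub>R \<bar>c (real n) (g x) - c (real n) (hs k x)\<bar>) \<longlonglongrightarrow> 0" by simp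
    qed
    show "AE x in lborel. norm (indicator {a..b} x *\<^sub>R \<bar>c (real n) (g x) - c (real n) (hs k x)\<bar>)
        \<le> indicator {a..b} x *\<^sub>R (2 * real n)" for k
    proof (rule AE_I2)
      fix x
      show "norm (indicator {a..b} x *\<^sub>R \<bar>c (real n) (g x) - c (real n) (hs k x)\<bar>) \<le> indicator {a..b} x *\<^sub>R (2 * real n)"
        using c_bound[of "real n" "g x"] c_bound[of "real n" "hs k x"]
        by (cases "x \<in> {a..b}") auto
    qed
    show "integrable lborel (\<lambda>x. indicator {a..b} x *\<^sub>R (2 * real n))"
      using int_ind by simp
  qed measurable
  then have "\<forall>\<^sub>F k in sequentially. (LINT x:{a..b}|lborel. \<bar>c (real n) (g x) - c (real n) (hs k x)\<bar>) < e / 2"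
    by (rule order_tendstoD) (use \<open>e > 0\<close> in simp)
  then obtain k where k: "(LINT x:{a..b}|lborel. \<bar>c (real n) (g x) - c (real n) (hs k x)\<bar>) < e / 2"
    using eventually_happens' sequentially_bot by blast
  define h where "h x = c (real n) (hs k x)" for x
  have h_cont: "continuous_on UNIV h"
    unfolding h_def by (rule continuous_on_compose2[OF c_cont hs(2)[rule_format]]) auto
  have [measurable]: "h \<in> borel_measurable borel"
    by (rule borel_measurable_continuous_onI[OF h_cont])
  have bounded_int: "set_integrable lborel {a..b} f"
    if [measurable]: "f \<in> borel_measurable borel" and "\<And>x. \<bar>f x\<bar> \<le> real n" for f :: "real \<Rightarrow> real"
    unfolding set_integrable_def
  proof (rule Bochner_Integration.integrable_bound[of _ "\<lambda>x. indicator {a..b} x *\<^sub>R real n"])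
    show "integrable lborel (\<lambda>x. indicator {a..b} x *\<^sub>R real n)" using int_ind by simp
    show "AE x in lborel. norm (indicator {a..b} x *\<^sub>R f x) \<le> norm (indicator {a..b} x *\<^sub>R real n)"
      using that(2) by (intro AE_I2) (simp add: indicator_def)
  qed measurable
  have ints: "set_integrable lborel {a..b} g" "set_integrable lborel {a..b} (\<lambda>x. c (real n) (g x))"
    "set_integrable lborel {a..b} h"
    using c_bound by (auto intro!: bounded_int set_integrable_of_integrable[OF g] simp: h_def)
  have "(LINT x:{a..b}|lborel. \<bar>g x - h x\<bar>)
      \<le> (LINT x:{a..b}|lborel. \<bar>g x - c (real n) (g x)\<bar> + \<bar>c (real n) (g x) - h x\<bar>)"
    using ints by (intro set_integral_mono set_integrable_abs set_integral_diff set_integral_add) auto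
  also have "\<dots> = (LINT x:{a..b}|lborel. \<bar>g x - c (real n) (g x)\<bar>) + (LINT x:{a..b}|lborel. \<bar>c (real n) (g x) - h x\<bar>)"
    using ints by (intro set_integral_add set_integrable_abs set_integral_diff) auto
  also have "\<dots> < e" using n k by (simp add: h_def)
  finally show thesis by (rule that[OF h_cont])
qed

definition rat_poly :: "rat list \<Rightarrow> real \<Rightarrow> real" where
  "rat_poly qs x = (\<Sum>i<length qs. of_rat (qs ! i) * x ^ i)"

lemma continuous_rat_poly: "continuous_on S (rat_poly qs)"
  unfolding rat_poly_def by (intro continuous_intros)

lemma rat_poly_dense_uniform:
  fixes h :: "real \<Rightarrow> real"
  assumes "continuous_on {a..b} h" "e > 0"
  obtains qs where "\<And>x. x \<in> {a..b} \<Longrightarrow> \<bar>h x - rat_poly qs x\<bar> < e"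
proof -
  obtain p where p: "real_polynomial_function p" "\<And>x. x \<in> {a..b} \<Longrightarrow> \<bar>h x - p x\<bar> < e / 2"
    using Stone_Weierstrass_real_polynomial_function[of "{a..b}" h "e / 2"] assms by auto
  obtain c n where pc: "p = (\<lambda>x. \<Sum>i\<le>n. c i * x ^ i)"
    using p(1) unfolding real_polynomial_function_iff_sum by blast
  define B where "B = 1 + \<bar>a\<bar> + \<bar>b\<bar>"
  define C where "C = real (Suc n) * B ^ n"
  define \<eta> where "\<eta> = e / (2 * C)"
  have "B \<ge> 1" by (simp add: B_def)
  then have "B ^ n > 0" by simp
  then have "C > 0" by (simp add: C_def)
  then have "\<eta> > 0" using \<open>e > 0\<close> by (simp add: \<eta>_def)
  have "\<exists>q. \<bar>c i - of_rat q\<bar> < \<eta>" for i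
  proof -
    have "c i - \<eta> < c i + \<eta>" using \<open>\<eta> > 0\<close> by simp
    then obtain q where "c i - \<eta> < of_rat q" "of_rat q < c i + \<eta>" using of_rat_dense by blast
    then have "\<bar>c i - of_rat q\<bar> < \<eta>" by linarith
    then show ?thesis by blast
  qed
  then obtain q where q: "\<And>i. \<bar>c i - of_rat (q i)\<bar> < \<eta>" by metis
  define qs where "qs = map q [0..<Suc n]"
  have qs: "rat_poly qs x = (\<Sum>i\<le>n. of_rat (q i) * x ^ i)" for x
    unfolding rat_poly_def qs_def by (rule sum.cong) (auto simp del: upt_Suc)
  have "\<bar>h x - rat_poly qs x\<bar> < e" if x: "x \<in> {a..b}" for x
  proof -
    have "\<bar>p x - rat_poly qs x\<bar> = \<bar>\<Sum>i\<le>n. (c i - of_rat (q i)) * x ^ i\<bar>"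
      by (simp add: pc qs sum_subtractf left_diff_distrib)
    also have "\<dots> \<le> (\<Sum>i\<le>n. \<eta> * B ^ n)"
    proof (rule order_trans[OF sum_abs sum_mono])
      fix i assume i: "i \<in> {..n}"
      have "\<bar>x\<bar> \<le> B" using x by (auto simp: B_def)
      then have "\<bar>x\<bar> ^ i \<le> B ^ i" by (intro power_mono) auto
      also have "\<dots> \<le> B ^ n" using i \<open>B \<ge> 1\<close> by (intro power_increasing) auto
      finally show "\<bar>(c i - of_rat (q i)) * x ^ i\<bar> \<le> \<eta> * B ^ n"
        unfolding abs_mult power_abs using q[of i] \<open>\<eta> > 0\<close> by (intro mult_mono) auto
    qed
    also have "\<dots> = C * \<eta>" by (simp add: C_def algebra_simps)
    also have "\<dots> = e / 2" using \<open>C > 0\<close> by (simp add: \<eta>_def)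
    finally show ?thesis using p(2)[OF x] by linarith
  qed
  then show thesis by (rule that)
qed

lemma rat_poly_dense_L1:
  fixes g :: "real \<Rightarrow> real"
  assumes g: "integrable lborel g" and "e > 0" "a < b"
  obtains qs where "(LINT x:{a..b}|lborel. \<bar>g x - rat_poly qs x\<bar>) < e"
proof -
  obtain h where h: "continuous_on UNIV h" "(LINT x:{a..b}|lborel. \<bar>g x - h x\<bar>) < e / 2"
    by (rule continuous_dense_L1[OF g half_gt_zero[OF \<open>e > 0\<close>]])
  have "e / (2 * (b - a)) > 0" using assms by simp
  then obtain qs where qs: "\<And>x. x \<in> {a..b} \<Longrightarrow> \<bar>h x - rat_poly qs x\<bar> < e / (2 * (b - a))"
    by (rule rat_poly_dense_uniform[OF continuous_on_subset[OF h(1) subset_UNIV]]) blast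
  have ints: "set_integrable lborel {a..b} g" "set_integrable lborel {a..b} h"
    "set_integrable lborel {a..b} (rat_poly qs)" "set_integrable lborel {a..b} (\<lambda>_. e / (2 * (b - a)))"
    by (simp add: set_integrable_of_integrable[OF g])
      (intro borel_integrable_atLeastAtMost' continuous_rat_poly continuous_on_subset[OF h(1)]
        continuous_on_const subset_UNIV)+
  have "(LINT x:{a..b}|lborel. \<bar>g x - rat_poly qs x\<bar>) \<le> (LINT x:{a..b}|lborel. \<bar>g x - h x\<bar> + e / (2 * (b - a)))"
  proof (rule set_integral_mono)
    show "\<bar>g x - rat_poly qs x\<bar> \<le> \<bar>g x - h x\<bar> + e / (2 * (b - a))" if "x \<in> {a..b}" for x
      using qs[OF that] by linarith
  qed (use ints in \<open>auto intro!: set_integrable_abs set_integral_diff set_integral_add\<close>)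
  also have "\<dots> = (LINT x:{a..b}|lborel. \<bar>g x - h x\<bar>) + (LINT x:{a..b}|lborel. e / (2 * (b - a)))"
    using ints by (intro set_integral_add set_integrable_abs set_integral_diff)
  also have "(LINT x:{a..b}|lborel. e / (2 * (b - a))) = e / 2"
    using \<open>a < b\<close> by (simp add: set_integral_const field_simps)
  finally show thesis using h(2) by (intro that[of qs]) simp
qed

section \<open>The norm as a limit over grids\<close>

lemma integral_grid_sum:
  fixes f :: "real \<Rightarrow> real"
  assumes int: "\<And>s t. f integrable_on {s..t}" and mono: "\<And>i. x i \<le> x (Suc i)"
  shows "(\<Sum>i<n. integral {x i..x (Suc i)} f) = integral {x 0..x n} f"
proof (induction n)
  case 0
  show ?case by simp
next
  case (Suc n)
  have "x 0 \<le> x n" using lift_Suc_mono_le[of x, OF mono] by simp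
  then have "integral {x 0..x n} f + integral {x n..x (Suc n)} f = integral {x 0..x (Suc n)} f"
    by (intro Henstock_Kurzweil_Integration.integral_combine int mono)
  then show ?case using Suc by simp
qed

definition grid :: "real \<Rightarrow> real \<Rightarrow> nat \<Rightarrow> nat \<Rightarrow> real" where
  "grid a b n i = a + (b - a) * (i / Suc n)"

lemma grid_0: "grid a b n 0 = a" and grid_end: "grid a b n (Suc n) = b"
  by (simp_all add: grid_def del: of_nat_Suc)

lemma grid_mono: "a \<le> b \<Longrightarrow> i \<le> j \<Longrightarrow> grid a b n i \<le> grid a b n j"
  unfolding grid_def by (intro add_left_mono mult_left_mono divide_right_mono) auto

lemma grid_step: "grid a b n (Suc i) - grid a b n i = (b - a) / Suc n"
proof -
  have "real (Suc i) / real (Suc n) = real i / real (Suc n) + 1 / real (Suc n)"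
    by (simp add: add_divide_distrib)
  then show ?thesis by (simp add: grid_def distrib_left del: of_nat_Suc)
qed

lemma grid_in: "a \<le> b \<Longrightarrow> i \<le> Suc n \<Longrightarrow> grid a b n i \<in> {a..b}"
  using grid_mono[of a b 0 i n] grid_mono[of a b i "Suc n" n] by (simp add: grid_0 grid_end)

text \<open>Where \<open>h\<close> oscillates by at most \<open>\<eta>\<close>, both integrals differ from \<open>|h s| (t - s)\<close> by at most
\<open>\<eta> (t - s)\<close>: cancellation between positive and negative values of \<open>h\<close> is a small effect.\<close>
lemma abs_integral_ge_oscillation:
  fixes h :: "real \<Rightarrow> real"
  assumes "s \<le> t" "continuous_on {s..t} h" "\<And>x. x \<in> {s..t} \<Longrightarrow> \<bar>h x - h s\<bar> \<le> \<eta>"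
  shows "integral {s..t} (\<lambda>x. \<bar>h x\<bar>) - 2 * \<eta> * (t - s) \<le> \<bar>integral {s..t} h\<bar>"
proof -
  have int: "h integrable_on {s..t}" "(\<lambda>x. \<bar>h x\<bar>) integrable_on {s..t}" "(\<lambda>x. h x - h s) integrable_on {s..t}"
    using assms(2) by (auto intro!: integrable_continuous_real continuous_intros)
  have "integral {s..t} (\<lambda>x. \<bar>h x\<bar>) \<le> integral {s..t} (\<lambda>_. \<bar>h s\<bar> + \<eta>)"
    by (rule integral_le[OF int(2) integrable_const_ivl]) (use assms(3) in force)
  also have "\<dots> = (\<bar>h s\<bar> + \<eta>) * (t - s)" using \<open>s \<le> t\<close> by simp
  finally have 1: "integral {s..t} (\<lambda>x. \<bar>h x\<bar>) \<le> (\<bar>h s\<bar> + \<eta>) * (t - s)" .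
  have "integral {s..t} h - integral {s..t} (\<lambda>_. h s) = integral {s..t} (\<lambda>x. h x - h s)"
    using int(1) by (intro Henstock_Kurzweil_Integration.integral_diff[symmetric] integrable_const_ivl)
  moreover have "norm (integral {s..t} (\<lambda>x. h x - h s)) \<le> integral {s..t} (\<lambda>_. \<eta>)"
    by (rule integral_norm_bound_integral[OF int(3) integrable_const_ivl]) (use assms(3) in simp)
  ultimately have 2: "\<bar>integral {s..t} h - h s * (t - s)\<bar> \<le> \<eta> * (t - s)"
    using \<open>s \<le> t\<close> by (simp add: mult.commute)
  have "\<bar>h s * (t - s)\<bar> = \<bar>h s\<bar> * (t - s)" using \<open>s \<le> t\<close> by (simp add: abs_mult)
  with 1 2 show ?thesis by (simp add: algebra_simps)
qed

text \<open>The sums never exceed the integral. For the lower bound replace \<open>g\<close> by a continuous \<open>h\<close> that is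
close to it in \<open>L\<^sup>1\<close>; on a fine grid \<open>h\<close> hardly oscillates within a cell, so that hardly any mass
is lost by cancellation. What matters later is that the sums use finitely many values of \<open>u\<close>.\<close>
lemma grid_variation_tendsto:
  assumes u: "ac_density a b u g" and "a < b"
  shows "(\<lambda>n. \<Sum>i<Suc n. \<bar>u (grid a b n (Suc i)) - u (grid a b n i)\<bar>)
    \<longlonglongrightarrow> (LINT x:{a..b}|lborel. \<bar>g x\<bar>)"
proof -
  have g: "integrable lborel g" using u unfolding ac_density_def by blast
  have gI: "f integrable_on {s..t}" if "integrable lborel f" for f :: "real \<Rightarrow> real" and s t
    by (rule set_borel_integral_eq_integral(1)[OF set_integrable_of_integrable[OF that]]) simp
  have g_abs: "(LINT x:{a..b}|lborel. \<bar>g x\<bar>) = integral {a..b} (\<lambda>x. \<bar>g x\<bar>)"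
    by (rule set_borel_integral_eq_integral(2)[OF set_integrable_of_integrable[OF integrable_abs[OF g]]]) simp
  let ?V = "\<lambda>n. \<Sum>i<Suc n. \<bar>u (grid a b n (Suc i)) - u (grid a b n i)\<bar>"
  let ?G = "integral {a..b} (\<lambda>x. \<bar>g x\<bar>)"
  have step_le: "grid a b n i \<le> grid a b n (Suc i)" for n i using grid_mono[of a b i "Suc i" n] \<open>a < b\<close> by simp
  have incr: "u (grid a b n (Suc i)) - u (grid a b n i) = integral {grid a b n i..grid a b n (Suc i)} g"
    if "i < Suc n" for n i
    by (rule ac_density_increment[OF u _ step_le])
      (use that \<open>a < b\<close> grid_in[of a b i n] grid_in[of a b "Suc i" n] in auto)
  have V: "?V n = (\<Sum>i<Suc n. \<bar>integral {grid a b n i..grid a b n (Suc i)} g\<bar>)" for n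
    by (intro sum.cong refl) (simp add: incr)
  have total: "(\<Sum>i<Suc n. integral {grid a b n i..grid a b n (Suc i)} f) = integral {a..b} f"
    if "\<And>s t. f integrable_on {s..t}" for f :: "real \<Rightarrow> real" and n
    using integral_grid_sum[of f "grid a b n" "Suc n", OF that step_le] by (simp only: grid_0 grid_end)
  have upper: "?V n \<le> ?G" for n
  proof -
    have "?V n \<le> (\<Sum>i<Suc n. integral {grid a b n i..grid a b n (Suc i)} (\<lambda>x. \<bar>g x\<bar>))"
      unfolding V
    proof (rule sum_mono)
      fix i
      show "\<bar>integral {grid a b n i..grid a b n (Suc i)} g\<bar> \<le> integral {grid a b n i..grid a b n (Suc i)} (\<lambda>x. \<bar>g x\<bar>)"
        using integral_norm_bound_integral[OF gI[OF g] gI[OF integrable_abs[OF g]], of _ _] by simp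
    qed
    also have "\<dots> = ?G" by (rule total) (rule gI[OF integrable_abs[OF g]])
    finally show ?thesis .
  qed
  have lower: "\<exists>N. \<forall>n\<ge>N. ?G - e \<le> ?V n" if "e > 0" for e
  proof -
    have "e / 4 > 0" using that by simp
    obtain h where h: "continuous_on UNIV h" "(LINT x:{a..b}|lborel. \<bar>g x - h x\<bar>) < e / 4"
      by (rule continuous_dense_L1[OF g \<open>e / 4 > 0\<close>])
    have hI: "h integrable_on {s..t}" "(\<lambda>x. \<bar>h x\<bar>) integrable_on {s..t}" for s t
      by (intro integrable_continuous_real continuous_intros continuous_on_subset[OF h(1)]; simp)+
    have dI: "(\<lambda>x. \<bar>g x - h x\<bar>) integrable_on {s..t}" for s t
    proof -
      have "set_integrable lborel {s..t} (\<lambda>x. \<bar>g x - h x\<bar>)"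
        by (intro set_integrable_abs set_integral_diff(1) set_integrable_of_integrable[OF g]
            borel_integrable_atLeastAtMost' continuous_on_subset[OF h(1)]) auto
      then show ?thesis by (rule set_borel_integral_eq_integral(1))
    qed
    have "set_integrable lborel {a..b} (\<lambda>x. \<bar>g x - h x\<bar>)"
      by (intro set_integrable_abs set_integral_diff(1) set_integrable_of_integrable[OF g]
          borel_integrable_atLeastAtMost' continuous_on_subset[OF h(1)]) auto
    then have d_small: "integral {a..b} (\<lambda>x. \<bar>g x - h x\<bar>) < e / 4"
      using h(2) by (simp add: set_borel_integral_eq_integral(2))
    \<comment> \<open>Error budget: \<open>e / 4\<close> is lost twice by replacing \<open>g\<close>, and \<open>2 \<eta> (b - a) = e / 2\<close> by oscillation.\<close>
    define \<eta> where "\<eta> = e / (4 * (b - a))"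
    have "\<eta> > 0" using that \<open>a < b\<close> by (simp add: \<eta>_def)
    have "uniformly_continuous_on {a..b} h"
      by (intro compact_uniformly_continuous continuous_on_subset[OF h(1)]) auto
    then obtain d where d: "d > 0" "\<And>x y. x \<in> {a..b} \<Longrightarrow> y \<in> {a..b} \<Longrightarrow> dist y x < d \<Longrightarrow> dist (h y) (h x) < \<eta>"
      unfolding uniformly_continuous_on_def using \<open>\<eta> > 0\<close> by blast
    obtain N :: nat where N: "(b - a) / d < N" using reals_Archimedean2 by blast
    have "?G - e \<le> ?V n" if "n \<ge> N" for n
    proof -
      have "(b - a) / d < Suc n" using N that by linarith
      then have mesh: "(b - a) / Suc n < d" using d(1) by (simp add: field_simps)
      have "integral {grid a b n i..grid a b n (Suc i)} (\<lambda>x. \<bar>h x\<bar>) - 2 * \<eta> * ((b - a) / Suc n)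
          - integral {grid a b n i..grid a b n (Suc i)} (\<lambda>x. \<bar>g x - h x\<bar>)
          \<le> \<bar>integral {grid a b n i..grid a b n (Suc i)} g\<bar>" if "i < Suc n" for i
      proof -
        let ?I = "{grid a b n i..grid a b n (Suc i)}"
        have sub: "?I \<subseteq> {a..b}"
          using grid_in[of a b i n] grid_in[of a b "Suc i" n] that \<open>a < b\<close> by auto
        have "\<bar>h x - h (grid a b n i)\<bar> \<le> \<eta>" if "x \<in> ?I" for x
        proof -
          have "dist x (grid a b n i) < d"
            using that grid_step[of a b n i] mesh by (simp add: dist_real_def)
          then have "dist (h x) (h (grid a b n i)) < \<eta>"
            using sub that step_le[of n i] by (intro d(2)) auto
          then show ?thesis by (simp add: dist_real_def)
        qed
        from abs_integral_ge_oscillation[OF step_le continuous_on_subset[OF h(1) subset_UNIV] this]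
        have 1: "integral ?I (\<lambda>x. \<bar>h x\<bar>) - 2 * \<eta> * ((b - a) / Suc n) \<le> \<bar>integral ?I h\<bar>"
          by (simp only: grid_step)
        have "\<bar>integral ?I (\<lambda>x. g x - h x)\<bar> \<le> integral ?I (\<lambda>x. \<bar>g x - h x\<bar>)"
          using integral_norm_bound_integral[OF Henstock_Kurzweil_Integration.integrable_diff[OF gI[OF g] hI(1)] dI] by simp
        moreover have "integral ?I (\<lambda>x. g x - h x) = integral ?I g - integral ?I h"
          by (rule Henstock_Kurzweil_Integration.integral_diff[OF gI[OF g] hI(1)])
        ultimately show ?thesis using 1 by linarith
      qed
      then have "(\<Sum>i<Suc n. integral {grid a b n i..grid a b n (Suc i)} (\<lambda>x. \<bar>h x\<bar>) - 2 * \<eta> * ((b - a) / Suc n)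
          - integral {grid a b n i..grid a b n (Suc i)} (\<lambda>x. \<bar>g x - h x\<bar>)) \<le> ?V n"
        unfolding V by (intro sum_mono) simp
      also have "(\<Sum>i<Suc n. integral {grid a b n i..grid a b n (Suc i)} (\<lambda>x. \<bar>h x\<bar>) - 2 * \<eta> * ((b - a) / Suc n)
          - integral {grid a b n i..grid a b n (Suc i)} (\<lambda>x. \<bar>g x - h x\<bar>))
          = integral {a..b} (\<lambda>x. \<bar>h x\<bar>) - 2 * \<eta> * (b - a) - integral {a..b} (\<lambda>x. \<bar>g x - h x\<bar>)"
        unfolding sum_subtractf total[OF hI(2)] total[OF dI] by simp
      finally have 2: "integral {a..b} (\<lambda>x. \<bar>h x\<bar>) - 2 * \<eta> * (b - a) - integral {a..b} (\<lambda>x. \<bar>g x - h x\<bar>) \<le> ?V n" .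
      have "?G \<le> integral {a..b} (\<lambda>x. \<bar>h x\<bar> + \<bar>g x - h x\<bar>)"
        by (rule integral_le[OF gI[OF integrable_abs[OF g]] Henstock_Kurzweil_Integration.integrable_add[OF hI(2) dI]]) simp
      also have "\<dots> = integral {a..b} (\<lambda>x. \<bar>h x\<bar>) + integral {a..b} (\<lambda>x. \<bar>g x - h x\<bar>)"
        by (rule Henstock_Kurzweil_Integration.integral_add[OF hI(2) dI])
      finally have 3: "?G \<le> integral {a..b} (\<lambda>x. \<bar>h x\<bar>) + integral {a..b} (\<lambda>x. \<bar>g x - h x\<bar>)" .
      have "2 * \<eta> * (b - a) = e / 2" using \<open>a < b\<close> by (simp add: \<eta>_def field_simps)
      then show ?thesis using 2 3 d_small by linarith
    qed
    then show ?thesis by blast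
  qed
  show ?thesis
    unfolding g_abs LIMSEQ_def
  proof (intro allI impI)
    fix e :: real assume "e > 0"
    then obtain N where "\<forall>n\<ge>N. ?G - e / 2 \<le> ?V n" using lower[of "e / 2"] by auto
    then have "\<forall>n\<ge>N. dist (?V n) ?G < e"
      using upper \<open>e > 0\<close> by (fastforce simp: dist_real_def abs_less_iff)
    then show "\<exists>N. \<forall>n\<ge>N. dist (?V n) ?G < e" by blast
  qed
qed

section \<open>Separability and the Borel sets of AC\<close>

text \<open>A countable dense subset of \<open>AC([a,b])\<close>. The polynomial is cut off outside \<open>[a,b]\<close>, because densities
are integrable on the whole line.\<close>
definition rat_primitive :: "real \<Rightarrow> real \<Rightarrow> rat \<Rightarrow> rat list \<Rightarrow> real \<Rightarrow> real" where
  "rat_primitive a b c qs =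
     (\<lambda>x\<in>{a..b}. of_rat c + (LINT t:{a..x}|lborel. indicator {a..b} t * rat_poly qs t))"

lemma integrable_rat_poly: "integrable lborel (\<lambda>t. indicator {a..b} t * rat_poly qs t)"
  using borel_integrable_atLeastAtMost'[OF continuous_rat_poly, of a b qs] by (simp add: set_integrable_def)

lemma rat_primitive_density:
  assumes "a < b"
  shows "ac_density a b (rat_primitive a b c qs) (\<lambda>t. indicator {a..b} t * rat_poly qs t)"
  unfolding ac_density_def
proof (intro conjI ballI)
  fix x assume "x \<in> {a..b}"
  have "(LINT t:{a..a}|lborel. indicator {a..b} t * rat_poly qs t) = 0"
    using set_borel_integral_eq_integral(2)[OF set_integrable_of_integrable[OF integrable_rat_poly, of "{a..a}"]]
    by simp
  then show "rat_primitive a b c qs x = rat_primitive a b c qs a + (LINT t:{a..x}|lborel. indicator {a..b} t * rat_poly qs t)"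
    using \<open>x \<in> {a..b}\<close> by (simp add: rat_primitive_def)
qed (rule integrable_rat_poly)

lemma rat_primitive_AC:
  assumes "a < b"
  shows "rat_primitive a b c qs \<in> AC a b"
proof -
  have "compact (rat_poly qs ` {a..b})"
    by (intro compact_continuous_image continuous_rat_poly) auto
  then have "bounded (rat_poly qs ` {a..b})" by (rule compact_imp_bounded)
  then obtain B where "\<forall>y\<in>rat_poly qs ` {a..b}. norm y \<le> B" unfolding bounded_iff by blast
  then have B: "\<bar>rat_poly qs t\<bar> \<le> B" if "t \<in> {a..b}" for t using that by simp
  let ?g = "\<lambda>t. indicator {a..b} t * rat_poly qs t"
  have "abs_continuous_on_Icc a b (rat_primitive a b c qs)"
  proof (rule lipschitz_imp_abs_continuous)
    fix x y assume xy: "a \<le> x" "x \<le> y" "y \<le> b"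
    have "?g integrable_on {x..y}"
      by (rule set_borel_integral_eq_integral(1)[OF set_integrable_of_integrable[OF integrable_rat_poly]]) simp
    then have "norm (integral {x..y} ?g) \<le> integral {x..y} (\<lambda>_. B)"
      by (rule integral_norm_bound_integral[OF _ integrable_const_ivl]) (use B xy in simp)
    then show "\<bar>rat_primitive a b c qs y - rat_primitive a b c qs x\<bar> \<le> B * (y - x)"
      unfolding ac_density_increment[OF rat_primitive_density[OF \<open>a < b\<close>] xy] using xy by (simp add: mult.commute)
  qed
  moreover have "rat_primitive a b c qs \<in> extensional {a..b}"
    by (simp add: rat_primitive_def)
  ultimately show ?thesis by (simp add: AC_def)
qed

text \<open>Approximate the density by a rational polynomial and the initial value by a rational number.\<close>
lemma rat_primitive_dense:
  assumes u: "u \<in> AC a b" and "a < b" "e > 0"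
  obtains c qs where "AC_dist a b u (rat_primitive a b c qs) < e"
proof -
  obtain g where g: "ac_density a b u g" by (rule ac_density_AC[OF u \<open>a < b\<close>])
  have "e / 2 > 0" using \<open>e > 0\<close> by simp
  obtain qs where qs: "(LINT x:{a..b}|lborel. \<bar>g x - rat_poly qs x\<bar>) < e / 2"
    by (rule rat_poly_dense_L1[OF _ \<open>e / 2 > 0\<close> \<open>a < b\<close>]) (use g in \<open>unfold ac_density_def, blast\<close>)
  have "u a - e / 2 < u a + e / 2" using \<open>e > 0\<close> by simp
  then obtain c where c: "u a - e / 2 < of_rat c" "of_rat c < u a + e / 2" using of_rat_dense by blast
  have "(LINT x:{a..b}|lborel. \<bar>g x - indicator {a..b} x * rat_poly qs x\<bar>) = (LINT x:{a..b}|lborel. \<bar>g x - rat_poly qs x\<bar>)"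
    by (rule set_lebesgue_integral_cong) auto
  moreover have "rat_primitive a b c qs a = of_rat c"
    using set_borel_integral_eq_integral(2)[OF set_integrable_of_integrable[OF integrable_rat_poly, of "{a..a}" a b qs]] \<open>a < b\<close>
    by (simp add: rat_primitive_def)
  ultimately have "AC_dist a b u (rat_primitive a b c qs) < e"
    unfolding AC_dist_eq_density[OF g rat_primitive_density[OF \<open>a < b\<close>]] using qs c by linarith
  then show thesis by (rule that)
qed

lemma AC_dist_measurable:
  assumes "a < b" and Z: "\<And>\<omega>. \<omega> \<in> space M \<Longrightarrow> Z \<omega> \<in> AC a b"
    and meas [measurable]: "\<And>s. s \<in> {a..b} \<Longrightarrow> (\<lambda>\<omega>. Z \<omega> s) \<in> borel_measurable M"
    and v: "v \<in> AC a b"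
  shows "(\<lambda>\<omega>. AC_dist a b v (Z \<omega>)) \<in> borel_measurable M"
proof -
  define V where "V n w = (\<Sum>i<Suc n. \<bar>w (grid a b n (Suc i)) - w (grid a b n i)\<bar>)" for n and w :: "real \<Rightarrow> real"
  show ?thesis
  proof (rule borel_measurable_LIMSEQ_real[where u = "\<lambda>n \<omega>. \<bar>v a - Z \<omega> a\<bar> + V n (\<lambda>x. v x - Z \<omega> x)"])
  show "(\<lambda>\<omega>. \<bar>v a - Z \<omega> a\<bar> + V n (\<lambda>x. v x - Z \<omega> x)) \<in> borel_measurable M" for n
  proof -
    have "(\<lambda>\<omega>. Z \<omega> (grid a b n i)) \<in> borel_measurable M" if "i \<le> Suc n" for i
      using \<open>a < b\<close> that by (intro meas grid_in) auto
    moreover have "(\<lambda>\<omega>. Z \<omega> a) \<in> borel_measurable M" using \<open>a < b\<close> by (intro meas) simp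
    ultimately show ?thesis
      unfolding V_def by (intro borel_measurable_add borel_measurable_abs borel_measurable_diff
          borel_measurable_const borel_measurable_sum) auto
  qed
  fix \<omega> assume "\<omega> \<in> space M"
  obtain g where g: "ac_density a b v g" by (rule ac_density_AC[OF v \<open>a < b\<close>])
  obtain h where h: "ac_density a b (Z \<omega>) h" by (rule ac_density_AC[OF Z[OF \<open>\<omega> \<in> space M\<close>] \<open>a < b\<close>])
  show "(\<lambda>n. \<bar>v a - Z \<omega> a\<bar> + V n (\<lambda>x. v x - Z \<omega> x)) \<longlonglongrightarrow> AC_dist a b v (Z \<omega>)"
    unfolding AC_dist_eq_density[OF g h] V_def
    by (intro tendsto_add tendsto_const grid_variation_tendsto[OF ac_density_diff[OF g h] \<open>a < b\<close>])
  qed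
qed

text \<open>By separability an open set is a countable union of balls with rational radius around rational
primitives, and the distance to a fixed center is a limit of expressions in point values.\<close>
theorem AC_borel_measurableI:
  assumes "a < b" and Z: "\<And>\<omega>. \<omega> \<in> space M \<Longrightarrow> Z \<omega> \<in> AC a b"
    and meas: "\<And>s. s \<in> {a..b} \<Longrightarrow> (\<lambda>\<omega>. Z \<omega> s) \<in> borel_measurable M"
  shows "Z \<in> M \<rightarrow>\<^sub>M AC_borel a b"
proof -
  interpret Metric_space "AC a b" "AC_dist a b" by (rule Metric_space_AC[OF \<open>a < b\<close>])
  show ?thesis
    unfolding AC_borel_def
  proof (rule measurable_measure_of)
    show "{U. openin mtopology U} \<subseteq> Pow (AC a b)"
      using openin_subset by fastforce
    show "Z \<in> space M \<rightarrow> AC a b" using Z by auto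
    fix U assume "U \<in> {U. openin mtopology U}"
    then have U: "U \<subseteq> AC a b" "\<And>u. u \<in> U \<Longrightarrow> \<exists>r>0. mball u r \<subseteq> U"
      by (auto simp: openin_mtopology)
    define J where "J = {(c, qs, q). mball (rat_primitive a b c qs) (of_rat q) \<subseteq> U}"
    have "Z -` U \<inter> space M = (\<Union>(c, qs, q)\<in>J. {\<omega> \<in> space M. AC_dist a b (rat_primitive a b c qs) (Z \<omega>) < of_rat q})"
      (is "?L = ?R")
    proof
      show "?R \<subseteq> ?L"
        using Z rat_primitive_AC[OF \<open>a < b\<close>] by (auto simp: J_def subset_iff in_mball)
      show "?L \<subseteq> ?R"
      proof
        fix \<omega> assume "\<omega> \<in> ?L"
        then have \<omega>: "\<omega> \<in> space M" "Z \<omega> \<in> U" by auto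
        obtain r where r: "r > 0" "mball (Z \<omega>) r \<subseteq> U" using U(2)[OF \<omega>(2)] by blast
        \<comment> \<open>Half of \<open>r\<close>, since the ball around the rational primitive has to fit into the one around \<open>Z \<omega>\<close>.\<close>
        obtain q where q: "0 < (of_rat q :: real)" "of_rat q < r / 2" using of_rat_dense[of 0 "r / 2"] r(1) by auto
        obtain c qs where cq: "AC_dist a b (Z \<omega>) (rat_primitive a b c qs) < of_rat q"
          by (rule rat_primitive_dense[OF Z[OF \<omega>(1)] \<open>a < b\<close> q(1)])
        have "mball (rat_primitive a b c qs) (of_rat q) \<subseteq> mball (Z \<omega>) r"
        proof
          fix v assume "v \<in> mball (rat_primitive a b c qs) (of_rat q)"
          then have v: "v \<in> AC a b" "AC_dist a b (rat_primitive a b c qs) v < of_rat q" by (auto simp: in_mball)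
          have "AC_dist a b (Z \<omega>) v < r"
            using triangle[OF Z[OF \<omega>(1)] rat_primitive_AC[OF \<open>a < b\<close>] v(1), of c qs] v(2) cq q(2) by linarith
          then show "v \<in> mball (Z \<omega>) r" using v(1) Z[OF \<omega>(1)] by (simp add: in_mball)
        qed
        then have "(c, qs, q) \<in> J" using r(2) by (auto simp: J_def)
        moreover have "AC_dist a b (rat_primitive a b c qs) (Z \<omega>) < of_rat q" using cq commute by simp
        ultimately show "\<omega> \<in> ?R" using \<omega>(1) by blast
      qed
    qed
    also have "\<dots> \<in> sets M"
    proof (rule sets.countable_UN'')
      show "countable J" by (rule countableI_type)
      fix j assume "j \<in> J"
      have [measurable]: "(\<lambda>\<omega>. AC_dist a b (rat_primitive a b c qs) (Z \<omega>)) \<in> borel_measurable M" for c qs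
        by (rule AC_dist_measurable[OF \<open>a < b\<close> Z meas rat_primitive_AC[OF \<open>a < b\<close>]])
      show "(case j of (c, qs, q) \<Rightarrow> {\<omega> \<in> space M. AC_dist a b (rat_primitive a b c qs) (Z \<omega>) < of_rat q}) \<in> sets M"
        by (cases j) simp
    qed
    finally show "Z -` U \<inter> space M \<in> sets M" .
  qed
qed

section \<open>Integration against signed measures\<close>

lemma signed_measure_additive:
  assumes \<nu>: "signed_measure M \<nu>" and "A \<in> sets M" "B \<in> sets M" "A \<inter> B = {}"
  shows "\<nu> (A \<union> B) = \<nu> A + \<nu> B"
proof -
  have "range (binaryset A B) \<subseteq> sets M"
    using assms(2,3) by (auto simp: binaryset_def)
  moreover have "disjoint_family (binaryset A B)"
    using assms(4) by (auto simp: disjoint_family_on_def binaryset_def)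
  ultimately have "(\<lambda>i. \<nu> (binaryset A B i)) sums \<nu> (\<Union>i. binaryset A B i)"
    using \<nu> unfolding signed_measure_def by blast
  moreover have "(\<lambda>i. \<nu> (binaryset A B i)) sums (\<nu> A + \<nu> B)"
    using \<nu> by (intro binaryset_sums) (simp add: signed_measure_def)
  ultimately show ?thesis by (simp add: UN_binaryset_eq sums_unique2)
qed

lemma signed_measure_abs_le_tv:
  assumes \<nu>: "signed_measure M \<nu>" and A: "A \<in> sets M"
  shows "ennreal \<bar>\<nu> A\<bar> \<le> tv_norm M \<nu>"
proof (cases "A = {}")
  case True
  then show ?thesis using \<nu> by (simp add: signed_measure_def)
next
  case False
  \<comment> \<open>The empty set is not allowed as a part of a partition.\<close>
  define P where "P = {A, space M - A} - {{}}"
  have "partition_on (space M) P"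
    using sets.sets_into_space[OF A] by (auto simp: partition_on_def disjoint_def P_def)
  then have P: "P \<in> {P. finite P \<and> P \<subseteq> sets M \<and> partition_on (space M) P}"
    using A by (auto simp: P_def)
  have "ennreal \<bar>\<nu> A\<bar> \<le> (\<Sum>B\<in>P. ennreal \<bar>\<nu> B\<bar>)"
    by (rule member_le_sum) (use False in \<open>auto simp: P_def\<close>)
  also have "\<dots> \<le> tv_norm M \<nu>"
    unfolding tv_norm_def by (rule SUP_upper[OF P])
  finally show ?thesis .
qed

text \<open>The embedding of the reals cuts off negative values, and so is subadditive only.\<close>
lemma ennreal_sum_le: "finite I \<Longrightarrow> ennreal (\<Sum>i\<in>I. f i) \<le> (\<Sum>i\<in>I. ennreal (f i))"
proof (induction I rule: finite_induct)
  case (insert i I)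
  have "ennreal (f i + sum f I) \<le> ennreal (f i) + ennreal (sum f I)"
    by (cases "f i \<ge> 0"; cases "sum f I \<ge> 0") (auto simp: ennreal_neg intro!: ennreal_leI)
  also have "\<dots> \<le> ennreal (f i) + (\<Sum>i\<in>I. ennreal (f i))"
    by (intro add_left_mono insert.IH)
  finally show ?case using insert by simp
qed simp

lemma ennreal_sums_le:
  assumes "f sums s"
  shows "ennreal s \<le> (\<Sum>i. ennreal (f i))"
proof (rule LIMSEQ_le_const2)
  show "(\<lambda>n. ennreal (\<Sum>i<n. f i)) \<longlonglongrightarrow> ennreal s"
    using assms unfolding sums_def by (rule tendsto_ennrealI)
  have "ennreal (\<Sum>i<n. f i) \<le> (\<Sum>i. ennreal (f i))" for n
    by (rule order_trans[OF ennreal_sum_le sum_le_suminf]) auto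
  then show "\<exists>N. \<forall>n\<ge>N. ennreal (\<Sum>i<n. f i) \<le> (\<Sum>i. ennreal (f i))" by blast
qed

text \<open>The set function from which \<^const>\<open>jordan_pos\<close> is built; it has to be shown that it is a measure,
since otherwise the measure type would replace it by the zero measure.\<close>
definition positive_variation :: "'a measure \<Rightarrow> ('a set \<Rightarrow> real) \<Rightarrow> 'a set \<Rightarrow> ennreal" where
  "positive_variation M \<nu> A = (SUP B \<in> {B \<in> sets M. B \<subseteq> A}. ennreal (\<nu> B))"

lemma positive_variation_upper:
  "B \<in> sets M \<Longrightarrow> B \<subseteq> A \<Longrightarrow> ennreal (\<nu> B) \<le> positive_variation M \<nu> A"
  unfolding positive_variation_def by (rule SUP_upper) simp

lemma positive_variation_mono:
  "A \<subseteq> A' \<Longrightarrow> positive_variation M \<nu> A \<le> positive_variation M \<nu> A'"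
  unfolding positive_variation_def by (rule SUP_subset_mono) auto

text \<open>Nearly optimal subsets of \<open>A\<close> and \<open>A'\<close> are disjoint and can be united. If one of them has negative
measure, it is dropped.\<close>
lemma positive_variation_superadditive:
  assumes \<nu>: "signed_measure M \<nu>" and disj: "A \<inter> A' = {}"
  shows "positive_variation M \<nu> A + positive_variation M \<nu> A' \<le> positive_variation M \<nu> (A \<union> A')"
proof -
  have ne: "{B \<in> sets M. B \<subseteq> C} \<noteq> {}" for C by auto
  have "ennreal (\<nu> B) + ennreal (\<nu> B') \<le> positive_variation M \<nu> (A \<union> A')"
    if B: "B \<in> sets M" "B \<subseteq> A" and B': "B' \<in> sets M" "B' \<subseteq> A'" for B B'
  proof -
    consider "\<nu> B \<le> 0" | "\<nu> B' \<le> 0" | "\<nu> B \<ge> 0" "\<nu> B' \<ge> 0" by linarith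
    then show ?thesis
    proof cases
      case 1
      then show ?thesis using B' positive_variation_upper[of B' M "A \<union> A'" \<nu>] by (auto simp: ennreal_neg)
    next
      case 2
      then show ?thesis using B positive_variation_upper[of B M "A \<union> A'" \<nu>] by (auto simp: ennreal_neg)
    next
      case 3
      have "\<nu> (B \<union> B') = \<nu> B + \<nu> B'"
        using B B' disj by (intro signed_measure_additive[OF \<nu>]) auto
      then have "ennreal (\<nu> B) + ennreal (\<nu> B') = ennreal (\<nu> (B \<union> B'))" using 3 by simp
      also have "\<dots> \<le> positive_variation M \<nu> (A \<union> A')"
        using B B' by (intro positive_variation_upper) auto
      finally show ?thesis .
    qed
  qed
  then have "(SUP B' \<in> {B \<in> sets M. B \<subseteq> A'}. SUP B \<in> {B \<in> sets M. B \<subseteq> A}. ennreal (\<nu> B) + ennreal (\<nu> B'))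
      \<le> positive_variation M \<nu> (A \<union> A')"
    by (intro SUP_least) auto
  then show ?thesis
    unfolding positive_variation_def[of M \<nu> A] positive_variation_def[of M \<nu> A']
    unfolding ennreal_SUP_add_left[OF ne] ennreal_SUP_add_right[OF ne] .
qed

text \<open>Superadditivity gives one inequality for finite unions, hence for countable ones by monotonicity.
The other one holds because any \<open>B\<close> inside the union is split by the sets \<open>A i\<close>, and \<open>\<nu>\<close> is
countably additive.\<close>
lemma positive_variation_countably_additive:
  assumes \<nu>: "signed_measure M \<nu>"
  shows "countably_additive (sets M) (positive_variation M \<nu>)"
proof (rule countably_additiveI)
  fix A :: "nat \<Rightarrow> 'a set" assume A: "range A \<subseteq> sets M" "disjoint_family A"
  let ?J = "positive_variation M \<nu>"
  have finite_le: "(\<Sum>i<n. ?J (A i)) \<le> ?J (\<Union>i<n. A i)" for n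
  proof (induction n)
    case (Suc n)
    have "(\<Sum>i<Suc n. ?J (A i)) \<le> ?J (\<Union>i<n. A i) + ?J (A n)"
      using Suc by (simp add: add_right_mono)
    also have "\<dots> \<le> ?J ((\<Union>i<n. A i) \<union> A n)"
    proof (rule positive_variation_superadditive[OF \<nu>])
      have "A i \<inter> A n = {}" if "i < n" for i
        using A(2) that unfolding disjoint_family_on_def by (metis UNIV_I less_irrefl)
      then show "(\<Union>i<n. A i) \<inter> A n = {}" by blast
    qed
    also have "(\<Union>i<n. A i) \<union> A n = (\<Union>i<Suc n. A i)" by (auto simp: less_Suc_eq)
    finally show ?case .
  qed simp
  have "(\<Sum>i. ?J (A i)) \<le> ?J (\<Union>i. A i)"
  proof (rule suminf_le_const)
    show "(\<Sum>i<n. ?J (A i)) \<le> ?J (\<Union>i. A i)" for n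
      by (rule order_trans[OF finite_le positive_variation_mono]) blast
  qed simp
  moreover have "?J (\<Union>i. A i) \<le> (\<Sum>i. ?J (A i))"
    unfolding positive_variation_def[of M \<nu> "\<Union>i. A i"]
  proof (rule SUP_least)
    fix B assume "B \<in> {B \<in> sets M. B \<subseteq> (\<Union>i. A i)}"
    then have B: "B \<in> sets M" "B = (\<Union>i. B \<inter> A i)" by auto
    have "range (\<lambda>i. B \<inter> A i) \<subseteq> sets M" using A(1) B(1) by auto
    moreover have "disjoint_family (\<lambda>i. B \<inter> A i)" using A(2) unfolding disjoint_family_on_def by blast
    ultimately have "(\<lambda>i. \<nu> (B \<inter> A i)) sums \<nu> (\<Union>i. B \<inter> A i)"
      using \<nu> unfolding signed_measure_def by blast
    then have "ennreal (\<nu> B) \<le> (\<Sum>i. ennreal (\<nu> (B \<inter> A i)))"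
      using ennreal_sums_le B(2) by metis
    also have "\<dots> \<le> (\<Sum>i. ?J (A i))"
      using A(1) B(1) by (intro suminf_le positive_variation_upper) auto
    finally show "ennreal (\<nu> B) \<le> (\<Sum>i. ?J (A i))" .
  qed
  ultimately show "(\<Sum>i. ?J (A i)) = ?J (\<Union>i. A i)" by (rule antisym)
qed

lemma sets_jordan_pos [simp, measurable_cong]: "sets (jordan_pos M \<nu>) = sets M"
  and space_jordan_pos [simp]: "space (jordan_pos M \<nu>) = space M"
  unfolding jordan_pos_def by simp_all

lemma emeasure_jordan_pos:
  assumes \<nu>: "signed_measure M \<nu>" and A: "A \<in> sets M"
  shows "emeasure (jordan_pos M \<nu>) A = positive_variation M \<nu> A"
  unfolding jordan_pos_def positive_variation_def[symmetric]
proof (rule emeasure_measure_of_sigma[OF _ _ positive_variation_countably_additive[OF \<nu>] A])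
  have "positive_variation M \<nu> {} = 0"
    using \<nu> by (simp add: positive_variation_def signed_measure_def cong: conj_cong)
  then show "positive (sets M) (positive_variation M \<nu>)" by (simp add: positive_def)
qed (rule sets.sigma_algebra_axioms)

lemma jordan_pos_total:
  assumes "signed_measure M \<nu>" "tv_norm M \<nu> \<le> ennreal K"
  shows "emeasure (jordan_pos M \<nu>) (space M) \<le> ennreal K"
proof -
  have "ennreal (\<nu> B) \<le> ennreal K" if "B \<in> sets M" for B
  proof -
    have "ennreal (\<nu> B) \<le> ennreal \<bar>\<nu> B\<bar>" by (rule ennreal_leI) simp
    also have "\<dots> \<le> ennreal K" using signed_measure_abs_le_tv[OF assms(1) that] assms(2) by (rule order_trans)
    finally show ?thesis .
  qed
  then show ?thesis
    by (auto simp: emeasure_jordan_pos[OF assms(1)] positive_variation_def intro!: SUP_least)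
qed

lemma signed_measure_uminus:
  assumes "signed_measure M \<nu>"
  shows "signed_measure M (\<lambda>A. - \<nu> A)"
  using assms unfolding signed_measure_def by (auto intro: sums_minus)

lemma tv_norm_uminus: "tv_norm M (\<lambda>A. - \<nu> A) = tv_norm M \<nu>"
  by (simp add: tv_norm_def)

lemma jordan_pos_integral:
  fixes f :: "'a \<Rightarrow> real"
  assumes \<nu>: "signed_measure M \<nu>" "tv_norm M \<nu> \<le> ennreal K" and "K \<ge> 0"
    and f: "f \<in> borel_measurable M" "\<And>x. x \<in> space M \<Longrightarrow> \<bar>f x\<bar> \<le> C"
  shows "integrable (jordan_pos M \<nu>) f" "C \<ge> 0 \<Longrightarrow> \<bar>\<integral>x. f x \<partial>jordan_pos M \<nu>\<bar> \<le> K * C"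
proof -
  let ?J = "jordan_pos M \<nu>"
  have total: "emeasure ?J (space ?J) \<le> ennreal K" using jordan_pos_total[OF \<nu>] by simp
  then have "emeasure ?J (space ?J) < top" by (rule order.strict_trans1) simp
  then interpret finite_measure ?J by (intro finite_measureI) simp
  have meas: "f \<in> borel_measurable ?J" using f(1) by simp
  show int: "integrable ?J f"
    by (rule integrable_const_bound[OF _ meas, of C]) (use f(2) in \<open>auto intro!: AE_I2\<close>)
  show "\<bar>\<integral>x. f x \<partial>?J\<bar> \<le> K * C" if "C \<ge> 0"
  proof -
    have "\<bar>\<integral>x. f x \<partial>?J\<bar> \<le> (\<integral>x. C \<partial>?J)"
      using f(2) int by (intro order_trans[OF integral_abs_bound] integral_mono) auto
    also have "\<dots> = measure ?J (space ?J) * C" by simp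
    also have "measure ?J (space ?J) \<le> K"
      using total \<open>K \<ge> 0\<close> by (simp add: emeasure_eq_measure)
    finally show ?thesis using \<open>C \<ge> 0\<close> by (simp add: mult_right_mono)
  qed
qed

lemma continuous_measurable_borel_I:
  fixes f :: "real \<Rightarrow> real"
  assumes "continuous_on {-1..0} f"
  shows "f \<in> borel_measurable borel_I"
  using assms by (rule borel_measurable_continuous_on_restrict)

lemma continuous_on_Icc_bounded:
  fixes f :: "real \<Rightarrow> real"
  assumes "continuous_on {a..b} f"
  obtains C where "C \<ge> 0" "\<And>x. x \<in> {a..b} \<Longrightarrow> \<bar>f x\<bar> \<le> C"
proof -
  have "bounded (f ` {a..b})" using assms by (intro compact_imp_bounded compact_continuous_image) auto
  then obtain B where B: "\<forall>y\<in>f ` {a..b}. norm y \<le> B" unfolding bounded_iff by blast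
  show thesis by (rule that[of "max B 0"]) (use B in \<open>auto simp: le_max_iff_disj\<close>)
qed

context
  fixes K :: real and \<nu> :: "real set \<Rightarrow> real"
  assumes K: "K \<ge> 0" and \<nu>: "\<nu> \<in> delay_measures K"
begin

lemma delay_measureD:
  "signed_measure borel_I \<nu>" "tv_norm borel_I \<nu> \<le> ennreal K"
  "signed_measure borel_I (\<lambda>A. - \<nu> A)" "tv_norm borel_I (\<lambda>A. - \<nu> A) \<le> ennreal K"
  using \<nu> signed_measure_uminus tv_norm_uminus[of borel_I \<nu>] by (auto simp: delay_measures_def)

lemma delay_integrable:
  fixes f :: "real \<Rightarrow> real"
  assumes "continuous_on {-1..0} f"
  shows "integrable (jordan_pos borel_I \<nu>) f" "integrable (jordan_pos borel_I (\<lambda>A. - \<nu> A)) f"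
proof -
  obtain C where C: "C \<ge> 0" "\<And>x. x \<in> {-1..0} \<Longrightarrow> \<bar>f x\<bar> \<le> C"
    by (rule continuous_on_Icc_bounded[OF assms]) (rule that; assumption)
  have "\<bar>f x\<bar> \<le> C" if "x \<in> space borel_I" for x using C(2) that by (simp add: space_restrict_space)
  note * = jordan_pos_integral(1)[OF _ _ K continuous_measurable_borel_I[OF assms] this]
  show "integrable (jordan_pos borel_I \<nu>) f" "integrable (jordan_pos borel_I (\<lambda>A. - \<nu> A)) f"
    by (intro * delay_measureD; assumption)+
qed

text \<open>Both parts of the Jordan decomposition have mass at most \<open>K\<close>. Bounding them separately loses a
factor 2 against the total variation, which only enlarges the Lipschitz constant of the equation.\<close>
lemma delay_integral_bound:
  assumes "continuous_on {-1..0} f" "C \<ge> 0" "\<And>x. x \<in> {-1..0} \<Longrightarrow> \<bar>f x\<bar> \<le> C"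
  shows "\<bar>signed_integral borel_I \<nu> f\<bar> \<le> 2 * K * C"
proof -
  have "\<bar>f x\<bar> \<le> C" if "x \<in> space borel_I" for x using assms(3) that by (simp add: space_restrict_space)
  note * = jordan_pos_integral(2)[OF _ _ K continuous_measurable_borel_I[OF assms(1)] this assms(2)]
  show ?thesis
    using *[OF delay_measureD(1,2)] *[OF delay_measureD(3,4)] unfolding signed_integral_def by linarith
qed

lemma delay_integral_diff:
  assumes "continuous_on {-1..0} f" "continuous_on {-1..0} g"
  shows "signed_integral borel_I \<nu> (\<lambda>x. f x - g x) = signed_integral borel_I \<nu> f - signed_integral borel_I \<nu> g"
  using delay_integrable[OF assms(1)] delay_integrable[OF assms(2)]
  by (simp add: signed_integral_def)

lemma delay_integral_sum:
  assumes "\<And>i. i \<in> I \<Longrightarrow> continuous_on {-1..0} (f i)"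
  shows "signed_integral borel_I \<nu> (\<lambda>x. \<Sum>i\<in>I. c i * f i x) = (\<Sum>i\<in>I. c i * signed_integral borel_I \<nu> (f i))"
  using delay_integrable[OF assms]
  by (simp add: signed_integral_def sum_subtractf right_diff_distrib)

lemma delay_integral_cong:
  assumes "\<And>x. x \<in> {-1..0} \<Longrightarrow> f x = g x"
  shows "signed_integral borel_I \<nu> f = signed_integral borel_I \<nu> g"
  unfolding signed_integral_def
  by (intro arg_cong2[where f = "(-)"] Bochner_Integration.integral_cong refl)
    (use assms in \<open>auto simp: space_restrict_space\<close>)

end

section \<open>The delay equation along one path\<close>

lemma geometric_tendsto_zero: "(\<lambda>n. c / 2 ^ n * w) \<longlonglongrightarrow> (0 :: real)"
  by (intro tendsto_mult_left_zero LIMSEQ_divide_realpow_zero) simp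

text \<open>One path of measures, as seen by a single \<open>\<omega>\<close>.\<close>
locale delay_path =
  fixes K :: real and \<kappa> :: "real \<Rightarrow> real set \<Rightarrow> real"
  assumes K_nonneg: "K \<ge> 0"
    and in_delay_measures: "\<And>\<tau>. \<tau> \<ge> 0 \<Longrightarrow> \<kappa> \<tau> \<in> delay_measures K"
    and weakly_measurable: "\<And>T f. T > 0 \<Longrightarrow> continuous_on {-1..0} f \<Longrightarrow>
      (\<lambda>t. signed_integral borel_I (\<kappa> t) f) \<in> borel_measurable (lebesgue_on {0..T})"
begin

text \<open>The right-hand side of the equation along a given function, and its integral over \<open>[0,t]\<close>.\<close>
definition drift :: "(real \<Rightarrow> real) \<Rightarrow> real \<Rightarrow> real" where
  "drift y \<tau> = signed_integral borel_I (\<kappa> \<tau>) (\<lambda>r. y (\<tau> + r))"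

definition accumulated :: "(real \<Rightarrow> real) \<Rightarrow> real \<Rightarrow> real" where
  "accumulated y t = (LINT \<tau>:{0..t}|lebesgue. drift y \<tau>)"

lemma continuous_segment:
  fixes y :: "real \<Rightarrow> real"
  assumes "continuous_on {-1..T} y" "\<tau> \<in> {0..T}"
  shows "continuous_on {-1..0} (\<lambda>r. y (\<tau> + r))"
  using assms(2) by (intro continuous_on_compose2[OF assms(1)] continuous_intros) auto

lemma drift_bound:
  assumes "continuous_on {-1..T} y" "\<tau> \<in> {0..T}" "C \<ge> 0" "\<And>s. s \<in> {-1..\<tau>} \<Longrightarrow> \<bar>y s\<bar> \<le> C"
  shows "\<bar>drift y \<tau>\<bar> \<le> 2 * K * C"
  unfolding drift_def using assms(2)
  by (intro delay_integral_bound[OF K_nonneg in_delay_measures continuous_segment[OF assms(1)]] assms(3,4)) auto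

lemma drift_cong:
  assumes "\<tau> \<in> {0..T}" "\<And>s. s \<in> {-1..T} \<Longrightarrow> y s = y' s"
  shows "drift y \<tau> = drift y' \<tau>"
  unfolding drift_def using assms(1)
  by (intro delay_integral_cong[OF K_nonneg in_delay_measures] assms(2)) auto

lemma drift_diff:
  assumes "continuous_on {-1..T} y" "continuous_on {-1..T} y'" "\<tau> \<in> {0..T}"
  shows "drift (\<lambda>s. y s - y' s) \<tau> = drift y \<tau> - drift y' \<tau>"
  unfolding drift_def using assms(3)
  by (intro delay_integral_diff[OF K_nonneg in_delay_measures] continuous_segment[OF assms(1)] continuous_segment[OF assms(2)]) auto

lemma drift_sum:
  assumes "\<And>i. i \<in> I \<Longrightarrow> continuous_on {-1..T} (f i)" "\<tau> \<in> {0..T}"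
  shows "drift (\<lambda>s. \<Sum>i\<in>I. c i * f i s) \<tau> = (\<Sum>i\<in>I. c i * drift (f i) \<tau>)"
  unfolding drift_def using assms(2)
  by (intro delay_integral_sum[OF K_nonneg in_delay_measures] continuous_segment[OF assms(1)]) auto

text \<open>Weak measurability concerns a fixed test function, while here the test function is the segment of
\<open>y\<close> that moves with \<open>\<tau>\<close>. Freezing the segment at the points of a grid leaves countably many test
functions. Uniform continuity of \<open>y\<close>, with the bound on the total variation, makes the frozen
drifts converge.\<close>
lemma drift_measurable:
  assumes y: "continuous_on {-1..T} y" and "T > 0"
  shows "drift y \<in> borel_measurable (lebesgue_on {0..T})"
proof -
  \<comment> \<open>A frozen segment starts earlier than the true one, possibly before \<open>-1\<close>; hence continue \<open>y\<close> by constants.\<close>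
  define w where "w x = y (max (-1) (min T x))" for x
  have w_cont: "continuous_on UNIV w"
    unfolding w_def using \<open>T > 0\<close> by (intro continuous_on_compose2[OF y] continuous_intros) auto
  have w_eq: "drift w \<tau> = drift y \<tau>" if "\<tau> \<in> {0..T}" for \<tau>
    by (rule drift_cong[OF that]) (simp add: w_def)
  define F where "F n \<tau> = signed_integral borel_I (\<kappa> \<tau>) (\<lambda>r. w (real_of_int \<lfloor>real (Suc n) * \<tau>\<rfloor> / Suc n + r))" for n and \<tau> :: real
  have "drift w \<in> borel_measurable (lebesgue_on {0..T})"
  proof (rule borel_measurable_LIMSEQ_real)
    show "F n \<in> borel_measurable (lebesgue_on {0..T})" for n
    proof -
      have "(\<lambda>\<tau>. (\<lambda>k \<tau>. signed_integral borel_I (\<kappa> \<tau>) (\<lambda>r. w (real_of_int k / Suc n + r))) \<lfloor>real (Suc n) * \<tau>\<rfloor> \<tau>)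
          \<in> borel_measurable (lebesgue_on {0..T})"
      proof (rule measurable_compose_countable[where f = "\<lambda>k \<tau>. signed_integral borel_I (\<kappa> \<tau>) (\<lambda>r. w (real_of_int k / Suc n + r))"
            and g = "\<lambda>\<tau>. \<lfloor>real (Suc n) * \<tau>\<rfloor>"])
        fix k :: int
        show "(\<lambda>\<tau>. signed_integral borel_I (\<kappa> \<tau>) (\<lambda>r. w (real_of_int k / Suc n + r))) \<in> borel_measurable (lebesgue_on {0..T})"
          using \<open>T > 0\<close> by (intro weakly_measurable continuous_on_compose2[OF w_cont] continuous_intros) auto
        have "(\<lambda>\<tau>. \<lfloor>real (Suc n) * \<tau>\<rfloor>) \<in> borel \<rightarrow>\<^sub>M count_space UNIV" by measurable
        then show "(\<lambda>\<tau>. \<lfloor>real (Suc n) * \<tau>\<rfloor>) \<in> lebesgue_on {0..T} \<rightarrow>\<^sub>M count_space UNIV"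
          by (intro measurable_restrict_space1 measurable_completion) simp
      qed
      then show ?thesis by (simp add: F_def[abs_def])
    qed
    fix \<tau> assume "\<tau> \<in> space (lebesgue_on {0..T})"
    then have \<tau>: "\<tau> \<in> {0..T}" by (simp add: space_restrict_space)
    show "(\<lambda>n. F n \<tau>) \<longlonglongrightarrow> drift w \<tau>"
      unfolding LIMSEQ_def
    proof (intro allI impI)
      fix e :: real assume "e > 0"
      define \<eta> where "\<eta> = e / (2 * K + 1)"
      have \<eta>: "\<eta> > 0" "2 * K * \<eta> < e" using \<open>e > 0\<close> K_nonneg by (auto simp: \<eta>_def field_simps)
      have "uniformly_continuous_on {-2..T} w"
        by (intro compact_uniformly_continuous continuous_on_subset[OF w_cont]) auto
      then obtain d where d: "d > 0" "\<And>x x'. x \<in> {-2..T} \<Longrightarrow> x' \<in> {-2..T} \<Longrightarrow> dist x' x < d \<Longrightarrow> dist (w x') (w x) < \<eta>"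
        unfolding uniformly_continuous_on_def using \<eta>(1) by blast
      obtain N :: nat where N: "1 / d < N" using reals_Archimedean2 by blast
      have "dist (F n \<tau>) (drift w \<tau>) < e" if "n \<ge> N" for n
      proof -
        define \<sigma> where "\<sigma> = real_of_int \<lfloor>real (Suc n) * \<tau>\<rfloor> / Suc n"
        have "1 / d < Suc n" using N that by linarith
        then have mesh: "1 / Suc n < d" using d(1) by (simp add: field_simps)
        have "real_of_int \<lfloor>real (Suc n) * \<tau>\<rfloor> \<le> real (Suc n) * \<tau>" "real (Suc n) * \<tau> - 1 < real_of_int \<lfloor>real (Suc n) * \<tau>\<rfloor>" by linarith+
        then have \<sigma>: "\<sigma> \<le> \<tau>" "\<tau> - 1 / Suc n < \<sigma>"
          unfolding \<sigma>_def by (simp_all add: divide_le_eq less_divide_eq algebra_simps del: of_nat_Suc)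
        moreover have "1 / real (Suc n) \<le> 1" by simp
        ultimately have "\<tau> - 1 < \<sigma>" by linarith
        have close: "\<bar>w (\<sigma> + r) - w (\<tau> + r)\<bar> \<le> \<eta>" if "r \<in> {-1..0}" for r
        proof -
          have "dist (w (\<sigma> + r)) (w (\<tau> + r)) < \<eta>"
            using \<tau> \<sigma> \<open>\<tau> - 1 < \<sigma>\<close> mesh that by (intro d(2)) (auto simp: dist_real_def)
          then show ?thesis by (simp add: dist_real_def)
        qed
        have cont: "continuous_on {-1..0} (\<lambda>r. w (\<sigma> + r))" "continuous_on {-1..0} (\<lambda>r. w (\<tau> + r))"
          by (intro continuous_on_compose2[OF w_cont] continuous_intros; simp)+
        have "\<kappa> \<tau> \<in> delay_measures K" using \<tau> by (intro in_delay_measures) simp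
        note dm = K_nonneg this
        have "F n \<tau> - drift w \<tau> = signed_integral borel_I (\<kappa> \<tau>) (\<lambda>r. w (\<sigma> + r) - w (\<tau> + r))"
          unfolding F_def drift_def \<sigma>_def[symmetric] by (rule delay_integral_diff[OF dm cont, symmetric])
        moreover have "\<bar>\<dots>\<bar> \<le> 2 * K * \<eta>"
          using \<eta>(1) close by (intro delay_integral_bound[OF dm] continuous_on_diff cont) auto
        ultimately show ?thesis using \<eta>(2) by (simp add: dist_real_def)
      qed
      then show "\<exists>N. \<forall>n\<ge>N. dist (F n \<tau>) (drift w \<tau>) < e" by blast
    qed
  qed
  then show ?thesis
    by (rule measurable_cong[THEN iffD1, rotated]) (simp add: space_restrict_space w_eq)
qed

lemma drift_integrable:
  assumes y: "continuous_on {-1..T} y" and "t \<le> T" "T > 0"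
  shows "set_integrable lebesgue {0..t} (drift y)"
proof -
  obtain C where C: "C \<ge> 0" "\<And>s. s \<in> {-1..T} \<Longrightarrow> \<bar>y s\<bar> \<le> C"
    by (rule continuous_on_Icc_bounded[OF y]) (rule that; assumption)
  have "set_integrable lebesgue {0..T} (drift y)"
    unfolding set_integrable_def
  proof (rule Bochner_Integration.integrable_bound[of _ "\<lambda>x. indicator {0..T} x *\<^sub>R (2 * K * C)"])
    have "integrable lborel (\<lambda>x. indicator {0..T} x *\<^sub>R (2 * K * C))"
      by (intro integrable_scaleR_left) (use \<open>T > 0\<close> in simp)
    then show "integrable lebesgue (\<lambda>x. indicator {0..T} x *\<^sub>R (2 * K * C))"
      by (subst integrable_completion) auto
    show "(\<lambda>x. indicator {0..T} x *\<^sub>R drift y x) \<in> borel_measurable lebesgue"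
      using drift_measurable[OF y \<open>T > 0\<close>] by (subst (asm) borel_measurable_restrict_space_iff) auto
    show "AE x in lebesgue. norm (indicator {0..T} x *\<^sub>R drift y x) \<le> norm (indicator {0..T} x *\<^sub>R (2 * K * C))"
    proof (rule AE_I2)
      fix x
      show "norm (indicator {0..T} x *\<^sub>R drift y x) \<le> norm (indicator {0..T} x *\<^sub>R (2 * K * C))"
        using drift_bound[OF y _ C(1), of x] C(2) by (cases "x \<in> {0..T}") auto
    qed
  qed
  then show ?thesis by (rule set_integrable_subset) (use \<open>t \<le> T\<close> in auto)
qed

lemma accumulated_bound:
  assumes y: "continuous_on {-1..T} y" and t: "0 \<le> t" "t \<le> T" "T > 0"
    and f: "\<And>\<tau>. \<tau> \<in> {0..t} \<Longrightarrow> \<bar>drift y \<tau>\<bar> \<le> f \<tau>" "continuous_on {0..t} f"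
  shows "\<bar>accumulated y t\<bar> \<le> integral {0..t} f"
proof -
  have fi: "set_integrable lborel {0..t} f" by (rule borel_integrable_atLeastAtMost'[OF f(2)])
  then have fi': "set_integrable lebesgue {0..t} f"
    unfolding set_integrable_def by (subst integrable_completion) auto
  have "\<bar>accumulated y t\<bar> \<le> (LINT \<tau>:{0..t}|lebesgue. \<bar>drift y \<tau>\<bar>)"
    unfolding accumulated_def using set_integral_norm_bound[OF drift_integrable[OF y t(2,3)]] by simp
  also have "\<dots> \<le> (LINT \<tau>:{0..t}|lebesgue. f \<tau>)"
    by (rule set_integral_mono[OF set_integrable_abs[OF drift_integrable[OF y t(2,3)]] fi' f(1)])
  also have "\<dots> = (LINT \<tau>:{0..t}|lborel. f \<tau>)"
    using fi unfolding set_lebesgue_integral_def set_integrable_def by (intro integral_completion) auto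
  also have "\<dots> = integral {0..t} f" by (rule set_borel_integral_eq_integral(2)[OF fi])
  finally show ?thesis .
qed

lemma accumulated_diff:
  assumes "continuous_on {-1..t} y" "continuous_on {-1..t} y'" "t > 0"
  shows "accumulated (\<lambda>s. y s - y' s) t = accumulated y t - accumulated y' t"
proof -
  have "accumulated (\<lambda>s. y s - y' s) t = (LINT \<tau>:{0..t}|lebesgue. drift y \<tau> - drift y' \<tau>)"
    unfolding accumulated_def by (rule set_lebesgue_integral_cong) (auto simp: drift_diff[OF assms(1,2)])
  also have "\<dots> = accumulated y t - accumulated y' t"
    unfolding accumulated_def using assms by (intro set_integral_diff(2) drift_integrable[of t]) auto
  finally show ?thesis .
qed

lemma accumulated_sum:
  assumes f: "\<And>i. i \<in> I \<Longrightarrow> continuous_on {-1..t} (f i)" and "t > 0"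
  shows "accumulated (\<lambda>s. \<Sum>i\<in>I. c i * f i s) t = (\<Sum>i\<in>I. c i * accumulated (f i) t)"
proof -
  have "accumulated (\<lambda>s. \<Sum>i\<in>I. c i * f i s) t = (LINT \<tau>:{0..t}|lebesgue. \<Sum>i\<in>I. c i * drift (f i) \<tau>)"
    unfolding accumulated_def by (rule set_lebesgue_integral_cong) (auto simp: drift_sum[OF f])
  also have "\<dots> = (\<integral>\<tau>. (\<Sum>i\<in>I. c i * (indicator {0..t} \<tau> *\<^sub>R drift (f i) \<tau>)) \<partial>lebesgue)"
    unfolding set_lebesgue_integral_def
    by (intro Bochner_Integration.integral_cong refl) (simp add: sum_distrib_left mult.left_commute)
  also have "\<dots> = (\<Sum>i\<in>I. c i * accumulated (f i) t)"
  proof -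
    have int: "integrable lebesgue (\<lambda>\<tau>. c i * (indicator {0..t} \<tau> *\<^sub>R drift (f i) \<tau>))" if "i \<in> I" for i
      using drift_integrable[OF f[OF that] order_refl \<open>t > 0\<close>] unfolding set_integrable_def
      by (rule integrable_mult_right)
    show ?thesis
      by (subst Bochner_Integration.integral_sum[OF int]) (simp_all add: accumulated_def set_lebesgue_integral_def)
  qed
  finally show ?thesis .
qed

lemma accumulated_0: "accumulated y 0 = 0"
proof -
  have "AE x in lebesgue. x \<noteq> (0::real)" by (rule AE_completion[OF AE_lborel_singleton])
  then have "AE x in lebesgue. indicator {0..0} x *\<^sub>R drift y x = 0"
    by eventually_elim auto
  then show ?thesis unfolding accumulated_def set_lebesgue_integral_def by (rule integral_eq_zero_AE)
qed

text \<open>The integral of \<open>2 K exp (rate \<tau>)\<close> over \<open>[0,t]\<close> is at most \<open>2 K / rate\<close> times \<open>exp (rate t)\<close>, so a rate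
above \<open>4 K\<close> turns the integral operator into a contraction with factor \<open>1 / 2\<close> on every bounded
interval. The summand 1 keeps the rate positive for \<open>K = 0\<close>.\<close>
definition rate :: real where "rate = 4 * K + 1"

definition weight :: "real \<Rightarrow> real" where "weight s = exp (rate * max s 0)"

lemma rate_pos: "rate > 0" using K_nonneg by (simp add: rate_def)

lemma weight_ge_1: "weight s \<ge> 1"
  using rate_pos by (simp add: weight_def)

lemma weight_mono: "s \<le> t \<Longrightarrow> weight s \<le> weight t"
  using rate_pos unfolding weight_def by (auto intro!: mult_left_mono)

text \<open>The weight is nondecreasing, hence on the segment that ends at \<open>\<tau>\<close> the function \<open>y\<close> is bounded by
\<open>D\<close> times the weight at \<open>\<tau>\<close> itself: the delay costs nothing.\<close>
lemma accumulated_contraction: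
  assumes y: "continuous_on {-1..t} y" and t: "t > 0" and D: "D \<ge> 0"
    and bound: "\<And>s. s \<in> {-1..t} \<Longrightarrow> \<bar>y s\<bar> \<le> D * weight s"
  shows "\<bar>accumulated y t\<bar> \<le> D / 2 * weight t"
proof -
  have "\<bar>accumulated y t\<bar> \<le> integral {0..t} (\<lambda>\<tau>. 2 * K * D * exp (rate * \<tau>))"
  proof (rule accumulated_bound[OF y])
    fix \<tau> assume \<tau>: "\<tau> \<in> {0..t}"
    have "\<bar>drift y \<tau>\<bar> \<le> 2 * K * (D * weight \<tau>)"
    proof (rule drift_bound[OF y \<tau>])
      show "D * weight \<tau> \<ge> 0" using D by (simp add: weight_def)
      fix s assume s: "s \<in> {-1..\<tau>}"
      have "\<bar>y s\<bar> \<le> D * weight s" using s \<tau> by (intro bound) auto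
      also have "\<dots> \<le> D * weight \<tau>" using s D by (intro mult_left_mono weight_mono) auto
      finally show "\<bar>y s\<bar> \<le> D * weight \<tau>" .
    qed
    then show "\<bar>drift y \<tau>\<bar> \<le> 2 * K * D * exp (rate * \<tau>)" using \<tau> by (simp add: weight_def)
  qed (use t in \<open>auto intro!: continuous_intros\<close>)
  also have "\<dots> = 2 * K * D / rate * exp (rate * t) - 2 * K * D / rate * exp (rate * 0)"
  proof (rule integral_unique, rule fundamental_theorem_of_calculus)
    show "((\<lambda>\<tau>. 2 * K * D / rate * exp (rate * \<tau>)) has_vector_derivative 2 * K * D * exp (rate * x)) (at x within {0..t})" for x
      using rate_pos unfolding has_real_derivative_iff_has_vector_derivative[symmetric]
      by (auto intro!: derivative_eq_intros)
  qed (use t in simp)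
  also have "\<dots> \<le> 2 * K * D / rate * exp (rate * t)"
    using rate_pos K_nonneg D by simp
  also have "\<dots> \<le> D / 2 * exp (rate * t)"
  proof (rule mult_right_mono)
    have "D * (4 * K) \<le> D * rate" using D by (intro mult_left_mono) (simp_all add: rate_def)
    then show "2 * K * D / rate \<le> D / 2" using rate_pos by (simp add: field_simps)
  qed simp
  finally show ?thesis using t by (simp add: weight_def)
qed

lemma accumulated_lipschitz:
  assumes y: "continuous_on {-1..T} y" and st: "0 \<le> s" "s \<le> t" "t \<le> T" "T > 0"
    and C: "C \<ge> 0" "\<And>s. s \<in> {-1..T} \<Longrightarrow> \<bar>y s\<bar> \<le> C"
  shows "\<bar>accumulated y t - accumulated y s\<bar> \<le> 2 * K * C * (t - s)"
proof -
  have int: "set_integrable lebesgue {0..s} (drift y)" "set_integrable lebesgue {s..t} (drift y)"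
    by (rule set_integrable_subset[OF drift_integrable[OF y st(3,4)]]; use st in auto)+
  have const: "set_integrable lborel {s..t} (\<lambda>_. 2 * K * C)"
    by (rule borel_integrable_atLeastAtMost') (rule continuous_on_const)
  then have const': "set_integrable lebesgue {s..t} (\<lambda>_. 2 * K * C)"
    unfolding set_integrable_def by (subst integrable_completion) auto
  have "AE x in lebesgue. x \<noteq> s" by (rule AE_completion[OF AE_lborel_singleton])
  then have "AE x in lebesgue. \<not> (x \<in> {0..s} \<and> x \<in> {s..t})" by eventually_elim auto
  from set_integral_Un_AE[OF this _ _ int] have "accumulated y t = accumulated y s + (LINT \<tau>:{s..t}|lebesgue. drift y \<tau>)"
    using st by (simp add: accumulated_def ivl_disj_un_two_touch)
  then have "\<bar>accumulated y t - accumulated y s\<bar> \<le> (LINT \<tau>:{s..t}|lebesgue. \<bar>drift y \<tau>\<bar>)"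
    using set_integral_norm_bound[OF int(2)] by simp
  also have "\<dots> \<le> (LINT \<tau>:{s..t}|lebesgue. 2 * K * C)"
    using st C by (intro set_integral_mono[OF set_integrable_abs[OF int(2)] const'] drift_bound[OF y]) auto
  also have "\<dots> = 2 * K * C * (t - s)"
    using st by (simp add: set_integral_const)
  finally show ?thesis .
qed

definition integral_operator :: "(real \<Rightarrow> real) \<Rightarrow> (real \<Rightarrow> real) \<Rightarrow> real \<Rightarrow> real" where
  "integral_operator u0 y s = (if s \<le> 0 then u0 s else u0 0 + accumulated y s)"

fun picard :: "(real \<Rightarrow> real) \<Rightarrow> nat \<Rightarrow> real \<Rightarrow> real" where
  "picard u0 0 = (\<lambda>s. u0 (min s 0))"
| "picard u0 (Suc n) = integral_operator u0 (picard u0 n)"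

lemma accumulated_lipschitz_const:
  assumes y: "continuous_on {-1..T} y" and "T > 0"
  obtains L where "\<And>s t. 0 \<le> s \<Longrightarrow> s \<le> t \<Longrightarrow> t \<le> T \<Longrightarrow> \<bar>accumulated y t - accumulated y s\<bar> \<le> L * (t - s)"
proof -
  obtain C where C: "C \<ge> 0" "\<And>s. s \<in> {-1..T} \<Longrightarrow> \<bar>y s\<bar> \<le> C"
    by (rule continuous_on_Icc_bounded[OF y]) (rule that; assumption)
  show thesis
    by (rule that[of "2 * K * C"]) (rule accumulated_lipschitz[OF y _ _ _ \<open>T > 0\<close> C])
qed

text \<open>To the left of 0 the function is \<open>u\<^sub>0\<close>, to the right it is Lipschitz because the drift is bounded.\<close>
lemma integral_operator_abs_continuous:
  assumes y: "continuous_on {-1..T} y" and "T > 0" and u0: "abs_continuous_on_Icc (-1) 0 u0"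
  shows "abs_continuous_on_Icc (-1) T (integral_operator u0 y)"
proof (rule abs_continuous_concat)
  show "abs_continuous_on_Icc (-1) 0 (integral_operator u0 y)"
    by (rule abs_continuous_cong[OF _ u0]) (simp add: integral_operator_def)
  obtain L where L: "\<And>s t. 0 \<le> s \<Longrightarrow> s \<le> t \<Longrightarrow> t \<le> T \<Longrightarrow> \<bar>accumulated y t - accumulated y s\<bar> \<le> L * (t - s)"
    by (rule accumulated_lipschitz_const[OF y \<open>T > 0\<close>]) (rule that; assumption)
  have eq: "integral_operator u0 y s = u0 0 + accumulated y s" if "s \<ge> 0" for s
    using that accumulated_0[of y] by (cases "s = 0") (auto simp: integral_operator_def)
  show "abs_continuous_on_Icc 0 T (integral_operator u0 y)"
  proof (rule lipschitz_imp_abs_continuous)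
    fix s t assume st: "0 \<le> s" "s \<le> t" "t \<le> T"
    then show "\<bar>integral_operator u0 y t - integral_operator u0 y s\<bar> \<le> L * (t - s)"
      using L[OF st] by (simp add: eq)
  qed
qed (use \<open>T > 0\<close> in auto)

lemma picard_continuous:
  assumes u0: "abs_continuous_on_Icc (-1) 0 u0" and "T > 0"
  shows "continuous_on {-1..T} (picard u0 n)"
proof (induction n)
  case 0
  show ?case
    by (simp, rule continuous_on_compose2[OF abs_continuous_imp_continuous[OF u0]]) (auto intro!: continuous_intros)
next
  case (Suc n)
  then show ?case
    using abs_continuous_imp_continuous[OF integral_operator_abs_continuous[OF Suc \<open>T > 0\<close> u0]] by simp
qed

lemma integral_operator_diff:
  assumes "continuous_on {-1..s} y" "continuous_on {-1..s} y'" "s > 0"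
  shows "integral_operator u0 y s - integral_operator u0 y' s = accumulated (\<lambda>s. y s - y' s) s"
  using assms accumulated_diff[of s y y'] by (simp add: integral_operator_def)

lemma integral_operator_contraction:
  assumes y: "continuous_on {-1..s} y" "continuous_on {-1..s} y'" and D: "D \<ge> 0"
    and bound: "\<And>r. r \<in> {-1..s} \<Longrightarrow> \<bar>y r - y' r\<bar> \<le> D * weight r"
  shows "\<bar>integral_operator u0 y s - integral_operator u0 y' s\<bar> \<le> D / 2 * weight s"
proof (cases "s > 0")
  case True
  then show ?thesis
    unfolding integral_operator_diff[OF y True]
    using y by (intro accumulated_contraction D bound continuous_on_diff) auto
next
  case False
  then show ?thesis using D by (simp add: integral_operator_def weight_def)
qed

lemma picard_step:
  assumes u0: "abs_continuous_on_Icc (-1) 0 u0"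
    and C: "C \<ge> 0" "\<And>s. s \<in> {-1..0} \<Longrightarrow> \<bar>u0 s\<bar> \<le> C" and "s \<ge> -1"
  shows "\<bar>picard u0 (Suc n) s - picard u0 n s\<bar> \<le> C / 2 ^ n * weight s"
  using \<open>s \<ge> -1\<close>
proof (induction n arbitrary: s)
  case 0
  show ?case
  proof (cases "s > 0")
    case True
    have "\<bar>picard u0 0 r\<bar> \<le> C * weight r" if "r \<in> {-1..s}" for r
    proof -
      have "\<bar>picard u0 0 r\<bar> \<le> C * 1" using C(2)[of "min r 0"] that by simp
      also have "\<dots> \<le> C * weight r" using C(1) by (intro mult_left_mono weight_ge_1)
      finally show ?thesis .
    qed
    from accumulated_contraction[OF picard_continuous[OF u0 True] True C(1) this]
    have "\<bar>picard u0 (Suc 0) s - picard u0 0 s\<bar> \<le> C / 2 * weight s"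
      using True by (simp add: integral_operator_def)
    also have "\<dots> \<le> C * weight s" using C(1) by (simp add: weight_def)
    finally show ?thesis by simp
  next
    case False
    then show ?thesis using C(1) by (simp add: integral_operator_def weight_def)
  qed
next
  case (Suc n)
  have cont: "continuous_on {-1..s} (picard u0 m)" for m
    by (rule continuous_on_subset[OF picard_continuous[OF u0, of "max 1 s"]]) auto
  have "\<bar>integral_operator u0 (picard u0 (Suc n)) s - integral_operator u0 (picard u0 n) s\<bar> \<le> C / 2 ^ n / 2 * weight s"
    using Suc.IH C(1) by (intro integral_operator_contraction cont) auto
  then show ?case by simp
qed

text \<open>A telescoping geometric sum. The exact remainder in the bound lets the induction close.\<close>
lemma picard_tail:
  assumes u0: "abs_continuous_on_Icc (-1) 0 u0"
    and C: "C \<ge> 0" "\<And>s. s \<in> {-1..0} \<Longrightarrow> \<bar>u0 s\<bar> \<le> C" and "s \<ge> -1"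
  shows "\<bar>picard u0 (n + k) s - picard u0 n s\<bar> \<le> (2 * C / 2 ^ n - 2 * C / 2 ^ (n + k)) * weight s"
proof (induction k)
  case (Suc k)
  have "\<bar>picard u0 (n + Suc k) s - picard u0 n s\<bar> \<le> C / 2 ^ (n + k) * weight s + (2 * C / 2 ^ n - 2 * C / 2 ^ (n + k)) * weight s"
    using picard_step[OF u0 C \<open>s \<ge> -1\<close>, of "n + k"] Suc by (simp del: picard.simps) 
  also have "\<dots> = (2 * C / 2 ^ n - 2 * C / 2 ^ (n + Suc k)) * weight s"
    by (simp add: field_simps)
  finally show ?case .
qed simp

definition solution :: "(real \<Rightarrow> real) \<Rightarrow> real \<Rightarrow> real" where
  "solution u0 = (\<lambda>s\<in>{-1..}. lim (\<lambda>n. picard u0 n s))"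

lemma picard_tendsto:
  assumes u0: "abs_continuous_on_Icc (-1) 0 u0" and "s \<ge> -1"
  shows "(\<lambda>n. picard u0 n s) \<longlonglongrightarrow> solution u0 s"
proof -
  obtain C where C: "C \<ge> 0" "\<And>s. s \<in> {-1..0} \<Longrightarrow> \<bar>u0 s\<bar> \<le> C"
    by (rule continuous_on_Icc_bounded[OF abs_continuous_imp_continuous[OF u0]]) (rule that; assumption)
  have "Cauchy (\<lambda>n. picard u0 n s)"
  proof (rule CauchyI')
    fix e :: real assume "e > 0"
    have "\<forall>\<^sub>F n in sequentially. 2 * C / 2 ^ n * weight s < e"
      by (rule order_tendstoD(2)[OF geometric_tendsto_zero \<open>e > 0\<close>])
    then obtain N where N: "2 * C / 2 ^ n * weight s < e" if "n \<ge> N" for n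
      unfolding eventually_sequentially by blast
    have "dist (picard u0 m s) (picard u0 n s) < e" if "m \<ge> N" "n > m" for m n
    proof -
      have "(2 * C / 2 ^ m - 2 * C / 2 ^ n) * weight s \<le> 2 * C / 2 ^ m * weight s"
        using C(1) by (intro mult_right_mono) (auto simp: weight_def)
      moreover have "\<bar>picard u0 n s - picard u0 m s\<bar> \<le> (2 * C / 2 ^ m - 2 * C / 2 ^ n) * weight s"
        using picard_tail[OF u0 C \<open>s \<ge> -1\<close>, of m "n - m"] that(2) by simp
      ultimately show ?thesis using N[OF that(1)] by (simp add: dist_real_def abs_minus_commute)
    qed
    then show "\<exists>M. \<forall>m\<ge>M. \<forall>n>m. dist (picard u0 m s) (picard u0 n s) < e" by blast
  qed
  then show ?thesis
    using \<open>s \<ge> -1\<close> by (simp add: solution_def Cauchy_convergent_iff convergent_LIMSEQ_iff)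
qed

lemma picard_error:
  assumes u0: "abs_continuous_on_Icc (-1) 0 u0"
    and C: "C \<ge> 0" "\<And>s. s \<in> {-1..0} \<Longrightarrow> \<bar>u0 s\<bar> \<le> C" and "s \<ge> -1"
  shows "\<bar>solution u0 s - picard u0 n s\<bar> \<le> 2 * C / 2 ^ n * weight s"
proof (rule LIMSEQ_le_const2)
  show "(\<lambda>k. \<bar>picard u0 (k + n) s - picard u0 n s\<bar>) \<longlonglongrightarrow> \<bar>solution u0 s - picard u0 n s\<bar>"
    by (intro tendsto_intros LIMSEQ_ignore_initial_segment picard_tendsto[OF u0 \<open>s \<ge> -1\<close>])
  have "\<bar>picard u0 (k + n) s - picard u0 n s\<bar> \<le> 2 * C / 2 ^ n * weight s" for k
  proof -
    have "(2 * C / 2 ^ n - 2 * C / 2 ^ (n + k)) * weight s \<le> 2 * C / 2 ^ n * weight s"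
      using C(1) by (intro mult_right_mono) (auto simp: weight_def)
    then show ?thesis using picard_tail[OF u0 C \<open>s \<ge> -1\<close>, of n k] by (simp add: add.commute)
  qed
  then show "\<exists>N. \<forall>k\<ge>N. \<bar>picard u0 (k + n) s - picard u0 n s\<bar> \<le> 2 * C / 2 ^ n * weight s" by blast
qed

lemma solution_continuous:
  assumes u0: "abs_continuous_on_Icc (-1) 0 u0" and "T > 0"
  shows "continuous_on {-1..T} (solution u0)"
proof -
  obtain C where C: "C \<ge> 0" "\<And>s. s \<in> {-1..0} \<Longrightarrow> \<bar>u0 s\<bar> \<le> C"
    by (rule continuous_on_Icc_bounded[OF abs_continuous_imp_continuous[OF u0]]) (rule that; assumption)
  have "uniform_limit {-1..T} (picard u0) (solution u0) sequentially"
  proof (rule uniform_limitI)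
    fix e :: real assume "e > 0"
    have "(\<lambda>n. 2 * C / 2 ^ n * weight T) \<longlonglongrightarrow> 0"
      by (rule geometric_tendsto_zero)
    then have "\<forall>\<^sub>F n in sequentially. 2 * C / 2 ^ n * weight T < e"
      using \<open>e > 0\<close> by (rule order_tendstoD)
    then show "\<forall>\<^sub>F n in sequentially. \<forall>s\<in>{-1..T}. dist (picard u0 n s) (solution u0 s) < e"
    proof eventually_elim
      case (elim n)
      show ?case
      proof
        fix s assume s: "s \<in> {-1..T}"
        have "\<bar>solution u0 s - picard u0 n s\<bar> \<le> 2 * C / 2 ^ n * weight s"
          using s by (intro picard_error[OF u0 C]) auto
        also have "\<dots> \<le> 2 * C / 2 ^ n * weight T"
          using s C(1) by (intro mult_left_mono weight_mono) auto
        also have "\<dots> < e" by (rule elim)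
        finally show "dist (picard u0 n s) (solution u0 s) < e" by (simp add: dist_real_def abs_minus_commute)
      qed
    qed
  qed
  then show ?thesis
    by (rule uniform_limit_theorem[rotated]) (auto intro!: picard_continuous[OF u0 \<open>T > 0\<close>] always_eventually)
qed

lemma solution_fixed_point:
  assumes u0: "abs_continuous_on_Icc (-1) 0 u0" and "s \<ge> -1"
  shows "solution u0 s = integral_operator u0 (solution u0) s"
proof (rule LIMSEQ_unique[where X = "\<lambda>n. picard u0 (Suc n) s"])
  obtain C where C: "C \<ge> 0" "\<And>s. s \<in> {-1..0} \<Longrightarrow> \<bar>u0 s\<bar> \<le> C"
    by (rule continuous_on_Icc_bounded[OF abs_continuous_imp_continuous[OF u0]]) (rule that; assumption)
  show "(\<lambda>n. picard u0 (Suc n) s) \<longlonglongrightarrow> solution u0 s"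
    by (rule LIMSEQ_Suc[OF picard_tendsto[OF u0 \<open>s \<ge> -1\<close>]])
  have cont: "continuous_on {-1..s} (picard u0 m)" "continuous_on {-1..s} (solution u0)" for m
    by (rule continuous_on_subset[OF picard_continuous[OF u0, of "max 1 s"]]; simp)
      (rule continuous_on_subset[OF solution_continuous[OF u0, of "max 1 s"]]; simp)
  have "\<bar>integral_operator u0 (picard u0 n) s - integral_operator u0 (solution u0) s\<bar> \<le> 2 * C / 2 ^ n / 2 * weight s" for n
  proof (rule integral_operator_contraction[OF cont])
    show "\<bar>picard u0 n r - solution u0 r\<bar> \<le> 2 * C / 2 ^ n * weight r" if "r \<in> {-1..s}" for r
      using picard_error[OF u0 C, of r n] that by (simp add: abs_minus_commute)
  qed (use C(1) in simp)
  then have "norm (integral_operator u0 (picard u0 n) s - integral_operator u0 (solution u0) s) \<le> C / 2 ^ n * weight s" for n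
    by (simp only: real_norm_def mult_divide_mult_cancel_left_if times_divide_eq_right) simp
  from Lim_null_comparison[OF always_eventually[OF allI[OF this]] geometric_tendsto_zero]
  have "(\<lambda>n. integral_operator u0 (picard u0 n) s - integral_operator u0 (solution u0) s) \<longlonglongrightarrow> 0" .
  then show "(\<lambda>n. picard u0 (Suc n) s) \<longlonglongrightarrow> integral_operator u0 (solution u0) s"
    by (simp add: LIM_zero_iff)
qed

lemma solution_abs_continuous:
  assumes u0: "abs_continuous_on_Icc (-1) 0 u0" and "T > 0"
  shows "abs_continuous_on_Icc (-1) T (solution u0)"
  by (rule abs_continuous_cong[OF _ integral_operator_abs_continuous[OF solution_continuous[OF u0 \<open>T > 0\<close>] \<open>T > 0\<close> u0]])
    (simp add: solution_fixed_point[OF u0, symmetric])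

text \<open>Applying the contraction again and again halves the bound on the difference each time.\<close>
lemma fixed_point_unique:
  assumes cont: "\<And>T. continuous_on {-1..T} z" "\<And>T. continuous_on {-1..T} z'"
    and fixed: "\<And>s. s \<ge> -1 \<Longrightarrow> z s = integral_operator u0 z s" "\<And>s. s \<ge> -1 \<Longrightarrow> z' s = integral_operator u0 z' s"
    and "s \<ge> -1"
  shows "z s = z' s"
proof -
  obtain B where B: "B \<ge> 0" "\<And>r. r \<in> {-1..s} \<Longrightarrow> \<bar>z r - z' r\<bar> \<le> B"
    by (rule continuous_on_Icc_bounded[OF continuous_on_diff[OF cont]]) (rule that; assumption)
  have "\<bar>z r - z' r\<bar> \<le> B / 2 ^ n * weight r" if "r \<in> {-1..s}" for r n
    using that
  proof (induction n arbitrary: r)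
    case 0
    have "B * 1 \<le> B * weight r" using B(1) by (intro mult_left_mono weight_ge_1)
    then show ?case using B(2)[OF 0] by simp
  next
    case (Suc n)
    have "\<bar>integral_operator u0 z r - integral_operator u0 z' r\<bar> \<le> B / 2 ^ n / 2 * weight r"
      using Suc B(1) by (intro integral_operator_contraction cont) auto
    then show ?case using fixed[of r] Suc.prems by simp
  qed
  from this[of s] have le: "\<bar>z s - z' s\<bar> \<le> B / 2 ^ n * weight s" for n using \<open>s \<ge> -1\<close> by simp
  have "(\<lambda>n. B / 2 ^ n * weight s) \<longlonglongrightarrow> 0" by (rule geometric_tendsto_zero)
  then have "\<bar>z s - z' s\<bar> \<le> 0" by (rule LIMSEQ_le_const) (use le in blast)
  then show ?thesis by simp
qed

lemma is_delay_solution_iff: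
  "is_delay_solution \<kappa> u0 z \<longleftrightarrow> z \<in> extensional {-1..} \<and> continuous_on {-1..} z \<and>
     (\<forall>s\<ge>-1. z s = integral_operator u0 z s)"
proof -
  have "(\<forall>s\<in>{-1..0}. z s = u0 s) \<and> (\<forall>t\<ge>0. z t = u0 0 + accumulated z t) \<longleftrightarrow>
      (\<forall>s\<ge>-1. z s = integral_operator u0 z s)"
  proof safe
    fix s :: real assume "\<forall>s\<in>{-1..0}. z s = u0 s" "\<forall>t\<ge>0. z t = u0 0 + accumulated z t" "-1 \<le> s"
    then show "z s = integral_operator u0 z s" unfolding integral_operator_def by auto
  next
    fix s :: real assume "\<forall>s\<ge>-1. z s = integral_operator u0 z s" "s \<in> {-1..0}"
    then show "z s = u0 s" unfolding integral_operator_def by auto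
  next
    fix t :: real assume *: "\<forall>s\<ge>-1. z s = integral_operator u0 z s" "0 \<le> t"
    then have "z t = integral_operator u0 z t" by simp
    then show "z t = u0 0 + accumulated z t"
      using *(2) accumulated_0[of z] by (cases "t = 0") (simp_all add: integral_operator_def)
  qed
  then show ?thesis
    unfolding is_delay_solution_def accumulated_def drift_def by blast
qed

lemma continuous_on_atLeast:
  fixes z :: "real \<Rightarrow> real"
  assumes "\<And>T. T > 0 \<Longrightarrow> continuous_on {-1..T} z"
  shows "continuous_on {-1..} z"
  unfolding continuous_on_eq_continuous_within
proof
  fix x :: real assume x: "x \<in> {-1..}"
  have "at x within {-1..} = at x within {-1..max x 0 + 1}"
    by (rule at_within_nhd[of x "{..<max x 0 + 1}"]) auto
  moreover have "continuous (at x within {-1..max x 0 + 1}) z"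
    using assms[of "max x 0 + 1"] x by (simp add: continuous_on_eq_continuous_within)
  ultimately show "continuous (at x within {-1..}) z" by simp
qed

lemma delay_solution_eq:
  assumes u0: "abs_continuous_on_Icc (-1) 0 u0"
  shows "delay_solution \<kappa> u0 = solution u0"
  unfolding delay_solution_def
proof (rule the_equality)
  show sol: "is_delay_solution \<kappa> u0 (solution u0)"
    unfolding is_delay_solution_iff
    using solution_fixed_point[OF u0] solution_continuous[OF u0]
    by (auto intro: continuous_on_atLeast simp: solution_def)
  fix z assume z: "is_delay_solution \<kappa> u0 z"
  show "z = solution u0"
  proof (rule extensionalityI[of _ "{-1..}"])
    show "z \<in> extensional {-1..}" "solution u0 \<in> extensional {-1..}"
      using z sol unfolding is_delay_solution_iff by blast+
    have cont: "continuous_on {-1..T} z" "continuous_on {-1..T} (solution u0)" for T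
      using z sol unfolding is_delay_solution_iff by (auto elim!: continuous_on_subset)
    show "z s = solution u0 s" if "s \<in> {-1..}" for s
      using z sol that unfolding is_delay_solution_iff
      by (intro fixed_point_unique[OF cont]) auto
  qed
qed

end

section \<open>Measurability in the random parameter\<close>

lemma real_polynomial_abs_continuous:
  assumes "real_polynomial_function p"
  shows "abs_continuous_on_Icc a b p"
proof -
  obtain p' where p': "real_polynomial_function p'" "\<And>x. (p has_real_derivative p' x) (at x)"
    using has_real_derivative_polynomial_function[OF assms] by blast
  have "continuous_on {a..b} p'"
    using continuous_real_polymonial_function[OF p'(1)] by (simp add: continuous_at_imp_continuous_on)
  then obtain B where B: "B \<ge> 0" "\<And>x. x \<in> {a..b} \<Longrightarrow> \<bar>p' x\<bar> \<le> B"
    by (rule continuous_on_Icc_bounded) (rule that; assumption)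
  show ?thesis
  proof (rule lipschitz_imp_abs_continuous)
    fix x y assume xy: "a \<le> x" "x \<le> y" "y \<le> b"
    show "\<bar>p y - p x\<bar> \<le> B * (y - x)"
    proof (cases "x = y")
      case False
      then obtain z where z: "x < z" "z < y" "p y - p x = (y - x) * p' z"
        using MVT2[of x y p p'] xy p'(2) by auto
      have "\<bar>p y - p x\<bar> = (y - x) * \<bar>p' z\<bar>" using z(3) xy by (simp add: abs_mult)
      also have "\<dots> \<le> (y - x) * B" using B(2)[of z] z(1,2) xy by (intro mult_left_mono) auto
      finally show ?thesis by (simp add: mult.commute)
    qed simp
  qed
qed

lemma path_functional_measurable:
  assumes "y \<in> AC (-1) T" "t \<in> {0..T}"
  shows "path_functional y t \<in> borel_measurable (path_space K T)"
proof (rule measurableI)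
  let ?G = "{{\<mu> \<in> measure_paths K T. path_functional y t \<mu> \<in> B} | y t B.
          y \<in> AC (-1) T \<and> t \<in> {0..T} \<and> B \<in> sets borel}"
  fix B :: "real set" assume "B \<in> sets borel"
  then have "{\<mu> \<in> measure_paths K T. path_functional y t \<mu> \<in> B} \<in> ?G"
    using assms by blast
  moreover have "?G \<subseteq> Pow (measure_paths K T)" by blast
  ultimately have "{\<mu> \<in> measure_paths K T. path_functional y t \<mu> \<in> B} \<in> sets (path_space K T)"
    unfolding path_space_def by (intro in_measure_of)
  moreover have "space (path_space K T) = measure_paths K T"
    unfolding path_space_def by (rule space_measure_of) blast
  then have "path_functional y t -` B \<inter> space (path_space K T) = {\<mu> \<in> measure_paths K T. path_functional y t \<mu> \<in> B}"
    by auto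
  ultimately show "path_functional y t -` B \<inter> space (path_space K T) \<in> sets (path_space K T)" by simp
qed simp

text \<open>Up to time \<open>t\<close> the functional sees only the restricted path, and only the values of \<open>y\<close> on \<open>[-1,T]\<close>.\<close>
lemma path_functional_restrict:
  assumes "delay_path K \<kappa>" "t \<in> {0..T}"
  shows "path_functional (\<lambda>x\<in>{-1..T}. y x) t (\<lambda>\<tau>\<in>{0..T}. \<kappa> \<tau>) = delay_path.accumulated \<kappa> y t"
proof -
  interpret delay_path K \<kappa> by (rule assms(1))
  show ?thesis
    unfolding path_functional_def accumulated_def drift_def
  proof (rule set_lebesgue_integral_cong)
    show "\<forall>\<tau>. \<tau> \<in> {0..t} \<longrightarrow> signed_integral borel_I ((\<lambda>\<tau>\<in>{0..T}. \<kappa> \<tau>) \<tau>) (\<lambda>s. (\<lambda>x\<in>{-1..T}. y x) (\<tau> + s)) =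
        signed_integral borel_I (\<kappa> \<tau>) (\<lambda>r. y (\<tau> + r))"
    proof (intro allI impI)
      fix \<tau> assume \<tau>: "\<tau> \<in> {0..t}"
      then have "\<tau> \<in> {0..T}" using assms(2) by auto
      moreover have "signed_integral borel_I (\<kappa> \<tau>) (\<lambda>s. (\<lambda>x\<in>{-1..T}. y x) (\<tau> + s)) = signed_integral borel_I (\<kappa> \<tau>) (\<lambda>r. y (\<tau> + r))"
        using \<tau> assms(2) by (intro delay_integral_cong[OF K_nonneg in_delay_measures]) auto
      ultimately show "signed_integral borel_I ((\<lambda>\<tau>\<in>{0..T}. \<kappa> \<tau>) \<tau>) (\<lambda>s. (\<lambda>x\<in>{-1..T}. y x) (\<tau> + s)) =
        signed_integral borel_I (\<kappa> \<tau>) (\<lambda>r. y (\<tau> + r))" by simp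
    qed
  qed simp
qed

text \<open>Applied to the Bernstein polynomials of \<open>y \<omega>\<close>, which are combinations of fixed polynomials with the
random coefficients \<open>y \<omega> (x n k)\<close>, the functional is a finite sum of products of measurable
functions. The polynomials converge uniformly on \<open>[-1,t]\<close>, and the contraction estimate transfers
this to the functional.\<close>
lemma accumulated_random_measurable:
  assumes path: "\<And>\<omega>. \<omega> \<in> space M \<Longrightarrow> delay_path K (\<kappa> \<omega>)"
    and poly: "\<And>p. real_polynomial_function p \<Longrightarrow> (\<lambda>\<omega>. delay_path.accumulated (\<kappa> \<omega>) p t) \<in> borel_measurable M"
    and "t > 0"
    and cont: "\<And>\<omega>. \<omega> \<in> space M \<Longrightarrow> continuous_on {-1..t} (y \<omega>)"
    and meas: "\<And>s. s \<in> {-1..t} \<Longrightarrow> (\<lambda>\<omega>. y \<omega> s) \<in> borel_measurable M"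
  shows "(\<lambda>\<omega>. delay_path.accumulated (\<kappa> \<omega>) (y \<omega>) t) \<in> borel_measurable M"
proof -
  \<comment> \<open>Bernstein polynomials live on \<open>[0,1]\<close>, which is mapped affinely to \<open>[-1,t]\<close>. For \<open>n = 0\<close> the node is \<open>-1\<close>.\<close>
  define x where "x n k = -1 + (t + 1) * (real k / real n)" for n k :: nat
  define \<phi> where "\<phi> n k s = Bernstein n k ((s + 1) / (t + 1))" for n k s
  define B where "B n \<omega> s = (\<Sum>k\<le>n. y \<omega> (x n k) * \<phi> n k s)" for n \<omega> s
  have x_in: "x n k \<in> {-1..t}" if "k \<le> n" for n k
  proof -
    have "real k / real n \<le> 1" using that by (cases "n = 0") (auto simp: divide_le_eq_1)
    then have "(t + 1) * (real k / real n) \<le> (t + 1) * 1" using \<open>t > 0\<close> by (intro mult_left_mono) auto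
    then show ?thesis using \<open>t > 0\<close> by (simp add: x_def)
  qed
  have \<phi>_poly: "real_polynomial_function (\<phi> n k)" for n k
  proof -
    have "real_polynomial_function (\<lambda>s. (s + 1) / (t + 1))"
      by (intro real_polynomial_function_divide real_polynomial_function.intros bounded_linear_ident)
    then show ?thesis
      unfolding \<phi>_def Bernstein_def
      by (intro real_polynomial_function.intros(2,4) real_polynomial_function_power real_polynomial_function_diff)
  qed
  have \<phi>_cont: "continuous_on S (\<phi> n k)" for S n k
    using continuous_real_polymonial_function[OF \<phi>_poly] by (simp add: continuous_at_imp_continuous_on)
  show ?thesis
  proof (rule borel_measurable_LIMSEQ_real[where u = "\<lambda>n \<omega>. \<Sum>k\<le>n. y \<omega> (x n k) * delay_path.accumulated (\<kappa> \<omega>) (\<phi> n k) t"])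
    show "(\<lambda>\<omega>. \<Sum>k\<le>n. y \<omega> (x n k) * delay_path.accumulated (\<kappa> \<omega>) (\<phi> n k) t) \<in> borel_measurable M" for n
      by (intro borel_measurable_sum borel_measurable_times meas poly \<phi>_poly x_in) simp
    fix \<omega> assume \<omega>: "\<omega> \<in> space M"
    interpret delay_path K "\<kappa> \<omega>" by (rule path[OF \<omega>])
    have B_cont: "continuous_on {-1..t} (B n \<omega>)" for n
      unfolding B_def by (intro continuous_intros \<phi>_cont)
    have B_acc: "(\<Sum>k\<le>n. y \<omega> (x n k) * accumulated (\<phi> n k) t) = accumulated (B n \<omega>) t" for n
      unfolding B_def by (rule accumulated_sum[OF \<phi>_cont \<open>t > 0\<close>, symmetric])
    show "(\<lambda>n. \<Sum>k\<le>n. y \<omega> (x n k) * accumulated (\<phi> n k) t) \<longlonglongrightarrow> accumulated (y \<omega>) t"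
      unfolding B_acc LIMSEQ_def
    proof (intro allI impI)
      fix e :: real assume "e > 0"
      define \<eta> where "\<eta> = e / weight t"
      have w: "weight t > 0" by (simp add: weight_def)
      then have "\<eta> > 0" using \<open>e > 0\<close> by (simp add: \<eta>_def)
      have "continuous_on {0..1} (\<lambda>v. y \<omega> (-1 + (t + 1) * v))"
      proof (rule continuous_on_compose2[OF cont[OF \<omega>]])
        show "(\<lambda>v. -1 + (t + 1) * v) ` {0..1} \<subseteq> {-1..t}"
        proof clarsimp
          fix v :: real assume v: "0 \<le> v" "v \<le> 1"
          then have "(t + 1) * v \<le> (t + 1) * 1" "0 \<le> (t + 1) * v"
            using \<open>t > 0\<close> by (intro mult_left_mono mult_nonneg_nonneg; simp)+
          then show "0 \<le> (t + 1) * v \<and> (t + 1) * v - 1 \<le> t" by simp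
        qed
      qed (intro continuous_intros)
      from Bernstein_Weierstrass[OF this \<open>\<eta> > 0\<close>] obtain N where N:
        "\<forall>n v. N \<le> n \<and> v \<in> {0..1} \<longrightarrow>
          \<bar>y \<omega> (-1 + (t + 1) * v) - (\<Sum>k\<le>n. y \<omega> (-1 + (t + 1) * (real k / real n)) * Bernstein n k v)\<bar> < \<eta>"
        by blast
      have "dist (accumulated (B n \<omega>) t) (accumulated (y \<omega>) t) < e" if "n \<ge> N" for n
      proof -
        have close: "\<bar>B n \<omega> s - y \<omega> s\<bar> \<le> \<eta> * weight s" if "s \<in> {-1..t}" for s
        proof -
          define v where "v = (s + 1) / (t + 1)"
          have "v \<in> {0..1}" using that \<open>t > 0\<close> by (simp add: v_def divide_le_eq_1)
          then have "\<bar>y \<omega> (-1 + (t + 1) * v) - (\<Sum>k\<le>n. y \<omega> (-1 + (t + 1) * (real k / real n)) * Bernstein n k v)\<bar> < \<eta>"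
            using N \<open>n \<ge> N\<close> by blast
          moreover have "-1 + (t + 1) * v = s" using \<open>t > 0\<close> by (simp add: v_def)
          moreover have "(\<Sum>k\<le>n. y \<omega> (-1 + (t + 1) * (real k / real n)) * Bernstein n k v) = B n \<omega> s"
            by (simp add: B_def x_def \<phi>_def v_def)
          ultimately have "\<bar>B n \<omega> s - y \<omega> s\<bar> \<le> \<eta> * 1" by (simp add: abs_minus_commute)
          also have "\<dots> \<le> \<eta> * weight s" using \<open>\<eta> > 0\<close> by (intro mult_left_mono weight_ge_1) simp
          finally show ?thesis .
        qed
        have "\<bar>accumulated (\<lambda>s. B n \<omega> s - y \<omega> s) t\<bar> \<le> \<eta> / 2 * weight t"
          using \<open>\<eta> > 0\<close> by (intro accumulated_contraction close continuous_on_diff B_cont cont \<omega> \<open>t > 0\<close>) simp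
        also have "accumulated (\<lambda>s. B n \<omega> s - y \<omega> s) t = accumulated (B n \<omega>) t - accumulated (y \<omega>) t"
          by (rule accumulated_diff[OF B_cont cont[OF \<omega>] \<open>t > 0\<close>])
        also have "\<eta> / 2 * weight t = e / 2" using w by (simp add: \<eta>_def)
        finally show ?thesis using \<open>e > 0\<close> by (simp add: dist_real_def)
      qed
      then show "\<exists>N. \<forall>n\<ge>N. dist (accumulated (B n \<omega>) t) (accumulated (y \<omega>) t) < e" by blast
    qed
  qed
qed

lemma delay_path_of_measure_paths:
  assumes "K \<ge> 0" and paths: "\<And>T. T > 0 \<Longrightarrow> (\<lambda>t\<in>{0..T}. \<kappa> t) \<in> measure_paths K T"
  shows "delay_path K \<kappa>"
proof
  show "\<kappa> \<tau> \<in> delay_measures K" if "\<tau> \<ge> 0" for \<tau>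
  proof -
    have "(\<lambda>t\<in>{0..\<tau> + 1}. \<kappa> t) \<in> {0..\<tau> + 1} \<rightarrow>\<^sub>E delay_measures K"
      using paths[of "\<tau> + 1"] that by (simp add: measure_paths_def)
    then have "(\<lambda>t\<in>{0..\<tau> + 1}. \<kappa> t) \<tau> \<in> delay_measures K" by (rule PiE_mem) (use that in simp)
    then show ?thesis using that by simp
  qed
  show "(\<lambda>t. signed_integral borel_I (\<kappa> t) f) \<in> borel_measurable (lebesgue_on {0..T})"
    if "T > 0" "continuous_on {-1..0} f" for T f
  proof -
    have "(\<lambda>t. signed_integral borel_I ((\<lambda>t\<in>{0..T}. \<kappa> t) t) f) \<in> borel_measurable (lebesgue_on {0..T})"
      using paths[OF that(1)] that(2) unfolding measure_paths_def by blast
    then show ?thesis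
      by (rule measurable_cong[THEN iffD1, rotated]) (simp add: space_restrict_space)
  qed
qed (rule assms(1))

theorem proposition7p1:
  fixes M :: "'w measure"
    and \<theta> :: "real \<Rightarrow> 'w \<Rightarrow> 'w"
    and \<mu> :: "'w \<Rightarrow> real set \<Rightarrow> real"
    and K :: real
  assumes mds: "metric_dynamical_system M \<theta>"
    and K_pos: "K > 0"
    and family: "\<And>\<omega>. \<omega> \<in> space M \<Longrightarrow> \<mu> \<omega> \<in> delay_measures K"
    and paths: "\<And>T \<omega>. T > 0 \<Longrightarrow> \<omega> \<in> space M \<Longrightarrow>
          (\<lambda>t\<in>{0..T}. \<mu> (\<theta> t \<omega>)) \<in> measure_paths K T"
    and paths_measurable: "\<And>T. T > 0 \<Longrightarrow>
          (\<lambda>\<omega>. \<lambda>t\<in>{0..T}. \<mu> (\<theta> t \<omega>)) \<in> M \<rightarrow>\<^sub>M path_space K T"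
  shows "\<forall>t\<ge>0. \<forall>u0\<in>AC (-1) 0.
    (\<lambda>\<omega>. delay_cocycle \<theta> \<mu> \<omega> t u0) \<in> M \<rightarrow>\<^sub>M AC_borel (-1) 0"
proof (intro allI impI ballI)
  fix t :: real and u0 assume "t \<ge> 0" and "u0 \<in> AC (-1) 0"
  then have u0: "abs_continuous_on_Icc (-1) 0 u0" by (simp add: AC_def)
  define \<kappa> where "\<kappa> \<omega> \<tau> = \<mu> (\<theta> \<tau> \<omega>)" for \<omega> \<tau>
  have path: "delay_path K (\<kappa> \<omega>)" if "\<omega> \<in> space M" for \<omega>
    using K_pos paths[OF _ that] by (intro delay_path_of_measure_paths) (simp_all add: \<kappa>_def)
  have poly: "(\<lambda>\<omega>. delay_path.accumulated (\<kappa> \<omega>) p s) \<in> borel_measurable M"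
    if p: "real_polynomial_function p" and "s > 0" for p s
  proof -
    have "(\<lambda>x\<in>{-1..s}. p x) \<in> AC (-1) s"
      using abs_continuous_cong[OF _ real_polynomial_abs_continuous[OF p], of "-1" s "\<lambda>x\<in>{-1..s}. p x"]
      by (simp add: AC_def)
    then have "(\<lambda>\<omega>. path_functional (\<lambda>x\<in>{-1..s}. p x) s (\<lambda>\<tau>\<in>{0..s}. \<mu> (\<theta> \<tau> \<omega>))) \<in> borel_measurable M"
      using \<open>s > 0\<close> by (intro measurable_compose[OF paths_measurable path_functional_measurable]) auto
    then show ?thesis
    proof (rule measurable_cong[THEN iffD1, rotated])
      fix \<omega> assume "\<omega> \<in> space M"
      then show "path_functional (\<lambda>x\<in>{-1..s}. p x) s (\<lambda>\<tau>\<in>{0..s}. \<mu> (\<theta> \<tau> \<omega>)) = delay_path.accumulated (\<kappa> \<omega>) p s"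
        using path_functional_restrict[OF path, of \<omega> s s p] \<open>s > 0\<close> by (simp add: \<kappa>_def)
    qed
  qed
  have picard: "(\<lambda>\<omega>. delay_path.picard (\<kappa> \<omega>) u0 n s) \<in> borel_measurable M" for n s
  proof (induction n arbitrary: s)
    case 0
    have "(\<lambda>\<omega>. u0 (min s 0)) \<in> borel_measurable M" by simp
    then show ?case
      by (rule measurable_cong[THEN iffD1, rotated]) (simp add: delay_path.picard.simps[OF path])
  next
    case (Suc n)
    have "(\<lambda>\<omega>. if s \<le> 0 then u0 s else u0 0 + delay_path.accumulated (\<kappa> \<omega>) (delay_path.picard (\<kappa> \<omega>) u0 n) s)
        \<in> borel_measurable M"
    proof (cases "s > 0")
      case True
      have "(\<lambda>\<omega>. delay_path.accumulated (\<kappa> \<omega>) (delay_path.picard (\<kappa> \<omega>) u0 n) s) \<in> borel_measurable M"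
        by (rule accumulated_random_measurable[OF _ _ True _ Suc.IH])
          (assumption | rule path poly[OF _ True] delay_path.picard_continuous[OF path u0 True])+
      then show ?thesis using True by simp
    qed simp
    then show ?case
      by (rule measurable_cong[THEN iffD1, rotated])
        (simp add: delay_path.picard.simps[OF path] delay_path.integral_operator_def[OF path])
  qed
  have Z: "delay_cocycle \<theta> \<mu> \<omega> t u0 = (\<lambda>s\<in>{-1..0}. delay_path.solution (\<kappa> \<omega>) u0 (t + s))" if "\<omega> \<in> space M" for \<omega>
    using delay_path.delay_solution_eq[OF path[OF that] u0]
    by (simp add: delay_cocycle_def \<kappa>_def[abs_def])
  show "(\<lambda>\<omega>. delay_cocycle \<theta> \<mu> \<omega> t u0) \<in> M \<rightarrow>\<^sub>M AC_borel (-1) 0"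
  proof (rule AC_borel_measurableI)
    fix \<omega> assume \<omega>: "\<omega> \<in> space M"
    interpret delay_path K "\<kappa> \<omega>" by (rule path[OF \<omega>])
    have "abs_continuous_on_Icc (-1) 0 (\<lambda>s. solution u0 (t + s))"
      by (rule abs_continuous_translate[OF solution_abs_continuous[OF u0, of "t + 1"]]) (use \<open>t \<ge> 0\<close> in auto)
    then have "abs_continuous_on_Icc (-1) 0 (\<lambda>s\<in>{-1..0}. solution u0 (t + s))"
      by (rule abs_continuous_cong[rotated]) simp
    then show "delay_cocycle \<theta> \<mu> \<omega> t u0 \<in> AC (-1) 0"
      by (simp add: Z[OF \<omega>] AC_def)
  next
    fix s :: real assume s: "s \<in> {-1..0}"
    show "(\<lambda>\<omega>. delay_cocycle \<theta> \<mu> \<omega> t u0 s) \<in> borel_measurable M"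
    proof (rule borel_measurable_LIMSEQ_real[OF _ picard])
      fix \<omega> assume \<omega>: "\<omega> \<in> space M"
      show "(\<lambda>n. delay_path.picard (\<kappa> \<omega>) u0 n (t + s)) \<longlonglongrightarrow> delay_cocycle \<theta> \<mu> \<omega> t u0 s"
        using delay_path.picard_tendsto[OF path[OF \<omega>] u0, of "t + s"] s \<open>t \<ge> 0\<close> by (simp add: Z[OF \<omega>])
    qed
  qed simp
qed

end
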